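(* In the setting of the context (Laguerre system of the first kind with moving parameters, pairwise distinct $\xi_1,\dots,\xi_p$, and a fixed row index $\boldsymbol\lambda=(\boldsymbol n,\eta)\in\mathbb N_0^r\times\mathbb N_0$ near the diagonal, $N=|\boldsymbol n|+\eta$), let $\boldsymbol m\in\mathbb N_0^p$ satisfy $|\boldsymbol m|=N-1$. There is a function $\mathcal B^{\mathrm H}_{\boldsymbol\lambda,\boldsymbol m}$ on $\mathbb R$, given by the Rodrigues representation $$\mathcal B^{\mathrm H}_{\boldsymbol\lambda,\boldsymbol m}=\Bigl(\prod_{i=1}^p(\xi_i+\partial_t)^{m_i}\Bigr)\Bigl(\prod_{h=1}^r\rho_h^{-n_h}K_{\rho_h,n_h}\Bigr)F,$$ such that the finite-$\tau$ representative $\mathcal B_\tau^{\mathrm L}$ satisfies $$\frac{c_\tau\varepsilon_\tau^{\eta}}{Z_\tau}\mathcal B_\tau^{\mathrm L}(x_\tau(t))\xrightarrow[\tau\to+\infty]{}\mathcal B^{\mathrm H}_{\boldsymbol\lambda,\boldsymbol m}(t)$$ in the sense of distributions (after extension by zero outside $(-\varepsilon_\tau^{-1},\infty)$). For every $k\in\mathbb N_0$ and $1\le i\le p$, $$\int_{-\varepsilon_\tau^{-1}}^\infty t^k(1+\varepsilon_\tau t)^{\beta_i(\tau)}\frac{c_\tau\varepsilon_\tau^\eta}{Z_\tau}\mathcal B_\tau^{\mathrm L}(x_\tau(t))\,\mathrm dt\xrightarrow[\tau\to+\infty]{}\int_{\mathbb R}t^k\mathrm e^{\xi_it}\mathcal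 B^{\mathrm H}_{\boldsymbol\lambda,\boldsymbol m}(t)\,\mathrm dt.$$ For $\operatorname{Re}z>-\min_{1\le h\le r}\rho_h$ when $r>0$, and for all $z\in\mathbb C$ when $r=0$, $$\int_{\mathbb R}\mathrm e^{zt}\mathcal B^{\mathrm H}_{\boldsymbol\lambda,\boldsymbol m}(t)\,\mathrm dt=L_F(z)\frac{\prod_{i=1}^p(\xi_i-z)^{m_i}}{\prod_{h=1}^r(\rho_h+z)^{n_h}}.$$ It also satisfies $$\int_{\mathbb R}t^k\mathrm e^{\xi_it}\mathcal B^{\mathrm H}_{\boldsymbol\lambda,\boldsymbol m}(t)\,\mathrm dt=0,\qquad0\le k<m_i,\quad1\le i\le p.$$
   Context: Moving parameters: $r\ge0$, $q=r+1$, $p\ge1$; for all large $\tau$, $a_\nu(\tau)>-1$ ($1\le\nu\le q$), $b_h(\tau)>a_h(\tau)$ ($1\le h\le r$). $\varepsilon_\tau=\sqrt{2/\tau}$, $c_\tau=\tau$, $x_\tau(t)=c_\tau(1+\varepsilon_\tau t)$. Assume $a_q(\tau)+1=\tau+\sqrt{2\tau}\,\widehat a_*+\mathrm O(1)$; $\varepsilon_\tau(a_h(\tau)+1)\to\rho_h>0$, $b_h(\tau)-a_h(\tau)\to d_h\ge0$ ($1\le h\le r$); $\varepsilon_\tau\beta_i(\tau)\to\xi_i$ with $\xi_i+\rho_h>0$ for all $i,h$; $\xi_1,\dots,\xi_p$ real and pairwise distinct. $Z_\tau=\prod_{\nu=1}^q\Gamma(a_\nu(\tau)+1)/\prod_{h=1}^r\Gamma(b_h(\tau)+1)$.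 Near the diagonal means any two entries of $(n_1,\dots,n_r,\eta)$ differ by at most one (this is what the paper calls Laguerre admissible in this case). $\mathcal B_\tau^{\mathrm L}$ is the function on $(0,\infty)$ with Mellin transform $\int_0^\infty x^{z-1}\mathcal B_\tau^{\mathrm L}(x)\,\mathrm dx=\dfrac{\prod_{\nu=1}^q\Gamma(z+a_\nu(\tau))}{\prod_{h=1}^r\Gamma(z+b_h(\tau)+n_h)}\prod_{i=1}^p(\beta_i(\tau)+1-z)_{m_i}$, where $(a)_k=a(a+1)\cdots(a+k-1)$. $\phi_a(t)=\pi^{-1/2}\mathrm e^{-(t-a)^2}$; $(K_{\rho,d}f)(t)=\int_0^\infty\frac{\rho^d}{\Gamma(d)}u^{d-1}\mathrm e^{-\rho u}f(t+u)\,\mathrm du$ for $\rho,d>0$, $K_{\rho,0}=I$; $F=K_{\rho_1,d_1}\cdots K_{\rho_r,d_r}\phi_{\widehat a_*}$; $L_F(z)=\int_{\mathbb R}\mathrm e^{zt}F(t)\,\mathrm dt=\mathrm e^{\widehat a_*z+z^2/4}\prod_{h=1}^r\bigl(\rho_h/(\rho_h+z)\bigr)^{d_h}$ (powers positive on the real axis to the right of every $-\rho_h$). *)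

theory Defs
  imports "HOL-Analysis.Analysis" "HOL-Library.Landau_Symbols"
begin

definition has_mellin :: "(real \<Rightarrow> real) \<Rightarrow> complex \<Rightarrow> complex \<Rightarrow> bool" where
  "has_mellin f z M \<longleftrightarrow>
     set_integrable lborel {0<..} (\<lambda>x. of_real x powr (z - 1) * complex_of_real (f x)) \<and>
     (LINT x:{0<..}|lborel. of_real x powr (z - 1) * complex_of_real (f x)) = M"

text \<open>The exponent carries a plus sign: the kernel is \<open>exp (z * t)\<close>.\<close>

definition bilateral_laplace :: "(real \<Rightarrow> real) \<Rightarrow> complex \<Rightarrow> complex" where
  "bilateral_laplace f z = (LINT t|lborel. exp (z * of_real t) * complex_of_real (f t))"

definition bilateral_laplace_exists :: "(real \<Rightarrow> real) \<Rightarrow> complex \<Rightarrow> bool" where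
  "bilateral_laplace_exists f z \<longleftrightarrow>
     integrable lborel (\<lambda>t. exp (z * of_real t) * complex_of_real (f t))"

definition smooth :: "(real \<Rightarrow> real) \<Rightarrow> bool" where
  "smooth f \<longleftrightarrow> (\<forall>k. (deriv ^^ k) f differentiable_on UNIV)"

definition test_fun :: "(real \<Rightarrow> real) \<Rightarrow> bool" where
  "test_fun \<phi> \<longleftrightarrow> smooth \<phi> \<and> compact (closure {t. \<phi> t \<noteq> 0})"

definition locally_integrable :: "(real \<Rightarrow> real) \<Rightarrow> bool" where
  "locally_integrable f \<longleftrightarrow> (\<forall>C. compact C \<longrightarrow> set_integrable lborel C f)"

definition tendsto_distr ::
    "(real \<Rightarrow> real \<Rightarrow> real) \<Rightarrow> (real \<Rightarrow> real) \<Rightarrow> real filter \<Rightarrow> bool" where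
  "tendsto_distr f g Fl \<longleftrightarrow>
     (\<forall>\<^sub>F \<tau> in Fl. locally_integrable (f \<tau>)) \<and> locally_integrable g \<and>
     (\<forall>\<phi>. test_fun \<phi> \<longrightarrow>
        ((\<lambda>\<tau>. LINT t|lborel. f \<tau> t * \<phi> t) \<longlongrightarrow> (LINT t|lborel. g t * \<phi> t)) Fl)"

definition gauss :: "real \<Rightarrow> real \<Rightarrow> real" where
  "gauss a t = exp (- (t - a)\<^sup>2) / sqrt pi"

definition K_op :: "real \<Rightarrow> real \<Rightarrow> (real \<Rightarrow> real) \<Rightarrow> real \<Rightarrow> real" where
  "K_op \<rho> d f t =
     (if d = 0 then f t
      else (LINT u:{0<..}|lborel.
              \<rho> powr d / Gamma d * u powr (d - 1) * exp (- \<rho> * u) * f (t + u)))"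

text \<open>\<open>K\<^bsub>\<rho>\<^sub>1,d\<^sub>1\<^esub> \<cdots> K\<^bsub>\<rho>\<^sub>r,d\<^sub>r\<^esub> \<phi>\<^sub>a\<close>\<close>

definition F_fun :: "nat \<Rightarrow> (nat \<Rightarrow> real) \<Rightarrow> (nat \<Rightarrow> real) \<Rightarrow> real \<Rightarrow> real \<Rightarrow> real" where
  "F_fun r \<rho> d a = foldr (\<lambda>h. K_op (\<rho> h) (d h)) [1..<Suc r] (gauss a)"

text \<open>\<open>(\<Prod>\<^sub>h \<rho>\<^sub>h\<^bsup>-n\<^sub>h\<^esup> K\<^bsub>\<rho>\<^sub>h,n\<^sub>h\<^esub>) f\<close>\<close>

definition K_part :: "nat \<Rightarrow> (nat \<Rightarrow> real) \<Rightarrow> (nat \<Rightarrow> nat) \<Rightarrow> (real \<Rightarrow> real) \<Rightarrow> real \<Rightarrow> real" where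
  "K_part r \<rho> n =
     foldr (\<lambda>h f t. inverse (\<rho> h ^ n h) * K_op (\<rho> h) (real (n h)) f t) [1..<Suc r]"

text \<open>\<open>(\<Prod>\<^sub>i (\<xi>\<^sub>i + \<partial>\<^sub>t)\<^bsup>m\<^sub>i\<^esup>) f\<close>\<close>

definition D_part :: "nat \<Rightarrow> (nat \<Rightarrow> real) \<Rightarrow> (nat \<Rightarrow> nat) \<Rightarrow> (real \<Rightarrow> real) \<Rightarrow> real \<Rightarrow> real" where
  "D_part p \<xi> m =
     foldr (\<lambda>i. (\<lambda>f t. \<xi> i * f t + deriv f t) ^^ m i) [1..<Suc p]"

definition eps :: "real \<Rightarrow> real" where
  "eps \<tau> = sqrt (2 / \<tau>)"

definition ctr :: "real \<Rightarrow> real" where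
  "ctr \<tau> = \<tau>"

definition x_map :: "real \<Rightarrow> real \<Rightarrow> real" where
  "x_map \<tau> t = ctr \<tau> * (1 + eps \<tau> * t)"

definition Z_norm :: "nat \<Rightarrow> (nat \<Rightarrow> real \<Rightarrow> real) \<Rightarrow> (nat \<Rightarrow> real \<Rightarrow> real) \<Rightarrow> real \<Rightarrow> real" where
  "Z_norm r a b \<tau> =
     (\<Prod>\<nu>=1..r+1. Gamma (a \<nu> \<tau> + 1)) / (\<Prod>h=1..r. Gamma (b h \<tau> + 1))"

definition near_diagonal :: "nat \<Rightarrow> (nat \<Rightarrow> nat) \<Rightarrow> nat \<Rightarrow> bool" where
  "near_diagonal r n \<eta> \<longleftrightarrow>
     (\<forall>x \<in> insert \<eta> (n ` {1..r}). \<forall>y \<in> insert \<eta> (n ` {1..r}). x \<le> y + 1)"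

text \<open>\<open>B\<close> is, up to null sets, the function on the half-line with the prescribed Mellin
  transform; the half-plane below lies to the right of all poles of the Gamma factors in the
  numerator. Values of \<open>B\<close> outside \<open>{0<..}\<close> play no role.\<close>

definition laguerre_rep ::
  "nat \<Rightarrow> nat \<Rightarrow> (nat \<Rightarrow> real) \<Rightarrow> (nat \<Rightarrow> real) \<Rightarrow> (nat \<Rightarrow> real) \<Rightarrow>
   (nat \<Rightarrow> nat) \<Rightarrow> (nat \<Rightarrow> nat) \<Rightarrow> (real \<Rightarrow> real) \<Rightarrow> bool" where
  "laguerre_rep r p a b \<beta> n m B \<longleftrightarrow>
     (\<forall>z::complex. (\<forall>\<nu>\<in>{1..r+1}. Re z > - a \<nu>) \<longrightarrow>
        has_mellin B z
          ((\<Prod>\<nu>=1..r+1. Gamma (z + of_real (a \<nu>)))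
             / (\<Prod>h=1..r. Gamma (z + of_real (b h) + of_nat (n h)))
           * (\<Prod>i=1..p. pochhammer (of_real (\<beta> i) + 1 - z) (m i))))"

definition rescaled ::
  "nat \<Rightarrow> (nat \<Rightarrow> real \<Rightarrow> real) \<Rightarrow> (nat \<Rightarrow> real \<Rightarrow> real) \<Rightarrow> nat \<Rightarrow>
   (real \<Rightarrow> real \<Rightarrow> real) \<Rightarrow> real \<Rightarrow> real \<Rightarrow> real" where
  "rescaled r a b \<eta> B \<tau> t = ctr \<tau> * eps \<tau> ^ \<eta> / Z_norm r a b \<tau> * B \<tau> (x_map \<tau> t)"

end

theory Submission
  imports Defs "HOL-Complex_Analysis.Complex_Analysis" "HOL-Probability.Probability" "HOL-Real_Asymp.Real_Asymp"
begin

text \<open>In the logarithmic chart \<open>x = \<tau> * exp (e * y)\<close>, \<open>e = eps \<tau>\<close>, the rescaled function becomes a function \<open>G\<close>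
  whose two-sided Laplace transform at \<open>s\<close> is, up to normalisation, the given Mellin transform at \<open>1 + s / e\<close>.
  The quotient with \<open>a\<^sub>q\<close> tends to \<open>exp (ahat * s + s\<^sup>2 / 4)\<close> (Laplace's method), each quotient
  \<open>Gamma (s / e + a\<^sub>h + 1) / Gamma (s / e + b\<^sub>h + n\<^sub>h + 1)\<close> to a power of \<open>\<rho>\<^sub>h + s\<close> and the Pochhammer symbols to
  powers of \<open>\<xi>\<^sub>i - s\<close>, so the transforms converge to that of the Rodrigues function. They are dominated on the imaginary
  axis by a multiple of \<open>1 / (1 + u\<^sup>2)\<close>, and Parseval's formula turns this into distributional convergence.
  A moment of order \<open>k\<close> is a \<open>k\<close>-th difference quotient with step \<open>e\<close> of the transform of \<open>G\<close>; since locally uniform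
  convergence of holomorphic functions is inherited by difference quotients, it tends to the \<open>k\<close>-th derivative of the
  limit transform. For \<open>k < m\<^sub>i\<close> the Pochhammer symbol vanishes at all nodes, which gives the orthogonality.\<close>

section \<open>Two-sided Laplace transforms\<close>

text \<open>Stirling's formula is avoided. Every Gamma quotient is read as an integral against a
  positive density: Euler's integral in the chart for the large parameter, the Beta integral for
  each pair \<open>a\<^sub>h\<close>, \<open>b\<^sub>h\<close>. Limits become dominated convergence,
  and the modulus on a vertical line is at most the value at the real point. This gives no decay in
  u, yet the Pochhammer symbols grow like a power of u and the Parseval integrand must be dominated
  uniformly in \<tau>; hence an arbitrary power of decay is extracted from the functional equation.
  Distributional convergence tests only compactly supported functions and says nothing about
  moments. These need a second argument, based at points that move with \<tau>; for that reason the
  transforms are shown to converge along every convergent sequence of arguments, not just pointwise.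
  Limits in \<tau> are taken along sequences, where dominated convergence and compactness arguments
  apply, and are returned to the filter at infinity at the end.\<close>

lemma integral_has_field_derivative:
  fixes F F' :: "'a::{real_normed_field, banach, second_countable_topology} \<Rightarrow> 'b \<Rightarrow> 'a"
  assumes r: "r > 0"
    and int: "\<And>x. x \<in> ball x0 r \<Longrightarrow> integrable M (F x)"
    and der: "\<And>x u. x \<in> ball x0 r \<Longrightarrow> u \<in> space M \<Longrightarrow> ((\<lambda>x. F x u) has_field_derivative F' x u) (at x)"
    and bnd: "\<And>x u. x \<in> ball x0 r \<Longrightarrow> u \<in> space M \<Longrightarrow> norm (F' x u) \<le> g u"
    and g: "integrable M g"
  shows "((\<lambda>x. integral\<^sup>L M (F x)) has_field_derivative integral\<^sup>L M (F' x0)) (at x0)"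
proof -
  have x0: "x0 \<in> ball x0 r" using r by simp
  \<comment> \<open>The mean value inequality on the convex ball makes \<open>g\<close> a bound for
    the difference quotients as well; it is the dominating function below.\<close>
  have quot: "norm ((F x u - F x0 u) / (x - x0)) \<le> g u"
    if "x \<in> ball x0 r" "x \<noteq> x0" "u \<in> space M" for x u
  proof -
    have "norm (F x u - F x0 u) \<le> g u * norm (x - x0)"
      by (rule field_differentiable_bound[of "ball x0 r" "\<lambda>x. F x u" "\<lambda>x. F' x u"])
         (use that x0 der bnd in \<open>auto intro: has_field_derivative_at_within\<close>)
    then show ?thesis using that by (simp add: norm_divide divide_le_eq)
  qed
  have main: "(\<lambda>n. integral\<^sup>L M (\<lambda>u. (F (X n) u - F x0 u) / (X n - x0))) \<longlonglongrightarrow> integral\<^sup>L M (F' x0)"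
    if X: "\<And>n. X n \<in> ball x0 r" "\<And>n. X n \<noteq> x0" "X \<longlonglongrightarrow> x0" for X
  proof (rule integral_dominated_convergence[where w = g])
    have lim: "(\<lambda>n. (F (X n) u - F x0 u) / (X n - x0)) \<longlonglongrightarrow> F' x0 u" if "u \<in> space M" for u
    proof -
      have "((\<lambda>x. (F x u - F x0 u) / (x - x0)) \<longlongrightarrow> F' x0 u) (at x0)"
        using der[OF x0 that] by (simp add: has_field_derivative_iff)
      then show ?thesis
        unfolding tendsto_at_iff_sequentially using X by (auto simp: o_def)
    qed
    then show "AE u in M. (\<lambda>n. (F (X n) u - F x0 u) / (X n - x0)) \<longlonglongrightarrow> F' x0 u" by simp
    have ms: "(\<lambda>u. (F (X n) u - F x0 u) / (X n - x0)) \<in> borel_measurable M" for n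
      using int[OF X(1)[of n]] int[OF x0] X(2)[of n]
      by (intro borel_measurable_integrable integrable_divide Bochner_Integration.integrable_diff) auto
    then show "(\<lambda>u. (F (X n) u - F x0 u) / (X n - x0)) \<in> borel_measurable M" for n .
    show "F' x0 \<in> borel_measurable M"
      by (rule borel_measurable_LIMSEQ_metric[OF ms lim])
    show "AE u in M. norm ((F (X n) u - F x0 u) / (X n - x0)) \<le> g u" for n
      using quot[OF X(1) X(2)] by simp
  qed (fact g)
  show ?thesis
    unfolding has_field_derivative_iff tendsto_at_iff_sequentially
  proof (intro allI impI)
    fix X :: "nat \<Rightarrow> 'a" assume X: "\<forall>i. X i \<in> UNIV - {x0}" "X \<longlonglongrightarrow> x0"
    \<comment> \<open>A sequence tending to \<open>x0\<close> may start outside the ball, so an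
      initial segment is dropped and restored by \<open>LIMSEQ_offset\<close>.\<close>
    obtain N where N: "\<And>n. n \<ge> N \<Longrightarrow> X n \<in> ball x0 r"
      using X(2) r unfolding lim_sequentially by (metis dist_commute mem_ball)
    have "(\<lambda>n. integral\<^sup>L M (\<lambda>u. (F (X (n + N)) u - F x0 u) / (X (n + N) - x0))) \<longlonglongrightarrow> integral\<^sup>L M (F' x0)"
      by (rule main) (use X N in \<open>auto intro: LIMSEQ_ignore_initial_segment\<close>)
    also have "(\<lambda>n. integral\<^sup>L M (\<lambda>u. (F (X (n + N)) u - F x0 u) / (X (n + N) - x0))) =
       (\<lambda>n. (integral\<^sup>L M (F (X (n + N))) - integral\<^sup>L M (F x0)) / (X (n + N) - x0))"
      using int N x0 X by (intro ext) (auto simp: Bochner_Integration.integral_diff)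
    finally show "((\<lambda>x. (integral\<^sup>L M (F x) - integral\<^sup>L M (F x0)) / (x - x0)) \<circ> X) \<longlonglongrightarrow> integral\<^sup>L M (F' x0)"
      unfolding o_def by (rule LIMSEQ_offset)
  qed
qed

lemma bilateral_laplace_exists_iff:
  assumes [measurable]: "f \<in> borel_measurable borel"
  shows "bilateral_laplace_exists f z \<longleftrightarrow> integrable lborel (\<lambda>t. exp (Re z * t) * f t)"
proof -
  have "bilateral_laplace_exists f z \<longleftrightarrow>
      integrable lborel (\<lambda>t. norm (exp (z * of_real t) * complex_of_real (f t)))"
    unfolding bilateral_laplace_exists_def by (rule integrable_norm_iff[symmetric]) measurable
  also have "(\<lambda>t. norm (exp (z * of_real t) * complex_of_real (f t))) = (\<lambda>t. norm (exp (Re z * t) * f t))"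
    by (simp add: norm_mult abs_mult)
  also have "integrable lborel \<dots> \<longleftrightarrow> integrable lborel (\<lambda>t. exp (Re z * t) * f t)"
    by (rule integrable_norm_iff) measurable
  finally show ?thesis .
qed

text \<open>Provides one majorant for the z-derivative of exp (z t) over a whole disc about
  \<sigma>: one \<delta> pays for moving x, another for the factor t, so the two exponents sit at
  distance 2 \<delta>.\<close>

lemma abs_times_exp_le:
  fixes \<sigma> \<delta> x t :: real
  assumes "\<bar>x - \<sigma>\<bar> \<le> \<delta>" "\<delta> > 0"
  shows "\<bar>t\<bar> * exp (x * t) \<le> (exp ((\<sigma> + 2 * \<delta>) * t) + exp ((\<sigma> - 2 * \<delta>) * t)) / \<delta>"
proof -
  have 1: "\<delta> * \<bar>t\<bar> \<le> exp (\<delta> * \<bar>t\<bar>)" using exp_ge_add_one_self[of "\<delta> * \<bar>t\<bar>"] by linarith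
  have "x * t \<le> \<sigma> * t + \<delta> * \<bar>t\<bar>"
  proof -
    have "(x - \<sigma>) * t \<le> \<bar>x - \<sigma>\<bar> * \<bar>t\<bar>" by (metis abs_ge_self abs_mult)
    also have "\<dots> \<le> \<delta> * \<bar>t\<bar>" using assms by (intro mult_right_mono) auto
    finally show ?thesis by (simp add: algebra_simps)
  qed
  then have "exp (x * t) \<le> exp (\<sigma> * t + \<delta> * \<bar>t\<bar>)" by simp
  with 1 have "(\<delta> * \<bar>t\<bar>) * exp (x * t) \<le> exp (\<delta> * \<bar>t\<bar>) * exp (\<sigma> * t + \<delta> * \<bar>t\<bar>)"
    by (intro mult_mono) auto
  also have "\<dots> = exp (\<sigma> * t + 2 * \<delta> * \<bar>t\<bar>)" by (simp add: exp_add [symmetric] algebra_simps)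
  also have "\<dots> \<le> exp ((\<sigma> + 2 * \<delta>) * t) + exp ((\<sigma> - 2 * \<delta>) * t)"
  proof (cases "t \<ge> 0")
    case True
    then have "\<sigma> * t + 2 * \<delta> * \<bar>t\<bar> = (\<sigma> + 2 * \<delta>) * t" by (simp add: algebra_simps)
    then show ?thesis by simp
  next
    case False
    then have "\<sigma> * t + 2 * \<delta> * \<bar>t\<bar> = (\<sigma> - 2 * \<delta>) * t" by (simp add: algebra_simps)
    then show ?thesis by simp
  qed
  finally show ?thesis using assms by (simp add: field_simps)
qed

lemma bilateral_laplace_has_field_derivative:
  assumes [measurable]: "f \<in> borel_measurable borel"
    and S: "open S" and int: "\<And>\<sigma>. \<sigma> \<in> S \<Longrightarrow> integrable lborel (\<lambda>t. exp (\<sigma> * t) * f t)"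
    and z0: "Re z0 \<in> S"
  shows "(bilateral_laplace f has_field_derivative bilateral_laplace (\<lambda>t. t * f t) z0) (at z0)"
proof -
  define \<sigma> where "\<sigma> = Re z0"
  obtain e where e: "e > 0" "\<And>x. \<bar>x - \<sigma>\<bar> < e \<Longrightarrow> x \<in> S"
    using S z0 unfolding open_real \<sigma>_def by metis
  \<comment> \<open>A third, because the exponents \<open>\<sigma> + 2 * \<delta>\<close> and
    \<open>\<sigma> - 2 * \<delta>\<close> of the majorant must stay in \<open>S\<close>.\<close>
  define \<delta> where "\<delta> = e / 3"
  have \<delta>: "\<delta> > 0" "2 * \<delta> < e" using e(1) by (auto simp: \<delta>_def)
  have dist: "\<bar>Re z - \<sigma>\<bar> < \<delta>" if "z \<in> ball z0 \<delta>" for z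
  proof -
    have "\<bar>Re (z - z0)\<bar> \<le> norm (z - z0)" by (rule abs_Re_le_cmod)
    also have "\<dots> < \<delta>" using that by (simp add: dist_norm norm_minus_commute)
    finally show ?thesis by (simp add: \<sigma>_def)
  qed
  let ?F = "\<lambda>z t. exp (z * of_real t) * complex_of_real (f t)"
  let ?F' = "\<lambda>z t. of_real t * exp (z * of_real t) * complex_of_real (f t)"
  let ?g = "\<lambda>t. (\<bar>exp ((\<sigma> + 2 * \<delta>) * t) * f t\<bar> + \<bar>exp ((\<sigma> - 2 * \<delta>) * t) * f t\<bar>) / \<delta>"
  have "((\<lambda>z. integral\<^sup>L lborel (?F z)) has_field_derivative integral\<^sup>L lborel (?F' z0)) (at z0)"
  proof (rule integral_has_field_derivative[OF \<delta>(1), where g = ?g])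
    fix z assume z: "z \<in> ball z0 \<delta>"
    have "integrable lborel (\<lambda>t. exp (Re z * t) * f t)"
      using dist[OF z] \<delta> by (intro int e(2)) linarith
    then show "integrable lborel (?F z)"
      using bilateral_laplace_exists_iff[of f z] by (simp add: bilateral_laplace_exists_def)
    fix t :: real
    show "((\<lambda>z. ?F z t) has_field_derivative ?F' z t) (at z)"
      by (auto intro!: derivative_eq_intros)
    have "norm (?F' z t) = (\<bar>t\<bar> * exp (Re z * t)) * \<bar>f t\<bar>" by (simp add: norm_mult)
    also have "\<dots> \<le> (exp ((\<sigma> + 2 * \<delta>) * t) + exp ((\<sigma> - 2 * \<delta>) * t)) / \<delta> * \<bar>f t\<bar>"
      by (rule mult_right_mono[OF abs_times_exp_le]) (use dist[OF z] \<delta> in auto)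
    also have "\<dots> = ?g t" by (simp add: abs_mult field_simps)
    finally show "norm (?F' z t) \<le> ?g t" .
  next
    show "integrable lborel ?g"
      by (intro integrable_divide_zero Bochner_Integration.integrable_add integrable_abs int e(2))
         (use \<delta> in auto)
  qed
  then show ?thesis unfolding bilateral_laplace_def by (simp add: mult_ac)
qed

lemma bilateral_laplace_holomorphic:
  assumes "f \<in> borel_measurable borel" "open S"
    and "\<And>\<sigma>. \<sigma> \<in> S \<Longrightarrow> integrable lborel (\<lambda>t. exp (\<sigma> * t) * f t)"
  shows "bilateral_laplace f holomorphic_on {z. Re z \<in> S}"
proof (rule holomorphic_onI)
  fix z assume "z \<in> {z. Re z \<in> S}"
  then have "(bilateral_laplace f has_field_derivative bilateral_laplace (\<lambda>t. t * f t) z) (at z)"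
    using bilateral_laplace_has_field_derivative[OF assms] by simp
  then show "bilateral_laplace f field_differentiable at z within {z. Re z \<in> S}"
    unfolding field_differentiable_def by (blast intro: has_field_derivative_at_within)
qed

lemma of_real_islimpt_strip:
  assumes "open S" "(\<sigma>::real) \<in> S"
  shows "complex_of_real \<sigma> islimpt (of_real ` S)"
proof -
  have "\<sigma> islimpt S" using assms by (simp add: interior_limit_point interior_open)
  then show ?thesis unfolding islimpt_approachable
    by (metis (no_types, lifting) dist_of_real imageI of_real_eq_iff)
qed

text \<open>The identity theorem reduces a complex transform to a real integral: both sides are
  holomorphic on the vertical strip over \<open>S\<close>, connected because \<open>S\<close> is
  convex, and agree on its real points. The closed forms for the kernels below are obtained this
  way.\<close>

lemma bilateral_laplace_eqI:
  assumes f: "f \<in> borel_measurable borel"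
    and S: "open S" "convex S" and int: "\<And>\<sigma>. \<sigma> \<in> S \<Longrightarrow> integrable lborel (\<lambda>t. exp (\<sigma> * t) * f t)"
    and H: "H holomorphic_on {z. Re z \<in> S}"
    and eq: "\<And>\<sigma>. \<sigma> \<in> S \<Longrightarrow> (LINT t|lborel. exp (\<sigma> * t) * f t) = g \<sigma>"
    and gH: "\<And>\<sigma>. \<sigma> \<in> S \<Longrightarrow> H (of_real \<sigma>) = of_real (g \<sigma>)"
    and z: "Re z \<in> S"
  shows "bilateral_laplace f z = H z"
proof -
  let ?D = "{z. Re z \<in> S}"
  have op: "open ?D" using open_vimage[OF S(1) continuous_on_Re[OF continuous_on_id]] by (simp add: vimage_def)
  have "convex ?D"
    using convex_linear_vimage[OF bounded_linear.linear[OF bounded_linear_Re] S(2)] by (simp add: vimage_def)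
  then have con: "connected ?D" by (rule convex_connected)
  have hol: "(\<lambda>z. bilateral_laplace f z - H z) holomorphic_on ?D"
    by (intro holomorphic_intros H bilateral_laplace_holomorphic f S(1) int)
  have "bilateral_laplace f z - H z = 0"
  proof (rule analytic_continuation[OF hol op con, where U = "of_real ` S" and \<xi> = "of_real (Re z)"])
    fix w :: complex assume "w \<in> of_real ` S"
    then obtain \<sigma> where w: "w = of_real \<sigma>" "\<sigma> \<in> S" by auto
    have "bilateral_laplace f w = (LINT t|lborel. complex_of_real (exp (\<sigma> * t) * f t))"
      unfolding bilateral_laplace_def w by (simp flip: exp_of_real)
    also have "\<dots> = of_real (g \<sigma>)" by (simp only: integral_complex_of_real eq[OF w(2)])
    finally show "bilateral_laplace f w - H w = 0" using gH[OF w(2)] w by simp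
  qed (use z S in \<open>auto intro: of_real_islimpt_strip\<close>)
  then show ?thesis by simp
qed

lemma set_integrable_lborel_iff_absolutely_integrable:
  fixes f :: "real \<Rightarrow> 'a::euclidean_space"
  assumes "set_borel_measurable lborel S f"
  shows "set_integrable lborel S f \<longleftrightarrow> f absolutely_integrable_on S"
  using assms unfolding set_integrable_def set_borel_measurable_def
  by (simp add: integrable_completion)

text \<open>Transfers the change of variables for absolutely integrable functions to the Borel
  measure; for Borel measurable integrands the two notions of integrability and the two integrals
  coincide.\<close>

lemma lborel_substitution:
  fixes f :: "real \<Rightarrow> 'a::euclidean_space" and g h :: "real \<Rightarrow> real"
  assumes S[measurable]: "S \<in> sets borel" and T: "T = g ` S"
    and der: "\<And>x. x \<in> S \<Longrightarrow> (g has_real_derivative h x) (at x)"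
    and inj: "inj_on g S"
    and f: "set_borel_measurable lborel T f"
    and g[measurable]: "g \<in> borel_measurable borel" and h[measurable]: "h \<in> borel_measurable borel"
  shows "set_integrable lborel S (\<lambda>x. \<bar>h x\<bar> *\<^sub>R f (g x)) \<longleftrightarrow> set_integrable lborel T f"
    and "set_integrable lborel T f \<Longrightarrow>
      (LINT x:S|lborel. \<bar>h x\<bar> *\<^sub>R f (g x)) = (LINT x:T|lborel. f x)"
proof -
  \<comment> \<open>Only the restriction of \<open>f\<close> to \<open>T\<close> is known to be
    measurable; inserting the indicator of \<open>T\<close> at \<open>g x\<close> changes nothing on
    \<open>S\<close> and keeps the composition measurable.\<close>
  have "(\<lambda>x. indicator S x *\<^sub>R (\<bar>h x\<bar> *\<^sub>R (indicator T (g x) *\<^sub>R f (g x)))) \<in> borel_measurable borel"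
  proof -
    have [measurable]: "(\<lambda>x. indicator T x *\<^sub>R f x) \<in> borel_measurable borel"
      using f by (simp add: set_borel_measurable_def)
    show ?thesis by measurable
  qed
  also have "(\<lambda>x. indicator S x *\<^sub>R (\<bar>h x\<bar> *\<^sub>R (indicator T (g x) *\<^sub>R f (g x)))) =
      (\<lambda>x. indicator S x *\<^sub>R (\<bar>h x\<bar> *\<^sub>R f (g x)))"
    by (auto simp: T indicator_def fun_eq_iff)
  finally have m: "set_borel_measurable lborel S (\<lambda>x. \<bar>h x\<bar> *\<^sub>R f (g x))"
    by (simp add: set_borel_measurable_def)
  have cov: "(\<lambda>x. \<bar>h x\<bar> *\<^sub>R f (g x)) absolutely_integrable_on S \<and> integral S (\<lambda>x. \<bar>h x\<bar> *\<^sub>R f (g x)) = b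
          \<longleftrightarrow> f absolutely_integrable_on T \<and> integral T f = b" for b
    unfolding T
    by (rule has_absolute_integral_change_of_variables_real)
       (use der inj in \<open>auto intro: has_field_derivative_at_within\<close>)
  show iff: "set_integrable lborel S (\<lambda>x. \<bar>h x\<bar> *\<^sub>R f (g x)) \<longleftrightarrow> set_integrable lborel T f"
    using cov set_integrable_lborel_iff_absolutely_integrable[OF m]
      set_integrable_lborel_iff_absolutely_integrable[OF f] by blast
  assume *: "set_integrable lborel T f"
  then show "(LINT x:S|lborel. \<bar>h x\<bar> *\<^sub>R f (g x)) = (LINT x:T|lborel. f x)"
    using cov[of "integral T f"] set_integrable_lborel_iff_absolutely_integrable[OF f]
    by (simp add: set_borel_integral_eq_integral iff)
qed

section \<open>Transforms of the Gamma, Beta and Gaussian kernels\<close>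

definition gamma_kernel :: "real \<Rightarrow> real \<Rightarrow> real" where
  "gamma_kernel d u = (if u > 0 then u powr (d - 1) else 0)"

text \<open>The Beta density (1 - t)^(D - 1) pulled back by t = exp (- u). For small u it behaves
  like \<open>gamma_kernel D\<close>, which is how a Gamma quotient degenerates to a power.\<close>

definition beta_kernel :: "real \<Rightarrow> real \<Rightarrow> real" where
  "beta_kernel D u = (if u > 0 then (1 - exp (- u)) powr (D - 1) else 0)"

lemma measurable_kernels [measurable]:
  "gamma_kernel d \<in> borel_measurable borel" "beta_kernel d \<in> borel_measurable borel"
  unfolding gamma_kernel_def[abs_def] beta_kernel_def[abs_def] by measurable

lemma kernels_nonneg [simp]: "gamma_kernel d u \<ge> 0" "beta_kernel d u \<ge> 0"
  by (auto simp: gamma_kernel_def beta_kernel_def)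

lemma gamma_kernel_real:
  assumes d: "d > 0" and s: "s > 0"
  shows "has_bochner_integral lborel (\<lambda>u. exp (- s * u) * gamma_kernel d u) (Gamma d / s powr d)"
proof -
  have 1: "has_bochner_integral lborel (\<lambda>u. exp (- u) * gamma_kernel d u) (Gamma d)"
  proof (rule has_bochner_integral_nn_integral)
    have "ennreal (Gamma d) = (\<integral>\<^sup>+ t. ennreal (indicator {0..} t * t powr (d - 1) / exp t) \<partial>lborel)"
      by (rule Gamma_conv_nn_integral_real[OF d])
    also have "\<dots> = (\<integral>\<^sup>+ u. ennreal (exp (- u) * gamma_kernel d u) \<partial>lborel)"
    proof (rule nn_integral_cong_AE)
      show "AE t in lborel. ennreal (indicator {0..} t * t powr (d - 1) / exp t) = ennreal (exp (- t) * gamma_kernel d t)"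
        using AE_lborel_singleton[of "0::real"]
        by eventually_elim (auto simp: gamma_kernel_def indicator_def exp_minus divide_inverse mult.commute)
    qed
    finally show "(\<integral>\<^sup>+ u. ennreal (exp (- u) * gamma_kernel d u) \<partial>lborel) = ennreal (Gamma d)" ..
  qed (use d in \<open>auto simp: Gamma_real_pos less_imp_le\<close>)
  have "has_bochner_integral lborel (\<lambda>u. exp (- (0 + s * u)) * gamma_kernel d (0 + s * u)) (Gamma d /\<^sub>R \<bar>s\<bar>)"
    using 1 s by (subst lborel_has_bochner_integral_real_affine_iff[symmetric]) auto
  then have "has_bochner_integral lborel
      (\<lambda>u. inverse (s powr (d - 1)) * (exp (- (0 + s * u)) * gamma_kernel d (0 + s * u)))
      (inverse (s powr (d - 1)) * (Gamma d /\<^sub>R \<bar>s\<bar>))"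
    by (intro has_bochner_integral_mult_right)
  also have "(\<lambda>u. inverse (s powr (d - 1)) * (exp (- (0 + s * u)) * gamma_kernel d (0 + s * u))) =
      (\<lambda>u. exp (- s * u) * gamma_kernel d u)"
    using s by (auto simp: gamma_kernel_def fun_eq_iff powr_mult zero_less_mult_iff)
  also have "inverse (s powr (d - 1)) * (Gamma d /\<^sub>R \<bar>s\<bar>) = Gamma d / s powr d"
    using s by (simp add: powr_diff divide_simps)
  finally show ?thesis .
qed

text \<open>The argument is \<open>- z\<close> because the transform integrates against exp of plus
  z t. The principal power is holomorphic on the right half-plane, so the real formula
  extends.\<close>

lemma gamma_kernel_laplace:
  assumes d: "d > 0" and z: "Re z > 0"
  shows "bilateral_laplace_exists (gamma_kernel d) (- z)"
    and "bilateral_laplace (gamma_kernel d) (- z) = of_real (Gamma d) * z powr (- of_real d)"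
proof -
  have int: "integrable lborel (\<lambda>u. exp (s * u) * gamma_kernel d u)" if "s \<in> {..<0}" for s
    using gamma_kernel_real[OF d, of "- s"] that by (auto simp: has_bochner_integral_iff)
  show "bilateral_laplace_exists (gamma_kernel d) (- z)"
    using int[of "- Re z"] z by (subst bilateral_laplace_exists_iff) auto
  have "bilateral_laplace (gamma_kernel d) (- z) = (\<lambda>w. of_real (Gamma d) * (- w) powr (- of_real d)) (- z)"
  proof (rule bilateral_laplace_eqI[where S = "{..<0}"])
    show "(\<lambda>w. complex_of_real (Gamma d) * (- w) powr (- of_real d)) holomorphic_on {z. Re z \<in> {..<0}}"
      by (intro holomorphic_intros) (auto simp: complex_nonpos_Reals_iff)
    fix s :: real assume s: "s \<in> {..<0}"
    show "(LINT t|lborel. exp (s * t) * gamma_kernel d t) = Gamma d * (- s) powr (- d)"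
      using gamma_kernel_real[OF d, of "- s"] s
      by (auto simp: has_bochner_integral_iff powr_minus field_simps)
    show "complex_of_real (Gamma d) * (- complex_of_real s) powr (- complex_of_real d) =
        of_real (Gamma d * (- s) powr (- d))"
      using s powr_of_real[of "- s" "- d"] by simp
  qed (use int z in auto)
  then show "bilateral_laplace (gamma_kernel d) (- z) = of_real (Gamma d) * z powr (- of_real d)" by simp
qed

text \<open>Euler's Beta integral in the variable u = - ln t; the Jacobian exp (- u) raises t^(s -
  1) to exp (- s u).\<close>

lemma beta_kernel_real:
  assumes D: "D > 0" and s: "s > 0"
  shows "has_bochner_integral lborel (\<lambda>u. exp (- s * u) * beta_kernel D u) (Beta s D)"
proof -
  let ?f = "\<lambda>t::real. t powr (s - 1) * (1 - t) powr (D - 1)"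
  have I: "set_integrable lborel {0..1} ?f" by (rule integrable_Beta[OF s D])
  have J: "(LINT t:{0..1}|lborel. ?f t) = Beta s D"
    using has_integral_Beta_real[OF s D] set_borel_integral_eq_integral(2)[OF I]
    by (simp add: integral_unique)
  have ae: "AE t in lborel. indicat_real {0..1} t *\<^sub>R ?f t = indicat_real {0<..<1} t *\<^sub>R ?f t"
    using AE_lborel_singleton[of "0::real"] AE_lborel_singleton[of "1::real"]
    by eventually_elim (auto simp: indicator_def)
  have I': "set_integrable lborel {0<..<1} ?f"
    by (rule set_integrable_subset[OF I]) auto
  have J': "(LINT t:{0<..<1}|lborel. ?f t) = Beta s D"
    unfolding J[symmetric] set_lebesgue_integral_def
    by (rule integral_cong_AE) (use ae in auto)
  have im: "{0<..<1} = (\<lambda>u::real. exp (- u)) ` {0<..}"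
  proof (intro equalityI subsetI)
    fix x :: real assume "x \<in> {0<..<1}"
    then show "x \<in> (\<lambda>u::real. exp (- u)) ` {0<..}"
      by (intro image_eqI[of _ _ "- ln x"]) auto
  qed auto
  have m: "set_borel_measurable lborel {0<..<1} ?f"
    unfolding set_borel_measurable_def by measurable
  note sub = lborel_substitution[of "{0<..}" "{0<..<1}" "\<lambda>u. exp (- u)" "\<lambda>u. - exp (- u)" ?f, OF _ im _ _ m]
  have eq: "indicator {0<..} u *\<^sub>R (\<bar>- exp (- u)\<bar> *\<^sub>R ?f (exp (- u))) = exp (- s * u) * beta_kernel D u" for u :: real
  proof (cases "u > 0")
    case True
    have "exp (- u) * exp ((s - 1) * (- u)) = exp (- s * u)"
      unfolding exp_add[symmetric] by (simp add: algebra_simps)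
    then show ?thesis using True by (simp add: beta_kernel_def powr_def flip: mult.assoc)
  qed (simp add: beta_kernel_def)
  have "set_integrable lborel {0<..} (\<lambda>u. \<bar>- exp (- u)\<bar> *\<^sub>R ?f (exp (- u)))"
    by (subst sub(1)) (use I' in \<open>auto intro!: derivative_eq_intros inj_onI\<close>)
  moreover have "(LINT u:{0<..}|lborel. \<bar>- exp (- u)\<bar> *\<^sub>R ?f (exp (- u))) = Beta s D"
    by (subst sub(2)) (use I' J' in \<open>auto intro!: derivative_eq_intros inj_onI\<close>)
  ultimately show ?thesis
    unfolding has_bochner_integral_iff set_integrable_def set_lebesgue_integral_def eq by simp
qed

lemma beta_kernel_laplace:
  assumes D: "D > 0" and z: "Re z > 0"
  shows "bilateral_laplace_exists (beta_kernel D) (- z)"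
    and "bilateral_laplace (beta_kernel D) (- z) = of_real (Gamma D) * Gamma z * rGamma (z + of_real D)"
proof -
  have int: "integrable lborel (\<lambda>u. exp (s * u) * beta_kernel D u)" if "s \<in> {..<0}" for s
    using beta_kernel_real[OF D, of "- s"] that by (auto simp: has_bochner_integral_iff)
  show "bilateral_laplace_exists (beta_kernel D) (- z)"
    using int[of "- Re z"] z by (subst bilateral_laplace_exists_iff) auto
  have "bilateral_laplace (beta_kernel D) (- z) =
      (\<lambda>w. of_real (Gamma D) * Gamma (- w) * rGamma (- w + of_real D)) (- z)"
  proof (rule bilateral_laplace_eqI[where S = "{..<0}"])
    have "w \<notin> \<int>\<^sub>\<le>\<^sub>0" if "Re w > 0" for w :: complex
      using that by (auto elim!: nonpos_Ints_cases)
    then show "(\<lambda>w. complex_of_real (Gamma D) * Gamma (- w) * rGamma (- w + of_real D)) holomorphic_on {z. Re z \<in> {..<0}}"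
      by (intro holomorphic_intros) auto
    fix s :: real assume s: "s \<in> {..<0}"
    show "(LINT t|lborel. exp (s * t) * beta_kernel D t) = Beta (- s) D"
      using beta_kernel_real[OF D, of "- s"] s by (auto simp: has_bochner_integral_iff)
    show "complex_of_real (Gamma D) * Gamma (- complex_of_real s) * rGamma (- complex_of_real s + of_real D) = of_real (Beta (- s) D)"
      using s Gamma_complex_of_real[of "- s"] rGamma_complex_of_real[of "- s + D"]
      by (simp add: Beta_altdef)
  qed (use int z in auto)
  then show "bilateral_laplace (beta_kernel D) (- z) = of_real (Gamma D) * Gamma z * rGamma (z + of_real D)" by simp
qed

lemma gauss_eq_normal_density: "gauss a = normal_density a (1 / sqrt 2)"
proof
  fix t
  have 1: "2 * (1 / sqrt 2)\<^sup>2 = (1::real)" and 2: "2 * pi * (1 / sqrt 2)\<^sup>2 = pi"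
    by (simp_all add: power_divide)
  show "gauss a t = normal_density a (1 / sqrt 2) t"
    unfolding gauss_def normal_density_def 1 2 by simp
qed

lemma gauss_laplace:
  shows "bilateral_laplace_exists (gauss a) z"
    and "bilateral_laplace (gauss a) z = exp (of_real a * z + z\<^sup>2 / 4)"
proof -
  have [measurable]: "gauss a \<in> borel_measurable borel" unfolding gauss_eq_normal_density by measurable
  \<comment> \<open>Completing the square: an exponential tilt of a Gaussian is a multiple of the
    Gaussian centred at \<open>a + s / 2\<close>.\<close>
  have eq: "exp (s * t) * gauss a t = exp (a * s + s\<^sup>2 / 4) * normal_density (a + s / 2) (1 / sqrt 2) t" for s t
  proof -
    have "s * t + - (t - a)\<^sup>2 = (a * s + s\<^sup>2 / 4) + - (t - (a + s / 2))\<^sup>2"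
      by (simp add: power2_eq_square field_simps)
    then show ?thesis
      unfolding gauss_eq_normal_density[symmetric] gauss_def times_divide_eq_right exp_add[symmetric] by (simp only:)
  qed
  have int: "integrable lborel (\<lambda>t. exp (s * t) * gauss a t)" for s
    unfolding eq by simp
  show "bilateral_laplace_exists (gauss a) z"
    using int by (subst bilateral_laplace_exists_iff) auto
  show "bilateral_laplace (gauss a) z = exp (of_real a * z + z\<^sup>2 / 4)"
  proof (rule bilateral_laplace_eqI[where S = UNIV and g = "\<lambda>s. exp (a * s + s\<^sup>2 / 4)"])
    show "(\<lambda>z. exp (of_real a * z + z\<^sup>2 / 4)) holomorphic_on {z. Re z \<in> UNIV}"
      by (intro holomorphic_intros) auto
    fix s
    show "(LINT t|lborel. exp (s * t) * gauss a t) = exp (a * s + s\<^sup>2 / 4)"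
      unfolding eq by simp
    show "exp (of_real a * of_real s + (of_real s)\<^sup>2 / 4) = complex_of_real (exp (a * s + s\<^sup>2 / 4))"
      by (simp flip: exp_of_real)
  qed (use int in auto)
qed

section \<open>Exponentially decaying functions\<close>

lemma power_le_fact_exp:
  fixes x :: real
  assumes "x \<ge> 0" shows "x ^ k \<le> fact k * exp x"
proof -
  have "x ^ k / fact k \<le> (\<Sum>n. x ^ n /\<^sub>R fact n)"
  proof -
    have "(\<Sum>n\<in>{k}. x ^ n /\<^sub>R fact n) \<le> (\<Sum>n. x ^ n /\<^sub>R fact n)"
      by (rule sum_le_suminf) (use assms summable_exp_generic[of x] in auto)
    then show ?thesis by (simp add: divide_inverse mult.commute)
  qed
  also have "\<dots> = exp x" by (simp add: exp_def)
  finally show ?thesis by (simp add: divide_le_eq mult.commute)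
qed

lemma integrable_exp_abs:
  fixes \<delta> :: real
  assumes "\<delta> > 0" shows "integrable lborel (\<lambda>t. exp (- \<delta> * \<bar>t\<bar>))"
proof -
  have 1: "integrable lborel (\<lambda>u. exp (- \<delta> * u) * gamma_kernel 1 u)"
    using gamma_kernel_real[of 1 \<delta>] assms by (simp add: has_bochner_integral_iff)
  have 2: "integrable lborel (\<lambda>u. exp (- \<delta> * (0 + -1 * u)) * gamma_kernel 1 (0 + -1 * u))"
    by (rule lborel_integrable_real_affine[OF 1]) simp
  have ae: "AE u in lborel. exp (- \<delta> * u) * gamma_kernel 1 u + exp (- \<delta> * (0 + -1 * u)) * gamma_kernel 1 (0 + -1 * u)
      = exp (- \<delta> * \<bar>u\<bar>)"
    using AE_lborel_singleton[of "0::real"] by eventually_elim (auto simp: gamma_kernel_def)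
  show ?thesis
    by (rule integrable_cong_AE_imp[OF Bochner_Integration.integrable_add[OF 1 2]]) (use ae in auto)
qed

text \<open>Only one-sided bounds appear, but for every \<sigma> in \<open>S\<close>; when
  \<open>S\<close> is open, two neighbours of \<sigma> yield decay in both directions. Since
  \<open>deriv\<close> is total, the first clause demands genuine differentiability of all orders.
  On the strips used below, the operators of the Rodrigues formula preserve this class.\<close>

definition decaying :: "real set \<Rightarrow> (real \<Rightarrow> real) \<Rightarrow> bool" where
  "decaying S f \<longleftrightarrow>
     (\<forall>k t. ((deriv ^^ k) f has_real_derivative (deriv ^^ Suc k) f t) (at t)) \<and>
     (\<forall>\<sigma>\<in>S. \<forall>k. \<exists>C. \<forall>t. exp (\<sigma> * t) * \<bar>(deriv ^^ k) f t\<bar> \<le> C)"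

text \<open>A candidate family for the derivatives is supplied, so the iterates of
  \<open>deriv\<close> never have to be computed.\<close>

lemma decayingI:
  assumes 0: "g 0 = f"
    and d: "\<And>k t. (g k has_real_derivative g (Suc k) t) (at t)"
    and b: "\<And>\<sigma> k. \<sigma> \<in> S \<Longrightarrow> \<exists>C. \<forall>t. exp (\<sigma> * t) * \<bar>g k t\<bar> \<le> C"
  shows "decaying S f"
proof -
  have "(deriv ^^ k) f = g k" for k
  proof (induction k)
    case (Suc k)
    then show ?case using d by (auto intro!: ext DERIV_imp_deriv)
  qed (use 0 in simp)
  then show ?thesis using d b unfolding decaying_def by metis
qed

lemma decaying_has_derivative:
  assumes "decaying S f"
  shows "((deriv ^^ k) f has_real_derivative (deriv ^^ Suc k) f t) (at t)"
  using assms by (auto simp: decaying_def)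

lemma decaying_bound:
  assumes "decaying S f" "\<sigma> \<in> S"
  obtains C where "C \<ge> 0" "\<And>t. exp (\<sigma> * t) * \<bar>(deriv ^^ k) f t\<bar> \<le> C"
proof -
  obtain C where C: "\<And>t. exp (\<sigma> * t) * \<bar>(deriv ^^ k) f t\<bar> \<le> C"
    using assms unfolding decaying_def by blast
  have "C \<ge> exp (\<sigma> * 0) * \<bar>(deriv ^^ k) f 0\<bar>" by (rule C)
  then have "C \<ge> 0" by (simp add: order_trans[OF abs_ge_zero])
  with C that show ?thesis by blast
qed

lemma decaying_smooth: "decaying S f \<Longrightarrow> smooth f"
  unfolding smooth_def decaying_def differentiable_on_def
  by (metis differentiable_at_withinI real_differentiable_def)

lemma decaying_isCont: "decaying S f \<Longrightarrow> isCont ((deriv ^^ k) f) t"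
  using decaying_has_derivative DERIV_isCont by blast

lemma decaying_measurable: "decaying S f \<Longrightarrow> (deriv ^^ k) f \<in> borel_measurable borel"
  by (intro borel_measurable_continuous_onI continuous_at_imp_continuous_on ballI) (rule decaying_isCont)

lemma decaying_deriv:
  assumes "decaying S f" shows "decaying S (deriv f)"
proof -
  have "(deriv ^^ k) (deriv f) = (deriv ^^ Suc k) f" for k by (simp only: funpow_Suc_right o_apply)
  then show ?thesis using assms unfolding decaying_def by metis
qed

lemma decaying_linear:
  assumes f: "decaying S f" and h: "decaying S h"
  shows "decaying S (\<lambda>t. a * f t + b * h t)"
proof (rule decayingI[where g = "\<lambda>k t. a * (deriv ^^ k) f t + b * (deriv ^^ k) h t"])
  fix k t
  show "((\<lambda>t. a * (deriv ^^ k) f t + b * (deriv ^^ k) h t) has_real_derivative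
      a * (deriv ^^ Suc k) f t + b * (deriv ^^ Suc k) h t) (at t)"
    using decaying_has_derivative[OF f] decaying_has_derivative[OF h]
    by (intro DERIV_add DERIV_cmult) auto
next
  fix \<sigma> k assume \<sigma>: "\<sigma> \<in> S"
  obtain C where C: "\<And>t. exp (\<sigma> * t) * \<bar>(deriv ^^ k) f t\<bar> \<le> C" using decaying_bound[OF f \<sigma>] by metis
  obtain D where D: "\<And>t. exp (\<sigma> * t) * \<bar>(deriv ^^ k) h t\<bar> \<le> D" using decaying_bound[OF h \<sigma>] by metis
  show "\<exists>C. \<forall>t. exp (\<sigma> * t) * \<bar>a * (deriv ^^ k) f t + b * (deriv ^^ k) h t\<bar> \<le> C"
  proof (intro exI allI)
    fix t
    have "exp (\<sigma> * t) * \<bar>a * (deriv ^^ k) f t + b * (deriv ^^ k) h t\<bar> \<le>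
        exp (\<sigma> * t) * (\<bar>a\<bar> * \<bar>(deriv ^^ k) f t\<bar> + \<bar>b\<bar> * \<bar>(deriv ^^ k) h t\<bar>)"
      by (intro mult_left_mono) (auto intro: order_trans[OF abs_triangle_ineq] simp: abs_mult)
    also have "\<dots> = \<bar>a\<bar> * (exp (\<sigma> * t) * \<bar>(deriv ^^ k) f t\<bar>) + \<bar>b\<bar> * (exp (\<sigma> * t) * \<bar>(deriv ^^ k) h t\<bar>)"
      by (simp add: algebra_simps)
    also have "\<dots> \<le> \<bar>a\<bar> * C + \<bar>b\<bar> * D" by (intro add_mono mult_left_mono C D) auto
    finally show "exp (\<sigma> * t) * \<bar>a * (deriv ^^ k) f t + b * (deriv ^^ k) h t\<bar> \<le> \<bar>a\<bar> * C + \<bar>b\<bar> * D" .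
  qed
qed simp

text \<open>The bound at \<sigma> + \<delta> controls t \<ge> 0 and the bound at \<sigma> - \<delta>
  controls t < 0.\<close>

lemma decaying_two_sided:
  assumes S: "open S" and f: "decaying S f" and \<sigma>: "\<sigma> \<in> S"
  obtains C \<delta> where "\<delta> > 0" "\<And>t. exp (\<sigma> * t) * \<bar>(deriv ^^ k) f t\<bar> \<le> C * exp (- \<delta> * \<bar>t\<bar>)"
proof -
  obtain e where e: "e > 0" "\<And>x. \<bar>x - \<sigma>\<bar> < e \<Longrightarrow> x \<in> S"
    using S \<sigma> unfolding open_real by metis
  define \<delta> where "\<delta> = e / 2"
  have \<delta>: "\<delta> > 0" and s: "\<sigma> + \<delta> \<in> S" "\<sigma> - \<delta> \<in> S" using e by (auto simp: \<delta>_def)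
  obtain C where C: "C \<ge> 0" "\<And>t. exp ((\<sigma> + \<delta>) * t) * \<bar>(deriv ^^ k) f t\<bar> \<le> C" using decaying_bound[OF f s(1)] by metis
  obtain D where D: "D \<ge> 0" "\<And>t. exp ((\<sigma> - \<delta>) * t) * \<bar>(deriv ^^ k) f t\<bar> \<le> D" using decaying_bound[OF f s(2)] by metis
  have "exp (\<sigma> * t) * \<bar>(deriv ^^ k) f t\<bar> \<le> (C + D) * exp (- \<delta> * \<bar>t\<bar>)" for t
  proof (cases "t \<ge> 0")
    case True
    then have "exp (\<sigma> * t) = exp ((\<sigma> + \<delta>) * t) * exp (- \<delta> * \<bar>t\<bar>)"
      unfolding exp_add[symmetric] by (simp add: algebra_simps)
    then have "exp (\<sigma> * t) * \<bar>(deriv ^^ k) f t\<bar> = (exp ((\<sigma> + \<delta>) * t) * \<bar>(deriv ^^ k) f t\<bar>) * exp (- \<delta> * \<bar>t\<bar>)"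
      by simp
    also have "\<dots> \<le> (C + D) * exp (- \<delta> * \<bar>t\<bar>)"
      by (rule mult_right_mono) (use C(2)[of t] D(1) in linarith, simp)
    finally show ?thesis .
  next
    case False
    then have "exp (\<sigma> * t) = exp ((\<sigma> - \<delta>) * t) * exp (- \<delta> * \<bar>t\<bar>)"
      unfolding exp_add[symmetric] by (simp add: algebra_simps)
    then have "exp (\<sigma> * t) * \<bar>(deriv ^^ k) f t\<bar> = (exp ((\<sigma> - \<delta>) * t) * \<bar>(deriv ^^ k) f t\<bar>) * exp (- \<delta> * \<bar>t\<bar>)"
      by simp
    also have "\<dots> \<le> (C + D) * exp (- \<delta> * \<bar>t\<bar>)"
      by (rule mult_right_mono) (use D(2)[of t] C(1) in linarith, simp)
    finally show ?thesis .
  qed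
  with \<delta> that show ?thesis by blast
qed

lemma decaying_moment_integrable:
  assumes S: "open S" and f: "decaying S f" and \<sigma>: "\<sigma> \<in> S"
  shows "integrable lborel (\<lambda>t. t ^ k * exp (\<sigma> * t) * f t)"
proof -
  have [measurable]: "f \<in> borel_measurable borel" using decaying_measurable[OF f, of 0] by simp
  obtain C \<delta> where \<delta>: "\<delta> > 0" and C: "\<And>t. exp (\<sigma> * t) * \<bar>f t\<bar> \<le> C * exp (- \<delta> * \<bar>t\<bar>)"
    using decaying_two_sided[OF S f \<sigma>, of 0] by (metis funpow_0)
  \<comment> \<open>Half of the decay rate is spent on \<open>t ^ k\<close>, through (\<delta> / 2 *
    \<bar>t\<bar>)^k \<le> k! exp (\<delta> / 2 * \<bar>t\<bar>).\<close>
  define K where "K = fact k * (2 / \<delta>) ^ k"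
  have "C * exp (- \<delta> * \<bar>0\<bar>) \<ge> 0" by (rule order_trans[OF _ C]) simp
  then have C0: "C \<ge> 0" by simp
  show ?thesis
  proof (rule Bochner_Integration.integrable_bound)
    show "integrable lborel (\<lambda>t. K * C * exp (- (\<delta> / 2) * \<bar>t\<bar>))"
      by (intro integrable_mult_right integrable_exp_abs) (use \<delta> in auto)
    show "AE t in lborel. norm (t ^ k * exp (\<sigma> * t) * f t) \<le> norm (K * C * exp (- (\<delta> / 2) * \<bar>t\<bar>))"
    proof (rule AE_I2)
      fix t :: real
      have "(\<delta> / 2 * \<bar>t\<bar>) ^ k \<le> fact k * exp (\<delta> / 2 * \<bar>t\<bar>)" using \<delta> by (intro power_le_fact_exp) auto
      then have "\<bar>t\<bar> ^ k * (\<delta> / 2) ^ k \<le> fact k * exp (\<delta> / 2 * \<bar>t\<bar>)"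
        by (simp add: power_mult_distrib power_divide mult.commute)
      then have "\<bar>t\<bar> ^ k \<le> K * exp (\<delta> / 2 * \<bar>t\<bar>)"
        using \<delta> by (simp add: K_def power_divide field_simps)
      then have "\<bar>t\<bar> ^ k * (exp (\<sigma> * t) * \<bar>f t\<bar>) \<le> K * exp (\<delta> / 2 * \<bar>t\<bar>) * (C * exp (- \<delta> * \<bar>t\<bar>))"
        using C0 \<delta> by (intro mult_mono[OF _ C]) (auto simp: K_def)
      also have "\<dots> = K * C * exp (- (\<delta> / 2) * \<bar>t\<bar>)"
      proof -
        have "exp (\<delta> / 2 * \<bar>t\<bar>) * exp (- \<delta> * \<bar>t\<bar>) = exp (- (\<delta> / 2) * \<bar>t\<bar>)"
          unfolding exp_add[symmetric] by (simp add: algebra_simps)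
        then show ?thesis by (metis (no_types, opaque_lifting) mult.assoc mult.left_commute)
      qed
      also have "\<dots> \<le> norm \<dots>" by simp
      finally show "norm (t ^ k * exp (\<sigma> * t) * f t) \<le> norm (K * C * exp (- (\<delta> / 2) * \<bar>t\<bar>))"
        by (simp add: abs_mult power_abs mult_ac)
    qed
  qed measurable
qed

lemma decaying_integrable:
  assumes "open S" "decaying S f" "\<sigma> \<in> S"
  shows "integrable lborel (\<lambda>t. exp (\<sigma> * t) * f t)"
  using decaying_moment_integrable[OF assms, of 0] by simp

lemma decaying_laplace_exists:
  assumes "open S" "decaying S f" "Re z \<in> S"
  shows "bilateral_laplace_exists f z"
  using decaying_integrable[OF assms] decaying_measurable[OF assms(2), of 0]
  by (subst bilateral_laplace_exists_iff) auto

text \<open>Integration by parts in the form of the fundamental theorem for exp (z t) f(t), whose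
  boundary values vanish by the two-sided decay.\<close>

lemma laplace_deriv:
  assumes S: "open S" and f: "decaying S f" and z: "Re z \<in> S"
  shows "bilateral_laplace (deriv f) z = - z * bilateral_laplace f z"
proof -
  let ?F = "\<lambda>t. exp (z * of_real t) * complex_of_real (f t)"
  let ?G = "\<lambda>t. exp (z * of_real t) * complex_of_real (deriv f t)"
  have i1: "integrable lborel ?F"
    using decaying_laplace_exists[OF S f z] by (simp add: bilateral_laplace_exists_def)
  have i2: "integrable lborel ?G"
    using decaying_laplace_exists[OF S decaying_deriv[OF f] z] by (simp add: bilateral_laplace_exists_def)
  obtain C \<delta> where \<delta>: "\<delta> > 0" and C: "\<And>t. exp (Re z * t) * \<bar>f t\<bar> \<le> C * exp (- \<delta> * \<bar>t\<bar>)"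
    using decaying_two_sided[OF S f z, of 0] by (metis funpow_0)
  have nF: "norm (?F t) \<le> C * exp (- \<delta> * \<bar>t\<bar>)" for t using C[of t] by (simp add: norm_mult)
  have lim: "(?F \<longlongrightarrow> 0) at_top" "(?F \<longlongrightarrow> 0) at_bot"
  proof -
    have "((\<lambda>t. C * exp (- \<delta> * \<bar>t\<bar>)) \<longlongrightarrow> 0) at_top" "((\<lambda>t. C * exp (- \<delta> * \<bar>t\<bar>)) \<longlongrightarrow> 0) at_bot"
      using \<delta> by real_asymp+
    then show "(?F \<longlongrightarrow> 0) at_top" "(?F \<longlongrightarrow> 0) at_bot"
      by (auto intro!: Lim_null_comparison[of ?F] simp only: nF eventually_True)
  qed
  have d: "(f has_real_derivative deriv f t) (at t)" for t
    using decaying_has_derivative[OF f, of 0] by simp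
  have c: "isCont f t" "isCont (deriv f) t" for t
    using decaying_isCont[OF f, where k = 0] decaying_isCont[OF f, where k = 1] by auto
  have "(LBINT t=-\<infinity>..\<infinity>. z * ?F t + ?G t) = 0 - 0"
  proof (rule interval_integral_FTC_integrable)
    fix t :: real
    have "((\<lambda>t. exp (z * of_real t) * of_real (f t)) has_vector_derivative
        exp (z * of_real t) * of_real (deriv f t) + (z * exp (z * of_real t)) * of_real (f t)) (at t)"
    proof (rule has_vector_derivative_mult)
      have "((\<lambda>t. exp (z * t)) has_field_derivative z * exp (z * of_real t)) (at (of_real t))"
        by (auto intro!: derivative_eq_intros)
      from has_vector_derivative_real_field[OF this]
      show "((\<lambda>t. exp (z * of_real t)) has_vector_derivative z * exp (z * of_real t)) (at t)" .
      show "((\<lambda>t. complex_of_real (f t)) has_vector_derivative of_real (deriv f t)) (at t)"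
        using d[of t] by (simp add: has_real_derivative_iff_has_vector_derivative has_vector_derivative_of_real)
    qed
    then show "(?F has_vector_derivative z * ?F t + ?G t) (at t)" by (simp add: algebra_simps)
    show "isCont (\<lambda>t. z * ?F t + ?G t) t" by (intro continuous_intros c)
  next
    show "set_integrable lborel (einterval (- \<infinity>) \<infinity>) (\<lambda>t. z * ?F t + ?G t)"
      using i1 i2 by (simp add: set_integrable_def)
    show "((?F \<circ> real_of_ereal) \<longlongrightarrow> 0) (at_right (- \<infinity>))" "((?F \<circ> real_of_ereal) \<longlongrightarrow> 0) (at_left \<infinity>)"
      using lim by (simp_all add: ereal_tendsto_simps)
  qed simp
  then have "(LINT t|lborel. z * ?F t + ?G t) = 0"
    by (simp add: interval_lebesgue_integral_def set_lebesgue_integral_def)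
  then have "z * (LINT t|lborel. ?F t) + (LINT t|lborel. ?G t) = 0"
    using i1 i2 by (subst (asm) Bochner_Integration.integral_add) auto
  then show ?thesis unfolding bilateral_laplace_def by (simp add: eq_neg_iff_add_eq_0 add.commute)
qed

section \<open>The averaging operators and their transforms\<close>

lemma K_op_eq:
  assumes "d \<noteq> 0"
  shows "K_op \<rho> d f t = (LINT u|lborel. \<rho> powr d / Gamma d * (gamma_kernel d u * exp (- \<rho> * u) * f (t + u)))"
  unfolding K_op_def set_lebesgue_integral_def gamma_kernel_def if_not_P[OF assms]
  by (intro Bochner_Integration.integral_cong refl) (simp add: indicator_def)

lemma gamma_kernel_exp_integrable:
  assumes "d > 0" "\<sigma> > - \<rho>"
  shows "integrable lborel (\<lambda>u. gamma_kernel d u * exp (- \<rho> * u) * exp (- \<sigma> * u))"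
proof -
  have eq: "exp (- (\<rho> + \<sigma>) * u) * gamma_kernel d u = gamma_kernel d u * exp (- \<rho> * u) * exp (- \<sigma> * u)" for u
    by (simp add: exp_add[symmetric] algebra_simps)
  have "integrable lborel (\<lambda>u. exp (- (\<rho> + \<sigma>) * u) * gamma_kernel d u)"
    using gamma_kernel_real[OF assms(1), of "\<rho> + \<sigma>"] assms(2) by (simp add: has_bochner_integral_iff)
  then show ?thesis unfolding eq .
qed

text \<open>Differentiation under the integral falls on \<open>f\<close>, so the k-th derivative of
  the image is the image of the k-th derivative. The weight exp (- \<rho> u) meets a growth exp (-
  \<sigma> u), and the Gamma integral converges because \<sigma> > - \<rho>.\<close>

lemma decaying_K_op:
  assumes ne: "S \<noteq> {}" and sub: "S \<subseteq> {- \<rho><..}" and \<rho>: "\<rho> > 0" and d: "d \<ge> 0" and f: "decaying S f"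
  shows "decaying S (K_op \<rho> d f)"
proof (cases "d = 0")
  case True
  then show ?thesis using f by (simp add: K_op_def[abs_def])
next
  case False
  with d have d: "d > 0" by simp
  define c where "c = \<rho> powr d / Gamma d"
  have c: "c \<ge> 0" using d by (simp add: c_def Gamma_real_pos less_imp_le)
  note K = K_op_eq[OF False, of \<rho>, folded c_def]
  have [measurable]: "(deriv ^^ k) f \<in> borel_measurable borel" for k by (rule decaying_measurable[OF f])
  have bnd: "\<exists>C\<ge>0. \<forall>t. \<bar>(deriv ^^ k) f t\<bar> \<le> C * exp (- \<sigma> * t)" if \<sigma>: "\<sigma> \<in> S" for k \<sigma>
  proof -
    obtain C where C: "C \<ge> 0" "\<And>t. exp (\<sigma> * t) * \<bar>(deriv ^^ k) f t\<bar> \<le> C" using decaying_bound[OF f \<sigma>] by metis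
    have "\<bar>(deriv ^^ k) f t\<bar> \<le> C * exp (- \<sigma> * t)" for t
      using C(2)[of t] by (simp add: exp_minus field_simps)
    with C(1) show ?thesis by blast
  qed
  have int: "integrable lborel (\<lambda>u. c * (gamma_kernel d u * exp (- \<rho> * u) * (deriv ^^ k) f (t + u)))" for k t
  proof -
    obtain \<sigma> where \<sigma>: "\<sigma> \<in> S" using ne by auto
    obtain C where C: "C \<ge> 0" "\<And>t. \<bar>(deriv ^^ k) f t\<bar> \<le> C * exp (- \<sigma> * t)" using bnd[OF \<sigma>, of k] by auto
    show ?thesis
    proof (intro integrable_mult_right, rule Bochner_Integration.integrable_bound)
      show "integrable lborel (\<lambda>u. (C * exp (- \<sigma> * t)) * (gamma_kernel d u * exp (- \<rho> * u) * exp (- \<sigma> * u)))"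
        by (intro integrable_mult_right gamma_kernel_exp_integrable d) (use \<sigma> sub in auto)
      have "\<bar>gamma_kernel d u * exp (- \<rho> * u) * (deriv ^^ k) f (t + u)\<bar> \<le>
          (C * exp (- \<sigma> * t)) * (gamma_kernel d u * exp (- \<rho> * u) * exp (- \<sigma> * u))" for u
      proof -
        have "\<bar>gamma_kernel d u * exp (- \<rho> * u) * (deriv ^^ k) f (t + u)\<bar> \<le>
            gamma_kernel d u * exp (- \<rho> * u) * (C * exp (- \<sigma> * (t + u)))"
          by (simp only: abs_mult abs_exp_cancel abs_of_nonneg kernels_nonneg) (intro mult_left_mono C(2); simp)
        also have "exp (- \<sigma> * (t + u)) = exp (- \<sigma> * t) * exp (- \<sigma> * u)"
          by (simp add: exp_add[symmetric] algebra_simps)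
        finally show ?thesis by (simp add: mult_ac)
      qed
      then show "AE u in lborel. norm (gamma_kernel d u * exp (- \<rho> * u) * (deriv ^^ k) f (t + u)) \<le>
          norm ((C * exp (- \<sigma> * t)) * (gamma_kernel d u * exp (- \<rho> * u) * exp (- \<sigma> * u)))"
        by (intro AE_I2) (smt (verit) real_norm_def)
    qed measurable
  qed
  show ?thesis
  proof (rule decayingI[where g = "\<lambda>k. K_op \<rho> d ((deriv ^^ k) f)"])
    fix k t
    obtain \<sigma> where \<sigma>: "\<sigma> \<in> S" using ne by auto
    obtain C where C: "C \<ge> 0" "\<And>t. \<bar>(deriv ^^ Suc k) f t\<bar> \<le> C * exp (- \<sigma> * t)" using bnd[OF \<sigma>, of "Suc k"] by blast
    let ?F = "\<lambda>k t u. c * (gamma_kernel d u * exp (- \<rho> * u) * (deriv ^^ k) f (t + u))"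
    have "((\<lambda>t. LINT u|lborel. ?F k t u) has_real_derivative (LINT u|lborel. ?F (Suc k) t u)) (at t)"
    \<comment> \<open>For x in the unit ball about t, exp (- \<sigma> x) is at most exp
      (\<bar>\<sigma>\<bar> (\<bar>t\<bar> + 1)); this is the constant in the majorant.\<close>
    proof (rule integral_has_field_derivative[where r = 1 and
          g = "\<lambda>u. (c * C * exp (\<bar>\<sigma>\<bar> * (\<bar>t\<bar> + 1))) * (gamma_kernel d u * exp (- \<rho> * u) * exp (- \<sigma> * u))"])
      fix x u :: real assume x: "x \<in> ball t 1"
      show "integrable lborel (?F k x)" by (rule int)
      have "((\<lambda>x. (deriv ^^ k) f (x + u)) has_real_derivative (deriv ^^ Suc k) f (x + u)) (at x)"
        using decaying_has_derivative[OF f, of k "x + u"] by (simp add: DERIV_shift)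
      then show "((\<lambda>x. ?F k x u) has_real_derivative ?F (Suc k) x u) (at x)"
        by (intro DERIV_cmult)
      have "\<bar>x\<bar> \<le> \<bar>t\<bar> + 1" using x by (auto simp: dist_real_def)
      then have "\<bar>\<sigma>\<bar> * \<bar>x\<bar> \<le> \<bar>\<sigma>\<bar> * (\<bar>t\<bar> + 1)" by (rule mult_left_mono) simp
      moreover have "- \<sigma> * x \<le> \<bar>\<sigma>\<bar> * \<bar>x\<bar>" by (metis abs_ge_self abs_minus_cancel abs_mult)
      ultimately have "- \<sigma> * x \<le> \<bar>\<sigma>\<bar> * (\<bar>t\<bar> + 1)" by linarith
      then have "exp (- \<sigma> * x) \<le> exp (\<bar>\<sigma>\<bar> * (\<bar>t\<bar> + 1))" by simp
      then have e: "exp (- \<sigma> * (x + u)) \<le> exp (\<bar>\<sigma>\<bar> * (\<bar>t\<bar> + 1)) * exp (- \<sigma> * u)"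
        by (simp add: exp_add[symmetric] algebra_simps)
      have "\<bar>(deriv ^^ Suc k) f (x + u)\<bar> \<le> C * (exp (\<bar>\<sigma>\<bar> * (\<bar>t\<bar> + 1)) * exp (- \<sigma> * u))"
        by (rule order_trans[OF C(2)]) (intro mult_left_mono e C(1))
      then have "c * (gamma_kernel d u * exp (- \<rho> * u) * \<bar>(deriv ^^ Suc k) f (x + u)\<bar>) \<le>
          c * (gamma_kernel d u * exp (- \<rho> * u) * (C * (exp (\<bar>\<sigma>\<bar> * (\<bar>t\<bar> + 1)) * exp (- \<sigma> * u))))"
        by (intro mult_left_mono) (use c in auto)
      then show "norm (?F (Suc k) x u) \<le> (c * C * exp (\<bar>\<sigma>\<bar> * (\<bar>t\<bar> + 1))) * (gamma_kernel d u * exp (- \<rho> * u) * exp (- \<sigma> * u))"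
        using c by (simp add: abs_mult mult_ac del: funpow.simps)
    next
      show "integrable lborel (\<lambda>u. (c * C * exp (\<bar>\<sigma>\<bar> * (\<bar>t\<bar> + 1))) * (gamma_kernel d u * exp (- \<rho> * u) * exp (- \<sigma> * u)))"
        by (intro integrable_mult_right gamma_kernel_exp_integrable d) (use \<sigma> sub in auto)
    qed simp
    then show "(K_op \<rho> d ((deriv ^^ k) f) has_real_derivative K_op \<rho> d ((deriv ^^ Suc k) f) t) (at t)"
      unfolding K[abs_def] .
  next
    fix \<sigma> k assume \<sigma>: "\<sigma> \<in> S"
    obtain C where C: "C \<ge> 0" "\<And>t. \<bar>(deriv ^^ k) f t\<bar> \<le> C * exp (- \<sigma> * t)" using bnd[OF \<sigma>, of k] by auto
    let ?I = "LINT u|lborel. (c * C) * (gamma_kernel d u * exp (- \<rho> * u) * exp (- \<sigma> * u))"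
    have bd: "\<bar>K_op \<rho> d ((deriv ^^ k) f) t\<bar> \<le> exp (- \<sigma> * t) * ?I" for t
    proof -
      have "\<bar>K_op \<rho> d ((deriv ^^ k) f) t\<bar> \<le>
          (LINT u|lborel. \<bar>c * (gamma_kernel d u * exp (- \<rho> * u) * (deriv ^^ k) f (t + u))\<bar>)"
        unfolding K by (rule integral_abs_bound)
      also have "\<dots> \<le> (LINT u|lborel. exp (- \<sigma> * t) * ((c * C) * (gamma_kernel d u * exp (- \<rho> * u) * exp (- \<sigma> * u))))"
      proof (rule integral_mono)
        show "integrable lborel (\<lambda>u. exp (- \<sigma> * t) * ((c * C) * (gamma_kernel d u * exp (- \<rho> * u) * exp (- \<sigma> * u))))"
          by (intro integrable_mult_right gamma_kernel_exp_integrable d) (use \<sigma> sub in auto)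
        fix u
        have e: "exp (- \<sigma> * (t + u)) = exp (- \<sigma> * t) * exp (- \<sigma> * u)"
          by (simp add: exp_add[symmetric] algebra_simps)
        have "c * (gamma_kernel d u * exp (- \<rho> * u) * \<bar>(deriv ^^ k) f (t + u)\<bar>) \<le>
          c * (gamma_kernel d u * exp (- \<rho> * u) * (C * (exp (- \<sigma> * t) * exp (- \<sigma> * u))))"
          unfolding e[symmetric] by (intro mult_left_mono C) (use c in auto)
        then show "\<bar>c * (gamma_kernel d u * exp (- \<rho> * u) * (deriv ^^ k) f (t + u))\<bar> \<le>
            exp (- \<sigma> * t) * ((c * C) * (gamma_kernel d u * exp (- \<rho> * u) * exp (- \<sigma> * u)))"
          using c by (simp add: abs_mult mult_ac)
      qed (intro integrable_abs int)
      finally show ?thesis by simp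
    qed
    have "exp (\<sigma> * t) * \<bar>K_op \<rho> d ((deriv ^^ k) f) t\<bar> \<le> ?I" for t
    proof -
      have "exp (\<sigma> * t) * \<bar>K_op \<rho> d ((deriv ^^ k) f) t\<bar> \<le> exp (\<sigma> * t) * (exp (- \<sigma> * t) * ?I)"
        by (rule mult_left_mono[OF bd]) simp
      also have "\<dots> = ?I" unfolding mult.assoc[symmetric] exp_add[symmetric] by simp
      finally show ?thesis .
    qed
    then show "\<exists>C. \<forall>t. exp (\<sigma> * t) * \<bar>K_op \<rho> d ((deriv ^^ k) f) t\<bar> \<le> C" by blast
  qed simp
qed

text \<open>For a positive numerator and Re w > 0 the principal logarithm of the quotient splits
  without a multiple of 2 pi i. The transform of K is stated with a power of a quotient, while the
  Gamma integral produces separate powers.\<close>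

lemma powr_divide_right_half_plane:
  assumes "\<rho> > 0" "Re w > 0"
  shows "(of_real \<rho> / w) powr (of_real d) = of_real (\<rho> powr d) * w powr (- of_real d)"
proof -
  have w: "w \<noteq> 0" "w \<notin> \<real>\<^sub>\<le>\<^sub>0" using assms by (auto simp: complex_nonpos_Reals_iff)
  have "Ln (of_real \<rho> * inverse w) = ln \<rho> + Ln (inverse w)"
    by (subst Ln_times_of_real) (use assms w in \<open>auto simp: Ln_of_real\<close>)
  also have "Ln (inverse w) = - Ln w" by (rule Ln_inverse) (use w in auto)
  finally have L: "Ln (of_real \<rho> / w) = of_real (ln \<rho>) - Ln w" by (simp add: divide_inverse)
  have "(of_real \<rho> / w) powr (of_real d) = exp (of_real (d * ln \<rho>) + - of_real d * Ln w)"
    using assms w by (simp add: powr_def L right_diff_distrib)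
  also have "\<dots> = of_real (\<rho> powr d) * w powr (- of_real d)"
    unfolding exp_add using assms w by (simp add: powr_def flip: exp_of_real)
  finally show ?thesis .
qed

text \<open>After Fubini the shift t + u contributes exp (- z u), and the remaining u-integral is
  the Gamma transform at \<rho> + z.\<close>

lemma laplace_K_op:
  assumes S: "open S" and sub: "S \<subseteq> {- \<rho><..}" and \<rho>: "\<rho> > 0" and d: "d \<ge> 0" and f: "decaying S f"
    and z: "Re z \<in> S"
  shows "bilateral_laplace (K_op \<rho> d f) z =
    (of_real \<rho> / (of_real \<rho> + z)) powr (of_real d) * bilateral_laplace f z"
proof (cases "d = 0")
  case True
  have "of_real \<rho> + z \<noteq> 0" using z sub by (auto simp: complex_eq_iff)
  then show ?thesis using \<rho> True by (simp add: K_op_def[abs_def])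
next
  case False
  with d have d: "d > 0" by simp
  define c where "c = \<rho> powr d / Gamma d"
  have c: "c \<ge> 0" using d by (simp add: c_def Gamma_real_pos less_imp_le)
  define \<sigma> where "\<sigma> = Re z"
  have \<sigma>: "\<sigma> \<in> S" "\<sigma> > - \<rho>" using z sub by (auto simp: \<sigma>_def)
  have [measurable]: "f \<in> borel_measurable borel" using decaying_measurable[OF f, of 0] by simp
  define k where "k u = c * (gamma_kernel d u * exp (- \<rho> * u))" for u
  have k: "k u \<ge> 0" for u using c by (simp add: k_def)
  have [measurable]: "k \<in> borel_measurable borel" unfolding k_def[abs_def] by measurable
  let ?H = "\<lambda>u t. exp (z * of_real t) * complex_of_real (k u * f (t + u))"
  let ?E = "\<lambda>t. exp (z * of_real t) * complex_of_real (f t)"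
  have E: "integrable lborel ?E"
    using decaying_laplace_exists[OF S f z] by (simp add: bilateral_laplace_exists_def)
  have H: "?H u t = (exp (- z * of_real u) * of_real (k u)) * ?E (u + 1 * t)" for u t
    by (simp add: exp_add exp_minus algebra_simps)
  have Hint: "integrable lborel (?H u)" for u
    unfolding H by (intro integrable_mult_right lborel_integrable_real_affine E) simp
  have Hval: "(LINT t|lborel. ?H u t) = (exp (- z * of_real u) * of_real (k u)) * bilateral_laplace f z" for u
  proof -
    have "(LINT t|lborel. ?E (u + 1 * t)) = bilateral_laplace f z"
      unfolding bilateral_laplace_def by (subst lborel_integral_real_affine[of 1 ?E u]) auto
    then show ?thesis unfolding H by (simp only: integral_mult_right_zero)
  qed
  have Hnorm: "(LINT t|lborel. norm (?H u t)) = (gamma_kernel d u * exp (- \<rho> * u) * exp (- \<sigma> * u)) * (c * (LINT t|lborel. norm (?E t)))" for u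
  proof -
    have "(LINT t|lborel. norm (?E (u + 1 * t))) = (LINT t|lborel. norm (?E t))"
      by (subst lborel_integral_real_affine[of 1 "\<lambda>t. norm (?E t)" u]) auto
    moreover have "norm (exp (- z * of_real u) * complex_of_real (k u)) = gamma_kernel d u * exp (- \<rho> * u) * exp (- \<sigma> * u) * c"
      using k[of u] by (simp add: norm_mult k_def \<sigma>_def mult_ac abs_mult c)
    ultimately show ?thesis unfolding H norm_mult[of "exp (- z * of_real _) * of_real (k _)"]
      by (simp only: integral_mult_right_zero mult.assoc)
  qed
  have FI: "integrable (lborel \<Otimes>\<^sub>M lborel) (case_prod ?H)"
  proof (rule lborel_pair.Fubini_integrable)
    show "case_prod ?H \<in> borel_measurable (lborel \<Otimes>\<^sub>M lborel)" by measurable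
    show "integrable lborel (\<lambda>u. LINT t|lborel. norm (case (u, t) of (u, t) \<Rightarrow> ?H u t))"
      unfolding prod.case Hnorm by (intro integrable_mult_left gamma_kernel_exp_integrable d \<sigma>)
    show "AE u in lborel. integrable lborel (\<lambda>t. case (u, t) of (u, t) \<Rightarrow> ?H u t)"
      unfolding prod.case using Hint by simp
  qed
  have "bilateral_laplace (K_op \<rho> d f) z = (LINT t|lborel. LINT u|lborel. ?H u t)"
  proof -
    have "K_op \<rho> d f t = (LINT u|lborel. k u * f (t + u))" for t
      unfolding K_op_eq[OF False] k_def c_def by (simp add: mult_ac)
    then show ?thesis unfolding bilateral_laplace_def by (simp only: integral_mult_right_zero integral_complex_of_real)
  qed
  also have "\<dots> = (LINT u|lborel. LINT t|lborel. ?H u t)"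
    by (rule lborel_pair.Fubini_integral[OF FI])
  also have "\<dots> = (LINT u|lborel. of_real c * (exp (- (of_real \<rho> + z) * of_real u) * of_real (gamma_kernel d u))) * bilateral_laplace f z"
  proof -
    have "exp (- z * of_real u) * of_real (k u) = of_real c * (exp (- (of_real \<rho> + z) * of_real u) * of_real (gamma_kernel d u))" for u
      by (simp add: k_def exp_add[symmetric] exp_of_real[symmetric] algebra_simps)
    then show ?thesis unfolding Hval by (simp only: integral_mult_left_zero)
  qed
  also have "(LINT u|lborel. of_real c * (exp (- (of_real \<rho> + z) * of_real u) * of_real (gamma_kernel d u))) =
      of_real c * bilateral_laplace (gamma_kernel d) (- (of_real \<rho> + z))"
    unfolding bilateral_laplace_def by (simp only: integral_mult_right_zero)
  also have "\<dots> = of_real c * (of_real (Gamma d) * (of_real \<rho> + z) powr (- of_real d))"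
    using \<sigma> by (subst gamma_kernel_laplace(2)[OF d]) (auto simp: \<sigma>_def)
  also have "\<dots> = of_real (\<rho> powr d) * (of_real \<rho> + z) powr (- of_real d)"
    using Gamma_real_pos[OF d] by (simp add: c_def)
  also have "\<dots> = (of_real \<rho> / (of_real \<rho> + z)) powr (of_real d)"
    using \<sigma> by (subst powr_divide_right_half_plane[OF \<rho>]) (auto simp: \<sigma>_def)
  finally show ?thesis .
qed

text \<open>Each derivative is a polynomial times the Gaussian, which beats every
  exponential.\<close>

lemma decaying_gauss: "decaying S (gauss a)"
proof -
  \<comment> \<open>With x = t - a, the derivative of p(x) exp (- x^2) is (p'(x) - 2 x p(x)) exp (-
    x^2).\<close>
  define p where "p k = ((\<lambda>p. pderiv p - [:0, 2:] * p) ^^ k) [:1 / sqrt pi :: real:]" for k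
  define g where "g k t = poly (p k) (t - a) * exp (- (t - a)\<^sup>2)" for k t
  show ?thesis
  proof (rule decayingI[where g = g])
    show "g 0 = gauss a" by (simp add: g_def p_def gauss_def fun_eq_iff)
  next
    fix k t
    show "(g k has_real_derivative g (Suc k) t) (at t)"
      unfolding g_def[abs_def]
      by (auto intro!: derivative_eq_intros simp: p_def algebra_simps)
  next
    fix \<sigma> :: real and k
    define P where "P = p k"
    define M where "M = (\<Sum>i\<le>degree P. \<bar>coeff P i\<bar> * fact i)"
    \<comment> \<open>\<open>M\<close> comes from replacing each power \<bar>x\<bar>^i by i! exp
      \<bar>x\<bar>; \<open>(1 + \<bar>\<sigma>\<bar>)\<^sup>2 / 4\<close> is the maximum of (1 +
      \<bar>\<sigma>\<bar>) \<bar>x\<bar> - x^2.\<close>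
    have "exp (\<sigma> * t) * \<bar>g k t\<bar> \<le> M * exp (\<sigma> * a + (1 + \<bar>\<sigma>\<bar>)\<^sup>2 / 4)" for t
    proof -
      define x where "x = t - a"
      have "\<bar>poly P x\<bar> \<le> (\<Sum>i\<le>degree P. \<bar>coeff P i\<bar> * \<bar>x\<bar> ^ i)"
        unfolding poly_altdef by (rule order_trans[OF sum_abs]) (simp add: abs_mult power_abs)
      also have "\<dots> \<le> (\<Sum>i\<le>degree P. \<bar>coeff P i\<bar> * (fact i * exp \<bar>x\<bar>))"
        by (intro sum_mono mult_left_mono power_le_fact_exp) auto
      also have "\<dots> = M * exp \<bar>x\<bar>" by (simp add: M_def sum_distrib_right mult.assoc)
      finally have P: "\<bar>poly P x\<bar> \<le> M * exp \<bar>x\<bar>" .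
      have M: "M \<ge> 0" unfolding M_def by (intro sum_nonneg) auto
      have "exp (\<sigma> * t) * \<bar>g k t\<bar> = \<bar>poly P x\<bar> * exp (\<sigma> * t - x\<^sup>2)"
        by (simp add: g_def P_def x_def abs_mult exp_diff exp_minus divide_inverse)
      also have "\<dots> \<le> M * exp \<bar>x\<bar> * exp (\<sigma> * t - x\<^sup>2)" by (intro mult_right_mono P) simp
      also have "\<dots> = M * exp (\<bar>x\<bar> + (\<sigma> * t - x\<^sup>2))" by (simp add: exp_add)
      also have "\<dots> \<le> M * exp (\<sigma> * a + (1 + \<bar>\<sigma>\<bar>)\<^sup>2 / 4)"
      proof (intro mult_left_mono M)
        have "\<sigma> * x \<le> \<bar>\<sigma>\<bar> * \<bar>x\<bar>" by (metis abs_ge_self abs_mult)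
        moreover have "(\<bar>x\<bar> - (1 + \<bar>\<sigma>\<bar>) / 2)\<^sup>2 \<ge> 0" by simp
        moreover have "(\<bar>x\<bar> - (1 + \<bar>\<sigma>\<bar>) / 2)\<^sup>2 = x\<^sup>2 - \<bar>x\<bar> - \<bar>\<sigma>\<bar> * \<bar>x\<bar> + (1 + \<bar>\<sigma>\<bar>)\<^sup>2 / 4"
          by (simp add: power2_eq_square field_simps)
        moreover have "\<sigma> * t = \<sigma> * x + \<sigma> * a" by (simp add: x_def algebra_simps)
        ultimately have "\<bar>x\<bar> + (\<sigma> * t - x\<^sup>2) \<le> \<sigma> * a + (1 + \<bar>\<sigma>\<bar>)\<^sup>2 / 4" by linarith
        then show "exp (\<bar>x\<bar> + (\<sigma> * t - x\<^sup>2)) \<le> exp (\<sigma> * a + (1 + \<bar>\<sigma>\<bar>)\<^sup>2 / 4)" by simp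
      qed
      finally show ?thesis .
    qed
    then show "\<exists>C. \<forall>t. exp (\<sigma> * t) * \<bar>g k t\<bar> \<le> C" by blast
  qed
qed

section \<open>The operators of the Rodrigues formula on the transform side\<close>

lemma bilateral_laplace_cmult: "bilateral_laplace (\<lambda>t. c * f t) z = of_real c * bilateral_laplace f z"
proof -
  have "(\<lambda>t. exp (z * of_real t) * complex_of_real (c * f t)) =
      (\<lambda>t. of_real c * (exp (z * of_real t) * complex_of_real (f t)))" by (simp add: fun_eq_iff)
  then show ?thesis unfolding bilateral_laplace_def by (simp only: integral_mult_right_zero)
qed

lemma prod_list_upt: "(\<Prod>h\<leftarrow>[1..<Suc r]. f h) = (\<Prod>h=1..r. f h)" for f :: "nat \<Rightarrow> 'a::comm_monoid_mult"
  using prod.distinct_set_conv_list[of "[1..<Suc r]" f]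
  unfolding set_upt atLeastLessThanSuc_atLeastAtMost by simp

text \<open>The real parts of the half-plane of the theorem. For \<open>r = 0\<close> this is the
  whole line, so both cases of the transform formula are handled at once.\<close>

definition strip :: "nat \<Rightarrow> (nat \<Rightarrow> real) \<Rightarrow> real set" where
  "strip r \<rho> = {\<sigma>. \<forall>h\<in>{1..r}. - \<rho> h < \<sigma>}"

lemma open_strip: "open (strip r \<rho>)"
proof -
  have "strip r \<rho> = (\<Inter>h\<in>{1..r}. {- \<rho> h<..})" by (auto simp: strip_def)
  then show ?thesis by (auto intro!: open_INT)
qed

context
  fixes r :: nat and \<rho> d :: "nat \<Rightarrow> real" and n :: "nat \<Rightarrow> nat"
  assumes \<rho>: "\<And>h. h \<in> {1..r} \<Longrightarrow> \<rho> h > 0"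
begin

lemma strip_zero: "0 \<in> strip r \<rho>"
  using \<rho> by (auto simp: strip_def)

lemma strip_subset: "h \<in> {1..r} \<Longrightarrow> strip r \<rho> \<subseteq> {- \<rho> h<..}"
  by (auto simp: strip_def)

lemma K_op_strip:
  assumes "h \<in> {1..r}" "D \<ge> 0" "decaying (strip r \<rho>) f"
  shows "decaying (strip r \<rho>) (K_op (\<rho> h) D f)"
    and "Re z \<in> strip r \<rho> \<Longrightarrow> bilateral_laplace (K_op (\<rho> h) D f) z =
      (of_real (\<rho> h) / (of_real (\<rho> h) + z)) powr (of_real D) * bilateral_laplace f z"
proof -
  show "decaying (strip r \<rho>) (K_op (\<rho> h) D f)"
    by (rule decaying_K_op[OF _ strip_subset[OF assms(1)] \<rho>[OF assms(1)] assms(2,3)])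
       (use strip_zero in auto)
qed (rule laplace_K_op[OF open_strip strip_subset[OF assms(1)] \<rho>[OF assms(1)] assms(2,3)])

lemma F_fun_strip:
  assumes d: "\<And>h. h \<in> {1..r} \<Longrightarrow> d h \<ge> 0"
  shows "decaying (strip r \<rho>) (F_fun r \<rho> d a)"
    and "Re z \<in> strip r \<rho> \<Longrightarrow> bilateral_laplace (F_fun r \<rho> d a) z =
      exp (of_real a * z + z\<^sup>2 / 4) * (\<Prod>h=1..r. (of_real (\<rho> h) / (of_real (\<rho> h) + z)) powr of_real (d h))"
proof -
  have *: "decaying (strip r \<rho>) (foldr (\<lambda>h. K_op (\<rho> h) (d h)) xs (gauss a)) \<and>
      (Re z \<in> strip r \<rho> \<longrightarrow> bilateral_laplace (foldr (\<lambda>h. K_op (\<rho> h) (d h)) xs (gauss a)) z =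
        exp (of_real a * z + z\<^sup>2 / 4) * (\<Prod>h\<leftarrow>xs. (of_real (\<rho> h) / (of_real (\<rho> h) + z)) powr of_real (d h)))"
    if "set xs \<subseteq> {1..r}" for xs
    using that
  proof (induction xs)
    case Nil
    show ?case by (simp add: decaying_gauss gauss_laplace)
  next
    case (Cons h xs)
    then show ?case using d[of h] K_op_strip[of h "d h"] by simp
  qed
  have s: "set [1..<Suc r] = {1..r}" by auto
  show "decaying (strip r \<rho>) (F_fun r \<rho> d a)"
    unfolding F_fun_def using *[of "[1..<Suc r]"] s by blast
  show "bilateral_laplace (F_fun r \<rho> d a) z =
      exp (of_real a * z + z\<^sup>2 / 4) * (\<Prod>h=1..r. (of_real (\<rho> h) / (of_real (\<rho> h) + z)) powr of_real (d h))"
    if "Re z \<in> strip r \<rho>"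
    unfolding F_fun_def prod_list_upt[symmetric] using *[of "[1..<Suc r]"] s that by blast
qed

text \<open>For an integer exponent the principal power is an ordinary power, and its numerator
  cancels the normalisation \<rho>^(- n).\<close>

lemma K_part_strip:
  assumes f: "decaying (strip r \<rho>) f"
  shows "decaying (strip r \<rho>) (K_part r \<rho> n f)"
    and "Re z \<in> strip r \<rho> \<Longrightarrow> bilateral_laplace (K_part r \<rho> n f) z =
      bilateral_laplace f z / (\<Prod>h=1..r. (of_real (\<rho> h) + z) ^ n h)"
proof -
  let ?K = "\<lambda>h f t. inverse (\<rho> h ^ n h) * K_op (\<rho> h) (real (n h)) f t"
  have *: "decaying (strip r \<rho>) (foldr ?K xs f) \<and>
      (Re z \<in> strip r \<rho> \<longrightarrow> bilateral_laplace (foldr ?K xs f) z =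
        bilateral_laplace f z / (\<Prod>h\<leftarrow>xs. (of_real (\<rho> h) + z) ^ n h))"
    if "set xs \<subseteq> {1..r}" for xs
    using that
  proof (induction xs)
    case Nil
    show ?case by (simp add: f)
  next
    case (Cons h xs)
    let ?f = "foldr ?K xs f"
    have h: "h \<in> {1..r}" using Cons.prems by simp
    have dec: "decaying (strip r \<rho>) ?f" using Cons by simp
    have K: "decaying (strip r \<rho>) (K_op (\<rho> h) (real (n h)) ?f)"
      by (rule K_op_strip(1)[OF h _ dec]) simp
    have "decaying (strip r \<rho>) (?K h ?f)"
      using decaying_linear[OF K K, of "inverse (\<rho> h ^ n h)" 0] by simp
    moreover have "bilateral_laplace (?K h ?f) z = bilateral_laplace ?f z / (of_real (\<rho> h) + z) ^ n h"
      if z: "Re z \<in> strip r \<rho>"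
    proof -
      have ne: "of_real (\<rho> h) + z \<noteq> 0" using strip_subset[OF h] z by (auto simp: complex_eq_iff)
      have "bilateral_laplace (?K h ?f) z = of_real (inverse (\<rho> h ^ n h)) *
          ((of_real (\<rho> h) / (of_real (\<rho> h) + z)) powr (of_real (real (n h))) * bilateral_laplace ?f z)"
        unfolding bilateral_laplace_cmult using K_op_strip(2)[OF h _ dec z, of "real (n h)"] by simp
      also have "(of_real (\<rho> h) / (of_real (\<rho> h) + z)) powr (of_real (real (n h))) =
          (of_real (\<rho> h) / (of_real (\<rho> h) + z)) ^ n h"
        using ne \<rho>[OF h] by (simp add: powr_nat')
      finally show ?thesis using ne \<rho>[OF h] by (simp add: power_divide field_simps)
    qed
    ultimately show ?case using Cons by simp
  qed
  have s: "set [1..<Suc r] = {1..r}" by auto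
  show "decaying (strip r \<rho>) (K_part r \<rho> n f)"
    unfolding K_part_def using *[of "[1..<Suc r]"] s by blast
  show "bilateral_laplace (K_part r \<rho> n f) z =
      bilateral_laplace f z / (\<Prod>h=1..r. (of_real (\<rho> h) + z) ^ n h)"
    if "Re z \<in> strip r \<rho>"
    unfolding K_part_def prod_list_upt[symmetric] using *[of "[1..<Suc r]"] s that by blast
qed

end

lemma first_order_operator:
  assumes S: "open S" and f: "decaying S f"
  shows "decaying S (\<lambda>t. c * f t + deriv f t)"
    and "Re z \<in> S \<Longrightarrow> bilateral_laplace (\<lambda>t. c * f t + deriv f t) z = (of_real c - z) * bilateral_laplace f z"
proof -
  show "decaying S (\<lambda>t. c * f t + deriv f t)"
    using decaying_linear[OF f decaying_deriv[OF f], of c 1] by simp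
  assume z: "Re z \<in> S"
  have i: "integrable lborel (\<lambda>t. exp (z * of_real t) * complex_of_real (f t))"
      "integrable lborel (\<lambda>t. exp (z * of_real t) * complex_of_real (deriv f t))"
    using decaying_laplace_exists[OF S f z] decaying_laplace_exists[OF S decaying_deriv[OF f] z]
    by (auto simp: bilateral_laplace_exists_def)
  have "bilateral_laplace (\<lambda>t. c * f t + deriv f t) z =
      (LINT t|lborel. of_real c * (exp (z * of_real t) * complex_of_real (f t)) + exp (z * of_real t) * complex_of_real (deriv f t))"
    unfolding bilateral_laplace_def by (simp add: algebra_simps)
  also have "\<dots> = of_real c * bilateral_laplace f z + bilateral_laplace (deriv f) z"
    unfolding bilateral_laplace_def using i
    by (simp add: Bochner_Integration.integral_add)
  also have "\<dots> = (of_real c - z) * bilateral_laplace f z"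
    by (simp add: laplace_deriv[OF S f z] algebra_simps)
  finally show "bilateral_laplace (\<lambda>t. c * f t + deriv f t) z = (of_real c - z) * bilateral_laplace f z" .
qed

lemma first_order_operator_funpow:
  assumes S: "open S" and f: "decaying S f"
  shows "decaying S (((\<lambda>f t. c * f t + deriv f t) ^^ m) f)"
    and "Re z \<in> S \<Longrightarrow> bilateral_laplace (((\<lambda>f t. c * f t + deriv f t) ^^ m) f) z =
      (of_real c - z) ^ m * bilateral_laplace f z"
proof (induction m)
  case (Suc m)
  {
    case 1
    then show ?case using first_order_operator(1)[OF S Suc(1)] by simp
  next
    case 2
    then show ?case using first_order_operator(2)[OF S Suc(1), of z c] Suc(2) by simp
  }
qed (use f in auto)

lemma D_part_strip:
  assumes S: "open S" and f: "decaying S f"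
  shows "decaying S (D_part p \<xi> m f)"
    and "Re z \<in> S \<Longrightarrow> bilateral_laplace (D_part p \<xi> m f) z =
      (\<Prod>i=1..p. (of_real (\<xi> i) - z) ^ m i) * bilateral_laplace f z"
proof -
  let ?D = "\<lambda>i. (\<lambda>f t. \<xi> i * f t + deriv f t) ^^ m i"
  have *: "decaying S (foldr ?D xs f) \<and> (Re z \<in> S \<longrightarrow> bilateral_laplace (foldr ?D xs f) z =
        (\<Prod>i\<leftarrow>xs. (of_real (\<xi> i) - z) ^ m i) * bilateral_laplace f z)" for xs
  proof (induction xs)
    case (Cons i xs)
    then show ?case using first_order_operator_funpow[OF S, of "foldr ?D xs f"] by simp
  qed (use f in simp)
  show "decaying S (D_part p \<xi> m f)" unfolding D_part_def using * by blast
  show "bilateral_laplace (D_part p \<xi> m f) z = (\<Prod>i=1..p. (of_real (\<xi> i) - z) ^ m i) * bilateral_laplace f z"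
    if "Re z \<in> S" unfolding D_part_def prod_list_upt[symmetric] using *[of "[1..<Suc p]"] that by blast
qed

section \<open>Parseval formula\<close>

text \<open>Boundedness of the kernel makes C \<bar>A(x)\<bar> \<bar>B(y)\<bar> an integrable
  majorant on the product. It serves for exponentials of modulus one and for a Gaussian
  kernel.\<close>

lemma Fubini_bounded_kernel:
  fixes A B :: "real \<Rightarrow> complex" and k :: "real \<Rightarrow> real \<Rightarrow> complex"
  assumes A: "integrable lborel A" and B: "integrable lborel B"
    and k[measurable]: "case_prod k \<in> borel_measurable (borel \<Otimes>\<^sub>M borel)"
    and bnd: "\<And>x y. norm (k x y) \<le> C"
  shows "(LINT x|lborel. A x * (LINT y|lborel. k x y * B y)) = (LINT y|lborel. B y * (LINT x|lborel. k x y * A x))"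
proof -
  have [measurable]: "A \<in> borel_measurable borel" "B \<in> borel_measurable borel"
    using A B by (auto dest: borel_measurable_integrable)
  have 1: "integrable (lborel \<Otimes>\<^sub>M lborel) (\<lambda>(x, y). C * (norm (A x) * norm (B y)))"
  proof (rule lborel_pair.Fubini_integrable)
    show "integrable lborel (\<lambda>x. LINT y|lborel. norm (case (x, y) of (x, y) \<Rightarrow> C * (norm (A x) * norm (B y))))"
      using A by (simp add: abs_mult integrable_norm)
  qed (use B in \<open>auto simp: integrable_norm\<close>)
  have 2: "integrable (lborel \<Otimes>\<^sub>M lborel) (\<lambda>(x, y). A x * (k x y * B y))"
  proof (rule Bochner_Integration.integrable_bound[OF 1])
    have "norm (A x * (k x y * B y)) \<le> C * (norm (A x) * norm (B y))" for x y
      using mult_right_mono[OF bnd[of x y], of "norm (A x) * norm (B y)"] by (simp add: norm_mult mult_ac)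
    then show "AE z in lborel \<Otimes>\<^sub>M lborel. norm (case z of (x, y) \<Rightarrow> A x * (k x y * B y)) \<le>
        norm (case z of (x, y) \<Rightarrow> C * (norm (A x) * norm (B y)))"
      by (intro AE_I2) (auto intro: order_trans[OF _ abs_ge_self])
  qed measurable
  have "(LINT x|lborel. A x * (LINT y|lborel. k x y * B y)) = (LINT x|lborel. LINT y|lborel. A x * (k x y * B y))"
    by simp
  also have "\<dots> = (LINT y|lborel. LINT x|lborel. A x * (k x y * B y))"
    by (rule lborel_pair.Fubini_integral[OF 2, symmetric])
  also have "\<dots> = (LINT y|lborel. LINT x|lborel. B y * (k x y * A x))" by (simp add: mult_ac)
  finally show ?thesis by simp
qed

text \<open>Fourier transform of the damping factor in the Parseval argument; as \<delta> tends to 0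
  the right-hand side is 2 pi times an approximate identity in w.\<close>

lemma gauss_fourier:
  assumes \<delta>: "\<delta> > 0"
  shows "integrable lborel (\<lambda>u. exp (\<i> * of_real (w * u)) * complex_of_real (exp (- (\<delta> * u)\<^sup>2)))"
    and "(LINT u|lborel. exp (\<i> * of_real (w * u)) * complex_of_real (exp (- (\<delta> * u)\<^sup>2))) =
      of_real (2 * pi * (gauss 0 (w / (2 * \<delta>)) / (2 * \<delta>)))"
proof -
  let ?f = "\<lambda>t. exp ((\<i> * of_real (w / \<delta>)) * of_real t) * complex_of_real (gauss 0 t)"
  have eq: "exp (\<i> * of_real (w * u)) * complex_of_real (exp (- (\<delta> * u)\<^sup>2)) = of_real (sqrt pi) * ?f (0 + \<delta> * u)" for u
    using \<delta> by (simp add: gauss_def)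
  have i: "integrable lborel ?f"
    using gauss_laplace(1)[of 0 "\<i> * of_real (w / \<delta>)"] by (simp add: bilateral_laplace_exists_def)
  show "integrable lborel (\<lambda>u. exp (\<i> * of_real (w * u)) * complex_of_real (exp (- (\<delta> * u)\<^sup>2)))"
    unfolding eq by (intro integrable_mult_right lborel_integrable_real_affine i) (use \<delta> in auto)
  have "(LINT u|lborel. ?f (0 + \<delta> * u)) = bilateral_laplace (gauss 0) (\<i> * of_real (w / \<delta>)) / of_real \<delta>"
    unfolding bilateral_laplace_def using \<delta>
    by (subst lborel_integral_real_affine[of \<delta> ?f 0]) (auto simp: scaleR_conv_of_real)
  also have "bilateral_laplace (gauss 0) (\<i> * of_real (w / \<delta>)) = of_real (exp (- (w / (2 * \<delta>))\<^sup>2))"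
    by (simp add: gauss_laplace(2) power_mult_distrib power_divide mult.commute flip: exp_of_real)
  finally show "(LINT u|lborel. exp (\<i> * of_real (w * u)) * complex_of_real (exp (- (\<delta> * u)\<^sup>2))) =
      of_real (2 * pi * (gauss 0 (w / (2 * \<delta>)) / (2 * \<delta>)))"
    unfolding eq integral_mult_right_zero using \<delta>
    by (simp add: gauss_def field_simps flip: of_real_mult of_real_divide)
qed


text \<open>Substituting x = y + 2 \<delta> v fixes the Gaussian and moves the parameter into
  \<psi>, where continuity and the bound \<open>M\<close> give dominated convergence.\<close>

lemma gauss_averages_tendsto:
  fixes \<psi> :: "real \<Rightarrow> real" and \<delta> :: "nat \<Rightarrow> real"
  assumes c: "\<And>y. isCont \<psi> y" and M: "\<And>y. \<bar>\<psi> y\<bar> \<le> M"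
    and \<delta>: "\<And>j. \<delta> j > 0" "\<delta> \<longlonglongrightarrow> 0"
  shows "(\<lambda>j. LINT x|lborel. complex_of_real (gauss 0 ((y - x) / (2 * \<delta> j)) / (2 * \<delta> j)) * of_real (\<psi> x))
      \<longlonglongrightarrow> of_real (\<psi> y)"
    and "norm (LINT x|lborel. complex_of_real (gauss 0 ((y - x) / (2 * \<delta> j)) / (2 * \<delta> j)) * of_real (\<psi> x)) \<le> M"
proof -
  have [measurable]: "\<psi> \<in> borel_measurable borel"
    by (intro borel_measurable_continuous_onI continuous_at_imp_continuous_on ballI c)
  have [measurable]: "gauss 0 \<in> borel_measurable borel" unfolding gauss_eq_normal_density by measurable
  have gi: "integrable lborel (gauss 0)" and g1: "(LINT v|lborel. gauss 0 v) = 1"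
    unfolding gauss_eq_normal_density by simp_all
  have gnn: "gauss 0 v \<ge> 0" for v by (simp add: gauss_def)
  have geven: "gauss 0 (- v) = gauss 0 v" for v by (simp add: gauss_def)
  have eq: "(LINT x|lborel. complex_of_real (gauss 0 ((y - x) / (2 * \<delta> j)) / (2 * \<delta> j)) * of_real (\<psi> x)) =
      of_real (LINT v|lborel. gauss 0 v * \<psi> (y + 2 * \<delta> j * v))" for j
  proof -
    have "(LINT x|lborel. gauss 0 ((y - x) / (2 * \<delta> j)) / (2 * \<delta> j) * \<psi> x) =
       (LINT v|lborel. gauss 0 v * \<psi> (y + 2 * \<delta> j * v))"
      using \<delta>(1)[of j] geven
      by (subst lborel_integral_real_affine[of "2 * \<delta> j" _ y]) auto
    then show ?thesis by (simp flip: of_real_mult of_real_divide)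
  qed
  have bound: "norm (gauss 0 v * \<psi> (y + 2 * \<delta> j * v)) \<le> M * gauss 0 v" for j v
    using mult_left_mono[OF M[of "y + 2 * \<delta> j * v"] gnn[of v]] gnn[of v] by (simp add: abs_mult mult.commute)
  have "(\<lambda>j. LINT v|lborel. gauss 0 v * \<psi> (y + 2 * \<delta> j * v)) \<longlonglongrightarrow> (LINT v|lborel. gauss 0 v * \<psi> y)"
  proof (rule integral_dominated_convergence[where w = "\<lambda>v. M * gauss 0 v"])
    show "AE v in lborel. (\<lambda>j. gauss 0 v * \<psi> (y + 2 * \<delta> j * v)) \<longlonglongrightarrow> gauss 0 v * \<psi> y"
    proof (intro AE_I2 tendsto_intros)
      fix v
      have "(\<lambda>j. y + 2 * \<delta> j * v) \<longlonglongrightarrow> y + 2 * 0 * v" by (intro tendsto_intros \<delta>)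
      then show "(\<lambda>j. \<psi> (y + 2 * \<delta> j * v)) \<longlonglongrightarrow> \<psi> y" by (intro isCont_tendsto_compose[OF c]) simp
    qed
  qed (use gi bound in auto)
  also have "(LINT v|lborel. gauss 0 v * \<psi> y) = \<psi> y" using g1 by simp
  finally show "(\<lambda>j. LINT x|lborel. complex_of_real (gauss 0 ((y - x) / (2 * \<delta> j)) / (2 * \<delta> j)) * of_real (\<psi> x))
      \<longlonglongrightarrow> of_real (\<psi> y)" unfolding eq by (rule tendsto_of_real)
  have "norm (LINT v|lborel. gauss 0 v * \<psi> (y + 2 * \<delta> j * v)) \<le> (LINT v|lborel. norm (gauss 0 v * \<psi> (y + 2 * \<delta> j * v)))"
    by (rule integral_norm_bound)
  also have "\<dots> \<le> (LINT v|lborel. M * gauss 0 v)"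
  proof (rule integral_mono)
    show "integrable lborel (\<lambda>v. norm (gauss 0 v * \<psi> (y + 2 * \<delta> j * v)))"
      by (rule Bochner_Integration.integrable_bound[of _ "\<lambda>v. M * gauss 0 v"])
         (use gi bound[of _ j] in \<open>auto intro: order_trans[OF _ abs_ge_self]\<close>)
  qed (use gi bound in auto)
  also have "\<dots> = M" using g1 by simp
  finally show "norm (LINT x|lborel. complex_of_real (gauss 0 ((y - x) / (2 * \<delta> j)) / (2 * \<delta> j)) * of_real (\<psi> x)) \<le> M"
    unfolding eq norm_of_real by simp
qed

text \<open>Both sides are limits of the identity with an additional Gaussian factor \<open>exp (- (\<delta> * u)\<^sup>2)\<close> on the transform
  side, where Fubini applies.\<close>

lemma bilateral_laplace_parseval:
  fixes G \<psi> :: "real \<Rightarrow> real"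
  assumes G: "integrable lborel G" and L: "integrable lborel (\<lambda>u. bilateral_laplace G (\<i> * of_real u))"
    and \<psi>: "integrable lborel \<psi>" and c: "\<And>y. isCont \<psi> y" and M: "\<And>y. \<bar>\<psi> y\<bar> \<le> M"
  shows "of_real (LINT y|lborel. G y * \<psi> y) =
    (LINT u|lborel. bilateral_laplace G (\<i> * of_real u) * bilateral_laplace \<psi> (- \<i> * of_real u)) / of_real (2 * pi)"
proof -
  define \<delta> where "\<delta> j = inverse (real (Suc j))" for j
  have \<delta>: "\<delta> j > 0" for j by (simp add: \<delta>_def)
  have \<delta>0: "\<delta> \<longlonglongrightarrow> 0" unfolding \<delta>_def by (rule LIMSEQ_inverse_real_of_nat)
  let ?G = "\<lambda>y. complex_of_real (G y)" and ?\<psi> = "\<lambda>y. complex_of_real (\<psi> y)"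
  let ?L = "\<lambda>u. bilateral_laplace G (\<i> * of_real u)" and ?P = "\<lambda>u. bilateral_laplace \<psi> (- \<i> * of_real u)"
  let ?e = "\<lambda>x y. exp (\<i> * of_real (x * y))"
  let ?w = "\<lambda>j u. complex_of_real (exp (- (\<delta> j * u)\<^sup>2))"
  let ?g = "\<lambda>j x y. complex_of_real (gauss 0 ((y - x) / (2 * \<delta> j)) / (2 * \<delta> j))"
  have [measurable]: "gauss 0 \<in> borel_measurable borel" unfolding gauss_eq_normal_density by measurable
  have [measurable]: "?L \<in> borel_measurable borel" using L by (auto dest: borel_measurable_integrable)
  have Gi: "integrable lborel ?G" and \<psi>i: "integrable lborel ?\<psi>" using G \<psi> by auto
  have [measurable]: "G \<in> borel_measurable borel" "\<psi> \<in> borel_measurable borel"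
    using G \<psi> by (auto dest: borel_measurable_integrable)
  have L_eq: "?L u = (LINT y|lborel. ?e u y * ?G y)" for u
    by (simp add: bilateral_laplace_def mult.assoc)
  have P_eq: "?P u = (LINT x|lborel. ?e u (- x) * ?\<psi> x)" for u
    by (simp add: bilateral_laplace_def mult.assoc)
  have wi: "integrable lborel (\<lambda>u. ?e x u * ?w j u)" for x j by (rule gauss_fourier(1)[OF \<delta>])
  have m1: "(\<lambda>(u, x). ?e u (- x)) \<in> borel_measurable (borel \<Otimes>\<^sub>M borel)"
    and m2: "(\<lambda>(u, x). ?e u x) \<in> borel_measurable (borel \<Otimes>\<^sub>M borel)"
    by measurable
  have Lwi: "integrable lborel (\<lambda>u. ?w j u * ?L u)" for j
    by (rule Bochner_Integration.integrable_bound[OF L])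
       (auto simp: norm_mult intro!: mult_left_le_one_le)
  \<comment> \<open>Three exchanges of integrals: after unfolding \<open>?P\<close> and
    \<open>?L\<close>, the inner u-integral becomes a Gaussian in y - x, which is finally moved from
    \<open>G\<close> to \<psi>.\<close>
  have key: "(LINT u|lborel. (?w j u * ?L u) * ?P u) =
      of_real (2 * pi) * (LINT y|lborel. ?G y * (LINT x|lborel. ?g j x y * ?\<psi> x))" for j
  proof -
    have "(LINT u|lborel. (?w j u * ?L u) * ?P u) =
        (LINT x|lborel. ?\<psi> x * (LINT u|lborel. ?e u (- x) * (?w j u * ?L u)))"
      unfolding P_eq by (rule Fubini_bounded_kernel[OF Lwi \<psi>i m1, where C = 1]) simp
    also have "(\<lambda>x. LINT u|lborel. ?e u (- x) * (?w j u * ?L u)) =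
        (\<lambda>x. of_real (2 * pi) * (LINT y|lborel. ?g j x y * ?G y))"
    proof
      fix x
      have "(LINT u|lborel. ?e u (- x) * (?w j u * ?L u)) =
          (LINT u|lborel. (?e (- x) u * ?w j u) * (LINT y|lborel. ?e u y * ?G y))"
        unfolding L_eq by (simp add: mult_ac)
      also have "\<dots> = (LINT y|lborel. ?G y * (LINT u|lborel. ?e u y * (?e (- x) u * ?w j u)))"
        by (rule Fubini_bounded_kernel[OF wi Gi m2, where C = 1]) simp
      also have "\<dots> = (LINT y|lborel. ?G y * (of_real (2 * pi) * ?g j x y))"
      proof -
        have "(LINT u|lborel. ?e u y * (?e (- x) u * ?w j u)) = of_real (2 * pi) * ?g j x y" for y
        proof -
          have "?e u y * ?e (- x) u = ?e (y - x) u" for u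
            unfolding exp_add[symmetric] by (simp add: algebra_simps)
          then have "(LINT u|lborel. ?e u y * (?e (- x) u * ?w j u)) = (LINT u|lborel. ?e (y - x) u * ?w j u)"
            by (simp only: mult.assoc[symmetric])
          then show ?thesis unfolding gauss_fourier(2)[OF \<delta>] by simp
        qed
        then show ?thesis by simp
      qed
      also have "\<dots> = of_real (2 * pi) * (LINT y|lborel. ?g j x y * ?G y)"
        unfolding integral_mult_right_zero[symmetric] by (simp add: mult_ac)
      finally show "(LINT u|lborel. ?e u (- x) * (?w j u * ?L u)) = of_real (2 * pi) * (LINT y|lborel. ?g j x y * ?G y)" .
    qed
    also have "(LINT x|lborel. ?\<psi> x * (of_real (2 * pi) * (LINT y|lborel. ?g j x y * ?G y))) =
        of_real (2 * pi) * (LINT x|lborel. ?\<psi> x * (LINT y|lborel. ?g j x y * ?G y))"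
      unfolding integral_mult_right_zero[symmetric] by (simp only: mult_ac)
    also have "(LINT x|lborel. ?\<psi> x * (LINT y|lborel. ?g j x y * ?G y)) =
        (LINT y|lborel. ?G y * (LINT x|lborel. ?g j x y * ?\<psi> x))"
    proof (rule Fubini_bounded_kernel[OF \<psi>i Gi])
      show "(\<lambda>(x, y). ?g j x y) \<in> borel_measurable (borel \<Otimes>\<^sub>M borel)" by measurable
      fix x y
      have "gauss 0 ((y - x) / (2 * \<delta> j)) \<le> 1 / sqrt pi" by (simp add: gauss_def divide_right_mono)
      then show "norm (?g j x y) \<le> 1 / sqrt pi / (2 * \<delta> j)"
        unfolding norm_of_real using \<delta>[of j]
        by (subst abs_of_nonneg) (auto simp: gauss_def intro!: divide_right_mono)
    qed
    finally show ?thesis .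
  qed
  have Pbound: "norm (?P u) \<le> (LINT x|lborel. \<bar>\<psi> x\<bar>)" for u
  proof -
    have "norm (?P u) \<le> (LINT x|lborel. norm (?e u (- x) * ?\<psi> x))" unfolding P_eq by (rule integral_norm_bound)
    then show ?thesis by (simp add: norm_mult)
  qed
  have [measurable]: "?P \<in> borel_measurable borel" unfolding P_eq by measurable
  \<comment> \<open>The damping can be removed because \<open>?L\<close> is integrable and
    \<open>?P\<close> is bounded by the integral of \<bar>\<psi>\<bar>.\<close>
  have "(\<lambda>j. LINT u|lborel. (?w j u * ?L u) * ?P u) \<longlonglongrightarrow> (LINT u|lborel. ?L u * ?P u)"
  proof (rule integral_dominated_convergence[where w = "\<lambda>u. norm (?L u) * (LINT x|lborel. \<bar>\<psi> x\<bar>)"])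
    show "AE u in lborel. (\<lambda>j. (?w j u * ?L u) * ?P u) \<longlonglongrightarrow> ?L u * ?P u"
    proof (rule AE_I2)
      fix u
      have "(\<lambda>j. (?w j u * ?L u) * ?P u) \<longlonglongrightarrow> (of_real (exp (- (0 * u)\<^sup>2)) * ?L u) * ?P u"
        by (intro tendsto_intros \<delta>0)
      then show "(\<lambda>j. (?w j u * ?L u) * ?P u) \<longlonglongrightarrow> ?L u * ?P u" by simp
    qed
    show "AE u in lborel. norm ((?w j u * ?L u) * ?P u) \<le> norm (?L u) * (LINT x|lborel. \<bar>\<psi> x\<bar>)" for j
    proof (intro AE_I2)
      fix u
      have "norm (?w j u * ?L u) \<le> norm (?L u)" by (simp add: norm_mult mult_left_le_one_le)
      then show "norm ((?w j u * ?L u) * ?P u) \<le> norm (?L u) * (LINT x|lborel. \<bar>\<psi> x\<bar>)"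
        unfolding norm_mult[of _ "?P u"] by (intro mult_mono Pbound) auto
    qed
    show "integrable lborel (\<lambda>u. norm (?L u) * (LINT x|lborel. \<bar>\<psi> x\<bar>))"
      using L by (intro integrable_mult_left integrable_norm) auto
  qed measurable
  moreover have "(\<lambda>j. LINT y|lborel. ?G y * (LINT x|lborel. ?g j x y * ?\<psi> x)) \<longlonglongrightarrow> (LINT y|lborel. ?G y * ?\<psi> y)"
  proof (rule integral_dominated_convergence[where w = "\<lambda>y. \<bar>G y\<bar> * M"])
    show "AE y in lborel. (\<lambda>j. ?G y * (LINT x|lborel. ?g j x y * ?\<psi> x)) \<longlonglongrightarrow> ?G y * ?\<psi> y"
      by (intro AE_I2 tendsto_mult tendsto_const gauss_averages_tendsto(1)[OF c M \<delta> \<delta>0])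
    show "AE y in lborel. norm (?G y * (LINT x|lborel. ?g j x y * ?\<psi> x)) \<le> \<bar>G y\<bar> * M" for j
      unfolding norm_mult norm_of_real
      by (intro AE_I2 mult_left_mono gauss_averages_tendsto(2)[OF c M \<delta> \<delta>0]) auto
    show "integrable lborel (\<lambda>y. \<bar>G y\<bar> * M)" using G by auto
  qed measurable
  then have "(\<lambda>j. of_real (2 * pi) * (LINT y|lborel. ?G y * (LINT x|lborel. ?g j x y * ?\<psi> x))) \<longlonglongrightarrow>
      of_real (2 * pi) * (LINT y|lborel. ?G y * ?\<psi> y)" by (intro tendsto_intros)
  ultimately have "(LINT u|lborel. ?L u * ?P u) = of_real (2 * pi) * (LINT y|lborel. ?G y * ?\<psi> y)"
    unfolding key by (rule LIMSEQ_unique)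
  also have "(LINT y|lborel. ?G y * ?\<psi> y) = of_real (LINT y|lborel. G y * \<psi> y)"
    by (simp flip: of_real_mult)
  finally show ?thesis by simp
qed

section \<open>Asymptotics of Gamma quotients\<close>

lemma has_mellin_measurable:
  assumes "has_mellin B z M"
  shows "(\<lambda>x. indicator {0<..} x * B x) \<in> borel_measurable borel"
proof -
  let ?F = "\<lambda>x. indicator {0<..} x *\<^sub>R (of_real x powr (z - 1) * complex_of_real (B x))"
  have [measurable]: "?F \<in> borel_measurable borel"
    using assms unfolding has_mellin_def set_integrable_def by (auto dest: borel_measurable_integrable)
  \<comment> \<open>The power of x has no zero on the half-line, so multiplying by its inverse
    recovers \<open>B\<close> there.\<close>
  have "(\<lambda>x. Re (?F x * of_real x powr (1 - z))) \<in> borel_measurable borel" by measurable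
  also have "(\<lambda>x. Re (?F x * of_real x powr (1 - z))) = (\<lambda>x. indicator {0<..} x * B x)"
  proof
    fix x :: real
    have "of_real x powr (z - 1) * complex_of_real (B x) * of_real x powr (1 - z) = complex_of_real (B x)" if "x > 0"
    proof -
      have "complex_of_real x powr (z - 1) * of_real x powr (1 - z) = 1"
        using that by (simp add: powr_add[symmetric])
      then show ?thesis by (metis mult.assoc mult.commute mult_1)
    qed
    then have "?F x * of_real x powr (1 - z) = complex_of_real (indicator {0<..} x * B x)"
      by (cases "x > 0") (simp_all only: indicator_def greaterThan_iff if_True if_False of_bool_def, simp_all)
    then show "Re (?F x * of_real x powr (1 - z)) = indicator {0<..} x * B x"
      by (simp only: Re_complex_of_real)
  qed
  finally show ?thesis .
qed

text \<open>In the chart \<open>x = \<tau> * exp (e * y)\<close> the Mellin transform becomes a Laplace transform. The variable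
  \<open>t = (exp (e * y) - 1) / e\<close> of the theorem tends to \<open>y\<close> as \<open>e\<close> tends to \<open>0\<close>.\<close>

definition log_pullback :: "real \<Rightarrow> real \<Rightarrow> (real \<Rightarrow> real) \<Rightarrow> real \<Rightarrow> real" where
  "log_pullback \<tau> e B y = B (\<tau> * exp (e * y)) * exp (e * y)"

lemma log_pullback_measurable:
  assumes [measurable]: "(\<lambda>x. indicator {0<..} x * B x) \<in> borel_measurable borel" and "\<tau> > 0"
  shows "log_pullback \<tau> e B \<in> borel_measurable borel"
proof -
  have "(\<lambda>y. (indicator {0<..} (\<tau> * exp (e * y)) * B (\<tau> * exp (e * y))) * exp (e * y)) \<in> borel_measurable borel"
    by measurable
  then show ?thesis using assms(2) by (simp add: log_pullback_def[abs_def])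
qed

text \<open>With z = 1 + s / e, the power x^(z - 1) becomes \<tau>^(s / e) exp (s y). The Jacobian
  is \<tau> e exp (e y), whose last factor is part of \<open>log_pullback\<close>.\<close>

lemma laplace_log_pullback:
  assumes M: "has_mellin B (1 + s / of_real e) M" and \<tau>: "\<tau> > 0" and e: "e > 0"
  shows "bilateral_laplace_exists (log_pullback \<tau> e B) s"
    and "bilateral_laplace (log_pullback \<tau> e B) s = of_real \<tau> powr (- s / of_real e) * M / of_real (\<tau> * e)"
proof -
  let ?f = "\<lambda>x. complex_of_real x powr (1 + s / of_real e - 1) * complex_of_real (B x)"
  have i: "set_integrable lborel {0<..} ?f" and v: "(LINT x:{0<..}|lborel. ?f x) = M"
    using M by (auto simp: has_mellin_def)
  have m: "set_borel_measurable lborel {0<..} ?f"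
    using i unfolding set_integrable_def set_borel_measurable_def by (rule borel_measurable_integrable)
  have im: "{0<..} = (\<lambda>y::real. \<tau> * exp (e * y)) ` UNIV"
  proof (intro equalityI subsetI)
    fix x :: real assume "x \<in> {0<..}"
    then show "x \<in> (\<lambda>y::real. \<tau> * exp (e * y)) ` UNIV"
      using \<tau> e by (intro image_eqI[of _ _ "ln (x / \<tau>) / e"]) auto
  qed (use \<tau> in auto)
  note sub = lborel_substitution[of UNIV "{0<..}" "\<lambda>y. \<tau> * exp (e * y)" "\<lambda>y. \<tau> * (e * exp (e * y))" ?f, OF _ im _ _ m]
  let ?c = "of_real (\<tau> * e) * of_real \<tau> powr (s / of_real e)"
  have c: "?c \<noteq> 0" using \<tau> e by simp
  have eq: "\<bar>\<tau> * (e * exp (e * y))\<bar> *\<^sub>R ?f (\<tau> * exp (e * y)) =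
      ?c * (exp (s * of_real y) * complex_of_real (log_pullback \<tau> e B y))" for y
  proof -
    let ?x = "\<tau> * exp (e * y)"
    have l: "ln ?x = ln \<tau> + e * y" using \<tau> by (simp add: ln_mult)
    have x: "?x > 0" using \<tau> by simp
    have "complex_of_real ?x powr (s / of_real e) = exp (s / of_real e * of_real (ln \<tau> + e * y))"
      using x unfolding l[symmetric] powr_def using \<tau> by (simp only: Ln_of_real of_real_eq_0_iff) simp
    also have "\<dots> = exp (s / of_real e * of_real (ln \<tau>)) * exp (s * of_real y)"
      using e by (simp add: ring_distribs exp_add mult_ac)
    also have "exp (s / of_real e * of_real (ln \<tau>)) = of_real \<tau> powr (s / of_real e)"
      using \<tau> by (simp add: powr_def Ln_of_real)
    finally have p: "complex_of_real ?x powr (s / of_real e) = of_real \<tau> powr (s / of_real e) * exp (s * of_real y)" .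
    have "\<bar>\<tau> * (e * exp (e * y))\<bar> *\<^sub>R ?f ?x =
        of_real (\<tau> * (e * exp (e * y))) * (complex_of_real ?x powr (s / of_real e) * complex_of_real (B ?x))"
      using \<tau> e by (simp add: scaleR_conv_of_real abs_mult)
    then show ?thesis unfolding p log_pullback_def by (simp add: mult_ac)
  qed
  have i2: "set_integrable lborel UNIV (\<lambda>y. \<bar>\<tau> * (e * exp (e * y))\<bar> *\<^sub>R ?f (\<tau> * exp (e * y)))"
    by (subst sub(1)) (use i \<tau> e in \<open>auto intro!: derivative_eq_intros inj_onI\<close>)
  have v2: "(LINT y:UNIV|lborel. \<bar>\<tau> * (e * exp (e * y))\<bar> *\<^sub>R ?f (\<tau> * exp (e * y))) = M"
    by (subst sub(2)) (use i v \<tau> e in \<open>auto intro!: derivative_eq_intros inj_onI\<close>)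
  let ?E = "\<lambda>y. exp (s * of_real y) * complex_of_real (log_pullback \<tau> e B y)"
  have "integrable lborel (\<lambda>y. ?c * ?E y)"
    using i2 unfolding eq by (simp add: set_integrable_def)
  then have "integrable lborel (\<lambda>y. inverse ?c * (?c * ?E y))" by (rule integrable_mult_right)
  moreover have "inverse ?c * (?c * ?E y) = ?E y" for y by (metis c left_inverse mult.assoc mult_1)
  ultimately show "bilateral_laplace_exists (log_pullback \<tau> e B) s"
    unfolding bilateral_laplace_exists_def by (simp only:)
  have "?c * bilateral_laplace (log_pullback \<tau> e B) s = M"
    using v2 unfolding eq bilateral_laplace_def by (simp add: set_lebesgue_integral_def)
  then show "bilateral_laplace (log_pullback \<tau> e B) s = of_real \<tau> powr (- s / of_real e) * M / of_real (\<tau> * e)"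
    using c \<tau> e by (auto simp: powr_minus field_simps)
qed

lemma has_mellin_exp_minus:
  assumes w: "Re w > 0"
  shows "has_mellin (\<lambda>x. exp (- x)) w (Gamma w)"
proof -
  let ?f = "\<lambda>t. complex_of_real t powr (w - 1) / of_real (exp t)"
  have m: "set_borel_measurable lborel {0<..} ?f"
    unfolding set_borel_measurable_def by measurable
  have i: "set_integrable lborel {0<..} ?f"
    using absolutely_integrable_Gamma_integral'[OF w] set_integrable_lborel_iff_absolutely_integrable[OF m] by simp
  have "(LINT t:{0<..}|lborel. ?f t) = Gamma w"
    using Gamma_integral_complex'[OF w] set_borel_integral_eq_integral(2)[OF i] by (simp add: integral_unique)
  with i show ?thesis by (simp add: has_mellin_def exp_minus divide_inverse)
qed

text \<open>Euler's integral in the same chart: the exponent e w y - \<tau> exp (e y) has the shape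
  required by Laplace's method.\<close>

lemma Gamma_integral_exp:
  assumes w: "Re w > 0" and \<tau>: "\<tau> > 0" and e: "e > 0"
  shows "(LINT y|lborel. exp (of_real e * w * of_real y - of_real (\<tau> * exp (e * y)))) =
      Gamma w * of_real \<tau> powr (- w) / of_real e"
proof -
  let ?s = "of_real e * (w - 1)"
  have s: "1 + ?s / of_real e = w" "- ?s / of_real e = 1 - w" using e by (simp_all add: field_simps)
  have M: "has_mellin (\<lambda>x. exp (- x)) (1 + ?s / of_real e) (Gamma w)"
    unfolding s by (rule has_mellin_exp_minus[OF w])
  have eq: "exp (?s * of_real y) * complex_of_real (log_pullback \<tau> e (\<lambda>x. exp (- x)) y) =
      exp (of_real e * w * of_real y - of_real (\<tau> * exp (e * y)))" for y
    unfolding log_pullback_def of_real_mult[of "exp _"] exp_of_real[symmetric] exp_add[symmetric]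
    by (simp add: algebra_simps)
  have "of_real \<tau> powr (1 - w) = of_real \<tau> * of_real \<tau> powr (- w)"
    using \<tau> by (simp add: powr_diff powr_minus divide_inverse)
  then show ?thesis
    using laplace_log_pullback(2)[OF M \<tau> e] \<tau> e unfolding bilateral_laplace_def s eq by (simp add: field_simps)
qed

section \<open>Uniform bounds and Laplace's method for Gamma\<close>

lemma norm_Gamma_le:
  fixes w :: complex
  assumes "Re w > 0"
  shows "norm (Gamma w) \<le> Gamma (Re w)"
proof -
  let ?E = "\<lambda>w y. exp (of_real 1 * w * of_real y - of_real (1 * exp (1 * y))) :: complex"
  have *: "(LINT y|lborel. ?E w y) = Gamma w" if "Re w > 0" for w
    using Gamma_integral_exp[OF that, of 1 1] by simp
  \<comment> \<open>The integrand at the real point is the modulus of the integrand at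
    \<open>w\<close>, so the triangle inequality for integrals is all that is used.\<close>
  have r: "?E (of_real (Re w)) y = of_real (norm (?E w y))" for y
    by (simp add: exp_diff norm_divide flip: exp_of_real)
  have "norm (Gamma w) \<le> (LINT y|lborel. norm (?E w y))"
    unfolding *[OF assms, symmetric] by (rule integral_norm_bound)
  moreover have "complex_of_real (LINT y|lborel. norm (?E w y)) = of_real (Gamma (Re w))"
    using *[of "of_real (Re w)"] assms unfolding r integral_complex_of_real by (simp add: Gamma_complex_of_real)
  ultimately show ?thesis by (simp only: of_real_eq_iff)
qed

text \<open>The quotient is, up to Gamma D, the transform of the nonnegative Beta kernel; its
  modulus is therefore at most its value at the real part.\<close>

lemma norm_Gamma_ratio_le:
  assumes D: "D > 0" and z: "Re z > 0"
  shows "norm (Gamma z * rGamma (z + of_real D)) \<le> Gamma (Re z) * rGamma (Re z + D)"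
proof -
  have G: "Gamma D > 0" by (rule Gamma_real_pos[OF D])
  let ?f = "\<lambda>z u. exp (- z * of_real u) * complex_of_real (beta_kernel D u)"
  have r: "?f (of_real (Re z)) u = of_real (norm (?f z u))" for u
    by (simp add: norm_mult flip: exp_of_real)
  have "norm (of_real (Gamma D) * Gamma z * rGamma (z + of_real D)) \<le> (LINT u|lborel. norm (?f z u))"
    unfolding beta_kernel_laplace(2)[OF D z, symmetric] bilateral_laplace_def by (rule integral_norm_bound)
  moreover have "complex_of_real (LINT u|lborel. norm (?f z u)) = of_real (Gamma D * Gamma (Re z) * rGamma (Re z + D))"
  proof -
    have "complex_of_real (LINT u|lborel. norm (?f z u)) = bilateral_laplace (beta_kernel D) (- of_real (Re z))"
      unfolding bilateral_laplace_def integral_complex_of_real[symmetric] r[symmetric] by simp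
    also have "\<dots> = of_real (Gamma D) * Gamma (of_real (Re z)) * rGamma (of_real (Re z) + of_real D)"
      using z by (intro beta_kernel_laplace(2)[OF D]) simp
    also have "\<dots> = of_real (Gamma D * Gamma (Re z) * rGamma (Re z + D))"
      using rGamma_complex_of_real[of "Re z + D"] by (simp add: Gamma_complex_of_real)
    finally show ?thesis .
  qed
  ultimately have "Gamma D * norm (Gamma z * rGamma (z + of_real D)) \<le> Gamma D * (Gamma (Re z) * rGamma (Re z + D))"
    using G by (simp add: norm_mult mult.assoc del: of_real_mult)
  then show ?thesis using G by simp
qed

text \<open>For negative x the right side grows only linearly, so a purely quadratic bound fails;
  the left side is quadratic near 0, linear at infinity, and serves all x at once.\<close>

lemma exp_minus_linear_lower_bound:
  fixes x :: real
  shows "x\<^sup>2 / (2 * (1 + \<bar>x\<bar>)) \<le> exp x - 1 - x"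
proof (cases "x \<ge> 0")
  case True
  have "x\<^sup>2 / (2 * (1 + \<bar>x\<bar>)) \<le> x\<^sup>2 / 2" using True by (intro divide_left_mono) auto
  also have "1 + x + x\<^sup>2 / 2 \<le> exp x" using exp_lower_Taylor_quadratic[OF True] by simp
  then have "x\<^sup>2 / 2 \<le> exp x - 1 - x" by simp
  finally show ?thesis .
next
  case False
  define t where "t = - x"
  have t: "t > 0" using False by (simp add: t_def)
  \<comment> \<open>This is the claim for x = - t with the denominator cleared; h(0) = 0 and h'(y) =
    2 y (1 - exp (- y)).\<close>
  define h where "h t = 2 * (1 + t) * exp (- t) + t\<^sup>2 - 2" for t :: real
  have "h 0 \<le> h t"
  proof (rule DERIV_nonneg_imp_nondecreasing[of 0 t h])
    fix y :: real assume y: "0 \<le> y" "y \<le> t"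
    have "(h has_real_derivative 2 * y * (1 - exp (- y))) (at y)"
      unfolding h_def[abs_def] by (auto intro!: derivative_eq_intros simp: algebra_simps)
    moreover have "2 * y * (1 - exp (- y)) \<ge> 0" using y by (intro mult_nonneg_nonneg) auto
    ultimately show "\<exists>z. (h has_real_derivative z) (at y) \<and> 0 \<le> z" by blast
  qed (use t in simp)
  then have "2 * (1 + t) * exp (- t) + t\<^sup>2 - 2 \<ge> 0" by (simp add: h_def)
  then have "t\<^sup>2 \<le> (exp (- t) - 1 + t) * (2 * (1 + t))"
    by (simp add: algebra_simps power2_eq_square)
  then have "t\<^sup>2 / (2 * (1 + t)) \<le> exp (- t) - 1 + t"
    using t by (subst pos_divide_le_eq) auto
  then show ?thesis using t by (simp add: t_def)
qed

lemma eps_sq: "\<tau> > 0 \<Longrightarrow> \<tau> * (eps \<tau>)\<^sup>2 = 2"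
  by (simp add: eps_def)

lemma eps_pos: "\<tau> > 0 \<Longrightarrow> eps \<tau> > 0"
  by (simp add: eps_def)

lemma eps_tendsto_0: "(eps \<longlongrightarrow> 0) at_top"
  unfolding eps_def[abs_def] by real_asymp

text \<open>A linear tail of any prescribed slope K once e \<le> 1 / K. The slope is later chosen to
  beat the exponential growth of the rest of the integrand.\<close>

lemma exponential_tail_bound:
  fixes \<tau> K y :: real
  assumes \<tau>: "\<tau> > 0" and K: "K > 0" "eps \<tau> \<le> 1 / K"
  shows "- \<tau> * (exp (eps \<tau> * y) - 1 - eps \<tau> * y) \<le> K\<^sup>2 - K * \<bar>y\<bar>"
proof -
  define e where "e = eps \<tau>"
  have e: "e > 0" "\<tau> * e\<^sup>2 = 2" using eps_pos[OF \<tau>] eps_sq[OF \<tau>] by (auto simp: e_def)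
  have "e * \<bar>y\<bar> \<le> 1 / K * \<bar>y\<bar>" using K(2) by (intro mult_right_mono) (auto simp: e_def)
  then have ey: "1 + e * \<bar>y\<bar> \<le> 1 + \<bar>y\<bar> / K" by simp
  have "K * \<bar>y\<bar> - K\<^sup>2 \<le> y\<^sup>2 / (1 + \<bar>y\<bar> / K)"
  proof -
    \<comment> \<open>The constant K^2 is chosen so that the terms K \<bar>y\<bar> cancel in this
      product.\<close>
    have "(K * \<bar>y\<bar> - K\<^sup>2) * (1 + \<bar>y\<bar> / K) = y\<^sup>2 - K\<^sup>2"
      using K by (simp add: field_simps power2_eq_square abs_mult_self_eq)
    also have "\<dots> \<le> y\<^sup>2" by simp
    finally have *: "(K * \<bar>y\<bar> - K\<^sup>2) * (1 + \<bar>y\<bar> / K) \<le> y\<^sup>2" .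
    have "0 < 1 + \<bar>y\<bar> / K" using K by (intro add_pos_nonneg) auto
    with * show ?thesis by (simp only: pos_le_divide_eq)
  qed
  also have "\<dots> \<le> y\<^sup>2 / (1 + e * \<bar>y\<bar>)"
    using ey e K by (intro divide_left_mono mult_pos_pos) (auto intro!: add_pos_nonneg)
  also have "\<dots> = \<tau> * ((e * y)\<^sup>2 / (2 * (1 + \<bar>e * y\<bar>)))"
  proof -
    have "\<tau> * (e * y)\<^sup>2 = 2 * y\<^sup>2" using e(2) by (simp add: power_mult_distrib mult.assoc[symmetric])
    then show ?thesis unfolding times_divide_eq_right
      using e(1) mult_divide_mult_cancel_left[of 2 "y\<^sup>2" "1 + \<bar>e * y\<bar>"] by (simp only: abs_mult abs_of_pos)
  qed
  also have "\<dots> \<le> \<tau> * (exp (e * y) - 1 - e * y)"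
    using \<tau> by (intro mult_left_mono exp_minus_linear_lower_bound) auto
  finally show ?thesis by (simp add: e_def)
qed

text \<open>Since \<tau> = 2 / e^2, the expression is 2 y^2 times the second-order Taylor quotient
  of exp at e y, which tends to 1 / 2.\<close>

lemma exponential_gauss_limit:
  fixes \<tau> :: "nat \<Rightarrow> real"
  assumes \<tau>: "filterlim \<tau> at_top sequentially"
  shows "(\<lambda>n. \<tau> n * (exp (eps (\<tau> n) * y) - 1 - eps (\<tau> n) * y)) \<longlonglongrightarrow> y\<^sup>2"
proof (cases "y = 0")
  case False
  have "((\<lambda>x::real. (exp x - 1 - x) / x\<^sup>2) \<longlongrightarrow> 1 / 2) (at 0)" by real_asymp
  moreover have "filterlim (\<lambda>n. eps (\<tau> n) * y) (at 0) sequentially"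
  proof -
    have "(\<lambda>n. eps (\<tau> n) * y) \<longlonglongrightarrow> 0 * y"
      by (intro tendsto_intros filterlim_compose[OF eps_tendsto_0 \<tau>])
    moreover have "\<forall>\<^sub>F n in sequentially. eps (\<tau> n) * y \<noteq> 0"
    proof -
      have "\<forall>\<^sub>F n in sequentially. \<tau> n > 0" using \<tau> by (simp add: filterlim_at_top_dense)
      then show ?thesis by eventually_elim (use False in \<open>auto dest: eps_pos\<close>)
    qed
    ultimately show ?thesis by (simp add: filterlim_at)
  qed
  ultimately have "(\<lambda>n. (exp (eps (\<tau> n) * y) - 1 - eps (\<tau> n) * y) / (eps (\<tau> n) * y)\<^sup>2) \<longlonglongrightarrow> 1 / 2"
    by (rule filterlim_compose)
  then have "(\<lambda>n. 2 * y\<^sup>2 * ((exp (eps (\<tau> n) * y) - 1 - eps (\<tau> n) * y) / (eps (\<tau> n) * y)\<^sup>2)) \<longlonglongrightarrow> 2 * y\<^sup>2 * (1 / 2)"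
    by (rule tendsto_mult_left)
  moreover have "\<forall>\<^sub>F n in sequentially. 2 * y\<^sup>2 * ((exp (eps (\<tau> n) * y) - 1 - eps (\<tau> n) * y) / (eps (\<tau> n) * y)\<^sup>2) =
      \<tau> n * (exp (eps (\<tau> n) * y) - 1 - eps (\<tau> n) * y)"
  proof -
    have "\<forall>\<^sub>F n in sequentially. \<tau> n > 0" using \<tau> by (simp add: filterlim_at_top_dense)
    then show ?thesis
    proof eventually_elim
      case (elim n)
      have "2 / (eps (\<tau> n))\<^sup>2 = \<tau> n" using eps_sq[OF elim] eps_pos[OF elim] by (simp add: field_simps)
      then have "\<tau> n * (exp (eps (\<tau> n) * y) - 1 - eps (\<tau> n) * y) =
          2 / (eps (\<tau> n))\<^sup>2 * (exp (eps (\<tau> n) * y) - 1 - eps (\<tau> n) * y)" by simp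
      then show ?case using False eps_pos[OF elim] by (simp add: power_mult_distrib)
    qed
  qed
  ultimately show ?thesis by (auto elim: Lim_transform_eventually)
qed simp

lemma exponential_integral_limit:
  fixes \<tau> \<alpha> :: "nat \<Rightarrow> real" and s :: "nat \<Rightarrow> complex" and a :: real and z :: complex
  assumes \<tau>: "filterlim \<tau> at_top sequentially" and \<alpha>: "\<alpha> \<longlonglongrightarrow> 2 * a" and s: "s \<longlonglongrightarrow> z"
  shows "(\<lambda>n. LINT y|lborel. exp ((of_real (\<alpha> n) + s n) * of_real y -
      of_real (\<tau> n * (exp (eps (\<tau> n) * y) - 1 - eps (\<tau> n) * y)))) \<longlonglongrightarrow>
      of_real (sqrt pi) * exp ((2 * of_real a + z)\<^sup>2 / 4)"
proof -
  let ?f = "\<lambda>n y. exp ((of_real (\<alpha> n) + s n) * of_real y -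
      of_real (\<tau> n * (exp (eps (\<tau> n) * y) - 1 - eps (\<tau> n) * y)))"
  let ?g = "\<lambda>y. exp ((2 * of_real a + z) * of_real y - of_real (y\<^sup>2))"
  have as: "(\<lambda>n. of_real (\<alpha> n) + s n) \<longlonglongrightarrow> of_real (2 * a) + z" by (intro tendsto_intros \<alpha> s)
  then obtain C where C: "C > 0" "\<And>n. norm (of_real (\<alpha> n) + s n) \<le> C"
    using convergent_imp_Bseq[of "\<lambda>n. of_real (\<alpha> n) + s n"] unfolding convergent_def Bseq_def by blast
  \<comment> \<open>One more than the bound on the linear coefficient, so that the majorant still
    decays like exp (- \<bar>y\<bar>).\<close>
  define K where "K = C + 1"
  have K: "K > 0" using C by (simp add: K_def)
  have "\<forall>\<^sub>F n in sequentially. \<tau> n > 0" using \<tau> by (simp add: filterlim_at_top_dense)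
  moreover have "\<forall>\<^sub>F n in sequentially. eps (\<tau> n) < 1 / K"
    by (rule order_tendstoD(2)[OF filterlim_compose[OF eps_tendsto_0 \<tau>]]) (use K in simp)
  ultimately have "\<forall>\<^sub>F n in sequentially. \<tau> n > 0 \<and> eps (\<tau> n) \<le> 1 / K" by eventually_elim auto
  then obtain N where N: "\<And>n. n \<ge> N \<Longrightarrow> \<tau> n > 0 \<and> eps (\<tau> n) \<le> 1 / K"
    unfolding eventually_sequentially by blast
  have bd: "norm (?f n y) \<le> exp (K\<^sup>2) * exp (- 1 * \<bar>y\<bar>)" if "n \<ge> N" for n y
  proof -
    have "Re ((of_real (\<alpha> n) + s n) * of_real y) \<le> norm ((of_real (\<alpha> n) + s n) * of_real y)" by (rule complex_Re_le_cmod)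
    also have "\<dots> \<le> C * \<bar>y\<bar>" unfolding norm_mult norm_of_real by (intro mult_right_mono C) auto
    finally have 1: "Re ((of_real (\<alpha> n) + s n) * of_real y) \<le> C * \<bar>y\<bar>" .
    have 2: "- \<tau> n * (exp (eps (\<tau> n) * y) - 1 - eps (\<tau> n) * y) \<le> K\<^sup>2 - K * \<bar>y\<bar>"
      using N[OF that] by (intro exponential_tail_bound K) auto
    have "norm (?f n y) = exp (Re ((of_real (\<alpha> n) + s n) * of_real y) + - \<tau> n * (exp (eps (\<tau> n) * y) - 1 - eps (\<tau> n) * y))"
      unfolding norm_exp_eq_Re by simp
    also have "\<dots> \<le> exp (K\<^sup>2 + - 1 * \<bar>y\<bar>)"
      using 1 2 by (simp only: exp_le_cancel_iff) (simp add: K_def algebra_simps)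
    finally show ?thesis by (simp only: exp_add)
  qed
  have lim: "(\<lambda>n. ?f n y) \<longlonglongrightarrow> ?g y" for y
  proof -
    have "(\<lambda>n. ?f n y) \<longlonglongrightarrow> exp ((of_real (2 * a) + z) * of_real y - of_real (y\<^sup>2))"
      by (intro tendsto_intros as exponential_gauss_limit \<tau>)
    then show ?thesis by simp
  qed
  have "(\<lambda>n. LINT y|lborel. ?f (n + N) y) \<longlonglongrightarrow> (LINT y|lborel. ?g y)"
  proof (rule integral_dominated_convergence[where w = "\<lambda>y. exp (K\<^sup>2) * exp (- 1 * \<bar>y\<bar>)"])
    show "integrable lborel (\<lambda>y. exp (K\<^sup>2) * exp (- 1 * \<bar>y\<bar>))"
      by (intro integrable_mult_right integrable_exp_abs) simp
    show "AE y in lborel. (\<lambda>n. ?f (n + N) y) \<longlonglongrightarrow> ?g y"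
      by (intro AE_I2 LIMSEQ_ignore_initial_segment[OF lim])
    show "AE y in lborel. norm (?f (n + N) y) \<le> exp (K\<^sup>2) * exp (- 1 * \<bar>y\<bar>)" for n
      by (intro AE_I2 bd) simp
  qed measurable
  then have "(\<lambda>n. LINT y|lborel. ?f n y) \<longlonglongrightarrow> (LINT y|lborel. ?g y)" by (rule LIMSEQ_offset)
  also have "(LINT y|lborel. ?g y) = of_real (sqrt pi) * bilateral_laplace (gauss 0) (2 * of_real a + z)"
  proof -
    have "?g y = of_real (sqrt pi) * (exp ((2 * of_real a + z) * of_real y) * complex_of_real (gauss 0 y))" for y
      by (simp add: gauss_def exp_diff exp_minus divide_inverse flip: exp_of_real)
    then show ?thesis unfolding bilateral_laplace_def by (simp only: integral_mult_right_zero)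
  qed
  finally show ?thesis by (simp add: gauss_laplace(2))
qed

text \<open>Numerator and denominator are the same exponential integral, once with \<open>s\<close>
  and once with 0; the factors exp \<tau>, 1 / e and \<tau>^(- A) cancel, and the limit is a
  quotient of two Gaussian integrals.\<close>

lemma Gamma_central_limit:
  fixes \<tau> A :: "nat \<Rightarrow> real" and s :: "nat \<Rightarrow> complex" and a :: real and z :: complex
  assumes \<tau>: "filterlim \<tau> at_top sequentially" and A: "(\<lambda>n. eps (\<tau> n) * (A n - \<tau> n)) \<longlonglongrightarrow> 2 * a"
    and s: "s \<longlonglongrightarrow> z"
  shows "(\<lambda>n. of_real (\<tau> n) powr (- s n / of_real (eps (\<tau> n))) *
      Gamma (of_real (A n) + s n / of_real (eps (\<tau> n))) / of_real (Gamma (A n))) \<longlonglongrightarrow> exp (of_real a * z + z\<^sup>2 / 4)"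
proof -
  let ?e = "\<lambda>n. eps (\<tau> n)"
  let ?J = "\<lambda>(s :: nat \<Rightarrow> complex) n. LINT y|lborel. exp ((of_real (?e n * (A n - \<tau> n)) + s n) * of_real y -
      of_real (\<tau> n * (exp (?e n * y) - 1 - ?e n * y)))"
  have J: "?J s \<longlonglongrightarrow> of_real (sqrt pi) * exp ((2 * of_real a + z)\<^sup>2 / 4)"
    by (rule exponential_integral_limit[OF \<tau> A s])
  have J0: "?J (\<lambda>n. 0) \<longlonglongrightarrow> of_real (sqrt pi) * exp ((2 * complex_of_real a + 0)\<^sup>2 / 4)"
    by (rule exponential_integral_limit[OF \<tau> A tendsto_const])
  have "(\<lambda>n. ?J s n / ?J (\<lambda>n. 0) n) \<longlonglongrightarrow> (of_real (sqrt pi) * exp ((2 * of_real a + z)\<^sup>2 / 4)) /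
      (of_real (sqrt pi) * exp ((2 * of_real a + 0)\<^sup>2 / 4))"
    by (intro tendsto_divide J J0) auto
  also have "(of_real (sqrt pi) * exp ((2 * of_real a + z)\<^sup>2 / 4)) /
      (of_real (sqrt pi) * exp ((2 * of_real a + 0)\<^sup>2 / 4)) = exp (of_real a * z + z\<^sup>2 / 4)"
    by (simp add: exp_diff[symmetric] power2_eq_square field_simps)
  finally have lim: "(\<lambda>n. ?J s n / ?J (\<lambda>n. 0) n) \<longlonglongrightarrow> exp (of_real a * z + z\<^sup>2 / 4)" .
  have e0: "(\<lambda>n. ?e n) \<longlonglongrightarrow> 0" by (rule filterlim_compose[OF eps_tendsto_0 \<tau>])
  \<comment> \<open>As e A tends to infinity, A + s / e eventually lies in the right half-plane,
    where Euler's integral is available.\<close>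
  have big: "filterlim (\<lambda>n. ?e n * A n) at_top sequentially"
  proof -
    have "filterlim (\<lambda>t. eps t * t) at_top at_top" unfolding eps_def[abs_def] by real_asymp
    then have "filterlim (\<lambda>n. ?e n * \<tau> n) at_top sequentially" by (rule filterlim_compose[OF _ \<tau>])
    from filterlim_tendsto_add_at_top[OF A this] show ?thesis by (simp add: algebra_simps)
  qed
  have "\<forall>\<^sub>F n in sequentially. \<tau> n > 0" using \<tau> by (simp add: filterlim_at_top_dense)
  moreover have "\<forall>\<^sub>F n in sequentially. ?e n * A n > 0" using big by (simp add: filterlim_at_top_dense)
  moreover have "\<forall>\<^sub>F n in sequentially. Re (s n) + ?e n * A n > 0"
  proof -
    have "(\<lambda>n. Re (s n)) \<longlonglongrightarrow> Re z" by (intro tendsto_intros s)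
    from filterlim_tendsto_add_at_top[OF this big] show ?thesis by (simp add: filterlim_at_top_dense)
  qed
  ultimately have "\<forall>\<^sub>F n in sequentially. ?J s n / ?J (\<lambda>n. 0) n = of_real (\<tau> n) powr (- s n / of_real (?e n)) *
      Gamma (of_real (A n) + s n / of_real (?e n)) / of_real (Gamma (A n))"
  proof eventually_elim
    case (elim n)
    have e: "?e n > 0" using eps_pos[OF elim(1)] .
    have An: "A n > 0" using elim(2) e by (simp add: zero_less_mult_iff)
    have JG: "?J s n = of_real (exp (\<tau> n)) * (Gamma (of_real (A n) + s n / of_real (?e n)) *
        of_real (\<tau> n) powr (- (of_real (A n) + s n / of_real (?e n))) / of_real (?e n))"
      if "Re (s n) + ?e n * A n > 0" for s :: "nat \<Rightarrow> complex"
    proof -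
      let ?w = "of_real (A n) + s n / of_real (?e n)"
      have w: "Re ?w > 0" using that e by (simp add: field_simps)
      have ew: "of_real (?e n) * ?w = of_real (?e n * A n) + s n" using e by (simp add: algebra_simps)
      have "exp ((of_real (?e n * (A n - \<tau> n)) + s n) * of_real y - of_real (\<tau> n * (exp (?e n * y) - 1 - ?e n * y))) =
          of_real (exp (\<tau> n)) * exp (of_real (?e n) * ?w * of_real y - of_real (\<tau> n * exp (?e n * y)))" for y
        unfolding ew by (simp add: exp_of_real[symmetric] exp_add[symmetric] algebra_simps)
      then have "?J s n = of_real (exp (\<tau> n)) * (LINT y|lborel. exp (of_real (?e n) * ?w * of_real y - of_real (\<tau> n * exp (?e n * y))))"
        by (simp only: integral_mult_right_zero)
      then show ?thesis unfolding Gamma_integral_exp[OF w elim(1) e] .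
    qed
    let ?r = "\<lambda>w. complex_of_real (\<tau> n) powr w"
    have G: "Gamma (A n) > 0" by (rule Gamma_real_pos[OF An])
    have p: "?r (- (of_real (A n) + s n / of_real (?e n))) = ?r (- of_real (A n)) * ?r (- s n / of_real (?e n))"
      unfolding powr_add[symmetric] by simp
    have J0n: "?J (\<lambda>n. 0) n = of_real (exp (\<tau> n)) * (of_real (Gamma (A n)) * ?r (- of_real (A n)) / of_real (?e n))"
      using JG[of "\<lambda>n. 0"] elim by (simp add: Gamma_complex_of_real)
    have "?r (- of_real (A n)) \<noteq> 0" using elim by simp
    then show ?case
      unfolding JG[of s, OF elim(3)] J0n p using G e by (simp add: divide_simps)
  qed
  then show ?thesis using lim by (auto elim: Lim_transform_eventually)
qed

text \<open>Shifting the argument by about \<open>\<tau>\<close> with the functional equation produces that many factors, each of modulus at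
  least \<open>sqrt (1 + u\<^sup>2 / (32 * \<tau>))\<close> after normalisation.\<close>

lemma Gamma_vertical_decay:
  fixes A \<tau> u :: real and l :: nat
  assumes l: "l \<ge> 1" and \<tau>: "\<tau> \<ge> 2 * real l" and A: "A > 0" "A \<le> 2 * \<tau>"
  shows "norm (Gamma (of_real A + \<i> * of_real u / of_real (eps \<tau>))) \<le> Gamma A * (128 * real l / (1 + u\<^sup>2)) ^ l"
proof -
  define v where "v = u / eps \<tau>"
  define M where "M = nat \<lceil>\<tau>\<rceil>"
  define y where "y = v\<^sup>2 / (A + M)\<^sup>2"
  \<comment> \<open>Bernoulli's inequality turns a block of \<open>q\<close> factors into 1 + q y,
    and 2 l such blocks fit into \<open>M\<close>. The doubling compensates the square root taken
    later.\<close>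
  define q where "q = M div (2 * l)"
  have \<tau>1: "\<tau> \<ge> 1" "\<tau> > 0" using l \<tau> by auto
  have M: "\<tau> \<le> M" "real M \<le> \<tau> + 1" using \<tau>1 unfolding M_def by linarith+
  have v2: "v\<^sup>2 = u\<^sup>2 * \<tau> / 2"
    using eps_sq[OF \<tau>1(2)] eps_pos[OF \<tau>1(2)] by (simp add: v_def power_divide field_simps)
  have y0: "y \<ge> 0" by (simp add: y_def)
  have y: "u\<^sup>2 / (32 * M) \<le> y"
  proof -
    \<comment> \<open>A \<le> 2 \<tau> and M \<le> \<tau> + 1 \<le> 2 \<tau>; with v^2 = u^2 \<tau>
      / 2 this is the source of the constant 32.\<close>
    have "(A + M)\<^sup>2 \<le> (4 * \<tau>)\<^sup>2" using A M \<tau>1 by (intro power_mono) auto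
    then have "v\<^sup>2 / (4 * \<tau>)\<^sup>2 \<le> y" unfolding y_def using A by (intro divide_left_mono) auto
    moreover have "v\<^sup>2 / (4 * \<tau>)\<^sup>2 = u\<^sup>2 / (32 * \<tau>)" unfolding v2 using \<tau>1 by (simp add: power2_eq_square)
    moreover have "u\<^sup>2 / (32 * M) \<le> u\<^sup>2 / (32 * \<tau>)" using \<tau>1 M by (intro divide_left_mono) auto
    ultimately show ?thesis by linarith
  qed
  \<comment> \<open>Because q \<ge> 1, M < 2 l (q + 1) \<le> 4 l q, and 128 = 4 * 32.\<close>
  have qy: "u\<^sup>2 / (128 * l) \<le> q * y"
  proof -
    have "2 * l \<le> M" using \<tau> M(1) by linarith
    then have "q \<ge> 1" using l by (simp add: q_def div_greater_zero_iff Suc_le_eq)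
    have "M < 2 * l * (q + 1)" using l unfolding q_def by (simp add: dividend_less_times_div)
    also have "\<dots> \<le> 4 * l * q" using \<open>q \<ge> 1\<close> by (simp add: algebra_simps)
    finally have "real M \<le> 4 * l * q" by (metis less_imp_le of_nat_le_iff of_nat_mult of_nat_numeral)
    then have "u\<^sup>2 * M \<le> u\<^sup>2 * (4 * l * q)" by (intro mult_left_mono) auto
    then have "u\<^sup>2 / (128 * l) \<le> q * (u\<^sup>2 / (32 * M))"
      using l \<tau>1 M by (simp add: field_simps)
    also have "\<dots> \<le> q * y" by (intro mult_left_mono y) auto
    finally show ?thesis .
  qed
  have pow: "((1 + u\<^sup>2) / (128 * l)) ^ (2 * l) \<le> (1 + y) ^ M"
  proof -
    have "(1 + u\<^sup>2) / (128 * l) \<le> 1 + q * y"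
    proof -
      have "1 / (128 * real l) \<le> 1" using l by simp
      then show ?thesis using qy unfolding add_divide_distrib by linarith
    qed
    also have "\<dots> \<le> (1 + y) ^ q" by (rule Bernoulli_inequality) (use y0 in linarith)
    finally have "((1 + u\<^sup>2) / (128 * l)) ^ (2 * l) \<le> ((1 + y) ^ q) ^ (2 * l)"
      by (rule power_mono) simp
    also have "\<dots> = (1 + y) ^ (q * (2 * l))" by (simp add: power_mult)
    also have "\<dots> \<le> (1 + y) ^ M" unfolding q_def using y0 by (intro power_increasing) auto
    finally show ?thesis .
  qed
  have root: "((1 + u\<^sup>2) / (128 * l)) ^ l \<le> sqrt (1 + y) ^ M"
  proof -
    have a: "(sqrt (1 + y) ^ M)\<^sup>2 = (1 + y) ^ M"
      unfolding power_mult[symmetric] mult.commute[of M] unfolding power_mult using y0 by simp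
    have "(((1 + u\<^sup>2) / (128 * l)) ^ l)\<^sup>2 \<le> (sqrt (1 + y) ^ M)\<^sup>2"
      using pow unfolding power_even_eq a .
    then show ?thesis by (rule power2_le_imp_le) (use y0 in simp)
  qed
  let ?z = "of_real A + \<i> * of_real v"
  have fac: "(A + j) * sqrt (1 + y) \<le> norm (?z + of_nat j)" if "j < M" for j
  proof -
    have "v\<^sup>2 / (A + M)\<^sup>2 \<le> v\<^sup>2 / (A + j)\<^sup>2"
      using A that by (intro divide_left_mono power_mono mult_pos_pos) auto
    then have "1 + y \<le> 1 + v\<^sup>2 / (A + j)\<^sup>2" by (simp add: y_def)
    also have "(A + j)\<^sup>2 * (1 + v\<^sup>2 / (A + j)\<^sup>2) = (A + j)\<^sup>2 + v\<^sup>2" using A by (simp add: field_simps)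
    finally have "sqrt ((A + j)\<^sup>2 * (1 + y)) \<le> sqrt ((A + j)\<^sup>2 + v\<^sup>2)"
      by (metis mult_left_mono real_sqrt_le_mono zero_le_power2)
    then show ?thesis using A by (simp add: real_sqrt_mult cmod_def)
  qed
  \<comment> \<open>One y serves all factors because A + j \<le> A + M; the real Pochhammer symbol
    will cancel against Gamma (A + M).\<close>
  have "pochhammer A M * sqrt (1 + y) ^ M = (\<Prod>j<M. (A + j) * sqrt (1 + y))"
    by (simp add: pochhammer_prod prod.distrib atLeast0LessThan)
  also have "\<dots> \<le> (\<Prod>j<M. norm (?z + of_nat j))" using A y0 by (intro prod_mono) (auto intro!: fac)
  also have "\<dots> = norm (pochhammer ?z M)" by (simp add: pochhammer_prod prod_norm atLeast0LessThan)
  finally have P: "pochhammer A M * sqrt (1 + y) ^ M \<le> norm (pochhammer ?z M)" .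
  have Apos: "pochhammer A M > 0" using A by (intro pochhammer_pos) auto
  have nz: "?z \<notin> \<int>\<^sub>\<le>\<^sub>0" "A \<notin> \<int>\<^sub>\<le>\<^sub>0" using A by (auto elim!: nonpos_Ints_cases simp: complex_eq_iff)
  have "pochhammer A M * sqrt (1 + y) ^ M * norm (Gamma ?z) \<le> norm (pochhammer ?z M) * norm (Gamma ?z)"
    by (intro mult_right_mono P) simp
  also have "\<dots> = norm (Gamma (?z + of_nat M))"
    using pochhammer_Gamma[OF nz(1), of M] nz by (simp add: norm_mult[symmetric] Gamma_eq_zero_iff)
  also have "\<dots> \<le> Gamma (A + M)" using norm_Gamma_le[of "?z + of_nat M"] A by simp
  also have "\<dots> = pochhammer A M * Gamma A"
    using pochhammer_Gamma[OF nz(2), of M] nz by (simp add: Gamma_eq_zero_iff)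
  finally have "sqrt (1 + y) ^ M * norm (Gamma ?z) \<le> Gamma A"
    using Apos by (simp add: mult.assoc)
  moreover have "((1 + u\<^sup>2) / (128 * l)) ^ l * norm (Gamma ?z) \<le> sqrt (1 + y) ^ M * norm (Gamma ?z)"
    by (intro mult_right_mono root) simp
  ultimately have "((1 + u\<^sup>2) / (128 * l)) ^ l * norm (Gamma ?z) \<le> Gamma A" by linarith
  moreover have "((1 + u\<^sup>2) / (128 * l)) ^ l > 0" using l by (simp add: add_pos_nonneg)
  ultimately have "norm (Gamma ?z) \<le> Gamma A / ((1 + u\<^sup>2) / (128 * l)) ^ l"
    by (simp add: pos_le_divide_eq mult.commute)
  then show ?thesis by (simp add: v_def power_divide)
qed

text \<open>The Beta kernel is taken with exponent \<open>D\<close> instead of \<open>D - 1\<close>, because \<open>D\<close> may tend to \<open>0\<close>.\<close>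

lemma beta_integral_limit:
  fixes e D :: "nat \<Rightarrow> real" and \<omega> :: "nat \<Rightarrow> complex" and w :: complex and d :: real
  assumes e: "\<And>n. e n > 0" "e \<longlonglongrightarrow> 0" and \<omega>: "\<omega> \<longlonglongrightarrow> w" "Re w > 0"
    and D: "\<And>n. D n \<ge> 0" "D \<longlonglongrightarrow> d"
  shows "(\<lambda>n. LINT v|lborel. exp (- \<omega> n * of_real v) * complex_of_real (beta_kernel (D n + 1) (e n * v) / e n powr D n))
      \<longlonglongrightarrow> bilateral_laplace (gamma_kernel (d + 1)) (- w)"
proof -
  let ?f = "\<lambda>n v. exp (- \<omega> n * of_real v) * complex_of_real (beta_kernel (D n + 1) (e n * v) / e n powr D n)"
  let ?g = "\<lambda>v. exp (- w * of_real v) * complex_of_real (gamma_kernel (d + 1) v)"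
  define \<kappa> where "\<kappa> = Re w / 2"
  have \<kappa>: "\<kappa> > 0" using \<omega> by (simp add: \<kappa>_def)
  obtain C where C: "\<And>n. norm (D n) \<le> C" using convergent_imp_Bseq[of D] D unfolding convergent_def Bseq_def by blast
  \<comment> \<open>An integer above all \<open>D n\<close>: the moving powers are dominated by (1 +
    v)^k, where the base 1 + v makes the power monotone in its exponent.\<close>
  define k where "k = nat \<lceil>C\<rceil>"
  have k: "D n \<le> real k" for n using C[of n] unfolding k_def by (simp add: abs_le_iff) linarith
  define B where "B = fact k * (2 / \<kappa>) ^ k * exp (\<kappa> / 2)"
  have B: "(1 + v) ^ k \<le> B * exp (\<kappa> / 2 * v)" if "v > 0" for v
  proof -
    have "(\<kappa> / 2 * (1 + v)) ^ k \<le> fact k * exp (\<kappa> / 2 * (1 + v))" using \<kappa> that by (intro power_le_fact_exp) auto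
    then have "(2 / \<kappa>) ^ k * (\<kappa> / 2 * (1 + v)) ^ k \<le> (2 / \<kappa>) ^ k * (fact k * exp (\<kappa> / 2 * (1 + v)))"
      using \<kappa> by (intro mult_left_mono) auto
    also have "(2 / \<kappa>) ^ k * (\<kappa> / 2 * (1 + v)) ^ k = (1 + v) ^ k"
    proof -
      have "2 / \<kappa> * (\<kappa> / 2 * (1 + v)) = 1 + v" using \<kappa> by simp
      then show ?thesis by (simp only: power_mult_distrib[symmetric])
    qed
    also have "(2 / \<kappa>) ^ k * (fact k * exp (\<kappa> / 2 * (1 + v))) = B * exp (\<kappa> / 2 * v)"
      unfolding B_def by (simp add: ring_distribs exp_add)
    finally show ?thesis .
  qed
  have B0: "B \<ge> 0" using \<kappa> by (simp add: B_def)
  have "(\<lambda>n. Re (\<omega> n)) \<longlonglongrightarrow> Re w" by (intro tendsto_intros \<omega>)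
  then have "\<forall>\<^sub>F n in sequentially. Re (\<omega> n) > \<kappa>" by (rule order_tendstoD(1)) (use \<omega> in \<open>simp add: \<kappa>_def\<close>)
  then obtain N where N: "\<And>n. n \<ge> N \<Longrightarrow> Re (\<omega> n) > \<kappa>" unfolding eventually_sequentially by blast
  \<comment> \<open>After u = e v the kernel is a power of (1 - exp (- e v)) / e, which lies between
    0 and v and tends to v.\<close>
  have eqv: "beta_kernel (D n + 1) (e n * v) / e n powr D n = ((1 - exp (- (e n * v))) / e n) powr D n" if "v > 0" for n v
    using that e(1)[of n] by (simp add: beta_kernel_def powr_divide)
  have zero: "beta_kernel c (e n * v) = 0" "gamma_kernel c v = 0" if "v \<le> 0" for c v n
    using that e(1)[of n] by (auto simp: beta_kernel_def gamma_kernel_def zero_less_mult_iff)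
  have base: "0 < (1 - exp (- (e n * v))) / e n" "(1 - exp (- (e n * v))) / e n \<le> v" if "v > 0" for n v
  proof -
    show "0 < (1 - exp (- (e n * v))) / e n" using that e(1)[of n] by simp
    have "1 - exp (- (e n * v)) \<le> e n * v" using exp_ge_add_one_self[of "- (e n * v)"] by simp
    then show "(1 - exp (- (e n * v))) / e n \<le> v" using e(1)[of n] by (simp add: divide_le_eq mult.commute)
  qed
  have bd: "norm (?f n v) \<le> B * (exp (- (\<kappa> / 2) * v) * gamma_kernel 1 v)" if n: "n \<ge> N" for n v
  proof (cases "v > 0")
    case True
    have "((1 - exp (- (e n * v))) / e n) powr D n \<le> (1 + v) powr D n"
      using base[OF True, of n] D by (intro powr_mono2) auto
    also have "\<dots> \<le> (1 + v) powr real k" using True k by (intro powr_mono) auto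
    also have "\<dots> = (1 + v) ^ k" using True by (simp add: powr_realpow)
    also have "\<dots> \<le> B * exp (\<kappa> / 2 * v)" by (rule B[OF True])
    finally have 1: "((1 - exp (- (e n * v))) / e n) powr D n \<le> B * exp (\<kappa> / 2 * v)" .
    have "norm (?f n v) = exp (- Re (\<omega> n) * v) * ((1 - exp (- (e n * v))) / e n) powr D n"
      unfolding eqv[OF True] by (simp add: norm_mult)
    also have "\<dots> \<le> exp (- \<kappa> * v) * (B * exp (\<kappa> / 2 * v))"
      using True N[OF n] B0 by (intro mult_mono 1) auto
    also have "\<dots> = B * exp (- \<kappa> * v + \<kappa> / 2 * v)" by (simp only: exp_add mult_ac)
    also have "- \<kappa> * v + \<kappa> / 2 * v = - (\<kappa> / 2) * v" by (simp add: algebra_simps)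
    finally show ?thesis using True by (simp add: gamma_kernel_def)
  qed (simp add: zero)
  have lim: "(\<lambda>n. ?f n v) \<longlonglongrightarrow> ?g v" for v
  proof (cases "v > 0")
    case True
    have "((\<lambda>x. (1 - exp (- (x * v))) / x) \<longlongrightarrow> v) (at_right 0)" by real_asymp
    moreover have "filterlim e (at_right 0) sequentially"
      using e(2) less_imp_neq[OF e(1), symmetric] e(1) by (simp add: filterlim_at)
    ultimately have "(\<lambda>n. (1 - exp (- (e n * v))) / e n) \<longlonglongrightarrow> v" by (rule filterlim_compose)
    then have "(\<lambda>n. ((1 - exp (- (e n * v))) / e n) powr D n) \<longlonglongrightarrow> v powr d"
      using True D by (intro tendsto_powr) auto
    from tendsto_of_real[OF this] have "(\<lambda>n. exp (- \<omega> n * of_real v) * complex_of_real (((1 - exp (- (e n * v))) / e n) powr D n)) \<longlonglongrightarrow>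
        exp (- w * of_real v) * complex_of_real (v powr d)"
      by (intro tendsto_mult tendsto_exp tendsto_minus tendsto_const \<omega>)
    then show ?thesis using True unfolding eqv[OF True] by (simp add: gamma_kernel_def)
  qed (simp add: zero)
  have "(\<lambda>n. LINT v|lborel. ?f (n + N) v) \<longlonglongrightarrow> (LINT v|lborel. ?g v)"
  proof (rule integral_dominated_convergence[where w = "\<lambda>v. B * (exp (- (\<kappa> / 2) * v) * gamma_kernel 1 v)"])
    show "integrable lborel (\<lambda>v. B * (exp (- (\<kappa> / 2) * v) * gamma_kernel 1 v))"
      using gamma_kernel_real[of 1 "\<kappa> / 2"] \<kappa> by (intro integrable_mult_right) (simp add: has_bochner_integral_iff)
    show "AE v in lborel. (\<lambda>n. ?f (n + N) v) \<longlonglongrightarrow> ?g v"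
      by (intro AE_I2 LIMSEQ_ignore_initial_segment[OF lim])
    show "AE v in lborel. norm (?f (n + N) v) \<le> B * (exp (- (\<kappa> / 2) * v) * gamma_kernel 1 v)" for n
      by (intro AE_I2 bd) simp
  qed measurable
  then show ?thesis unfolding bilateral_laplace_def by (rule LIMSEQ_offset)
qed

text \<open>The Beta integral with exponent D produces rGamma (z + D + 1), where z = \<omega> / e.
  The extra factor \<omega> + e D = e (z + D) lowers the argument by the functional equation; in the
  limit it becomes w and lowers the power d + 1 to d.\<close>

lemma Gamma_ratio_asymp:
  fixes e D :: "nat \<Rightarrow> real" and \<omega> :: "nat \<Rightarrow> complex" and w :: complex and d :: real
  assumes e: "\<And>n. e n > 0" "e \<longlonglongrightarrow> 0" and \<omega>: "\<omega> \<longlonglongrightarrow> w" "Re w > 0"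
    and D: "\<And>n. D n \<ge> 0" "D \<longlonglongrightarrow> d"
  shows "(\<lambda>n. of_real (e n powr (- D n)) * (Gamma (\<omega> n / of_real (e n)) * rGamma (\<omega> n / of_real (e n) + of_real (D n))))
      \<longlonglongrightarrow> w powr (- of_real d)"
proof -
  have d: "d \<ge> 0" using LIMSEQ_le_const[OF D(2)] D(1) by blast
  have w0: "w \<noteq> 0" using \<omega> by auto
  let ?I = "\<lambda>n. LINT v|lborel. exp (- \<omega> n * of_real v) * complex_of_real (beta_kernel (D n + 1) (e n * v) / e n powr D n)"
  have G: "Gamma (D n + 1) > 0" for n using D(1)[of n] by (intro Gamma_real_pos) linarith
  have Gd: "Gamma (d + 1) > 0" using d by (intro Gamma_real_pos) linarith
  then have Gd0: "complex_of_real (Gamma (d + 1)) \<noteq> 0" by simp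
  have "(\<lambda>n. Gamma (D n + 1)) \<longlonglongrightarrow> Gamma (d + 1)"
    using d by (intro tendsto_Gamma tendsto_intros D) (auto elim!: nonpos_Ints_cases)
  then have "(\<lambda>n. ?I n / of_real (Gamma (D n + 1)) * (\<omega> n + of_real (e n * D n))) \<longlonglongrightarrow>
      bilateral_laplace (gamma_kernel (d + 1)) (- w) / of_real (Gamma (d + 1)) * (w + of_real (0 * d))"
    using Gd0 d by (intro tendsto_intros beta_integral_limit assms) (auto elim!: nonpos_Ints_cases)
  also have "bilateral_laplace (gamma_kernel (d + 1)) (- w) / of_real (Gamma (d + 1)) * (w + of_real (0 * d)) = w powr (- of_real d)"
  proof -
    have "bilateral_laplace (gamma_kernel (d + 1)) (- w) = of_real (Gamma (d + 1)) * w powr (- of_real (d + 1))"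
      using d \<omega> by (intro gamma_kernel_laplace) auto
    then show ?thesis using w0 Gd by (simp add: powr_add powr_minus powr_diff field_simps)
  qed
  finally have lim: "(\<lambda>n. ?I n / of_real (Gamma (D n + 1)) * (\<omega> n + of_real (e n * D n))) \<longlonglongrightarrow> w powr (- of_real d)" .
  have "(\<lambda>n. Re (\<omega> n)) \<longlonglongrightarrow> Re w" by (intro tendsto_intros \<omega>)
  then have "\<forall>\<^sub>F n in sequentially. Re (\<omega> n) > 0" by (rule order_tendstoD(1)) (rule \<omega>)
  then have "\<forall>\<^sub>F n in sequentially. ?I n / of_real (Gamma (D n + 1)) * (\<omega> n + of_real (e n * D n)) =
      of_real (e n powr (- D n)) * (Gamma (\<omega> n / of_real (e n)) * rGamma (\<omega> n / of_real (e n) + of_real (D n)))"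
  proof eventually_elim
    case (elim n)
    let ?z = "\<omega> n / of_real (e n)"
    have z: "Re ?z > 0" using elim e(1)[of n] by simp
    have en: "e n > 0" by (rule e)
    let ?h = "\<lambda>u. exp (- ?z * of_real u) * complex_of_real (beta_kernel (D n + 1) u)"
    have "?I n = (LINT v|lborel. of_real (1 / e n powr D n) * ?h (0 + e n * v))"
      using en by (intro Bochner_Integration.integral_cong refl) simp
    also have "\<dots> = of_real (1 / e n powr D n) * (LINT v|lborel. ?h (0 + e n * v))"
      by (rule integral_mult_right_zero)
    also have "(LINT v|lborel. ?h (0 + e n * v)) = bilateral_laplace (beta_kernel (D n + 1)) (- ?z) / of_real (e n)"
      unfolding bilateral_laplace_def using en
      by (subst lborel_integral_real_affine[of "e n" ?h 0]) (auto simp: scaleR_conv_of_real)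
    also have "bilateral_laplace (beta_kernel (D n + 1)) (- ?z) =
        of_real (Gamma (D n + 1)) * Gamma ?z * rGamma (?z + of_real (D n + 1))"
      using D(1)[of n] by (intro beta_kernel_laplace z) linarith
    finally have I: "?I n / of_real (Gamma (D n + 1)) =
        of_real (e n powr (- D n)) / of_real (e n) * (Gamma ?z * rGamma (?z + of_real (D n) + 1))"
      using G[of n] en by (simp add: powr_minus field_simps)
    have s: "\<omega> n + of_real (e n * D n) = of_real (e n) * (?z + of_real (D n))"
      using en by (simp add: field_simps)
    show ?case unfolding I s rGamma_plus1[of "?z + of_real (D n)", symmetric] using en by simp
  qed
  then show ?thesis using lim by (auto elim: Lim_transform_eventually)
qed

section \<open>Difference quotients of convergent holomorphic functions\<close>

text \<open>If uniformity fails, compactness yields bad points converging along a subsequence. The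
  hypothesis speaks about full sequences, so the gaps are filled with the limit point.\<close>

lemma continuous_convergence_imp_uniform_limit:
  fixes f :: "nat \<Rightarrow> 'a::metric_space \<Rightarrow> 'b::metric_space"
  assumes K: "compact K" and g: "continuous_on K g"
    and conv: "\<And>s z. (\<And>n. s n \<in> K) \<Longrightarrow> z \<in> K \<Longrightarrow> s \<longlonglongrightarrow> z \<Longrightarrow> (\<lambda>n. f n (s n)) \<longlonglongrightarrow> g z"
  shows "uniform_limit K f g sequentially"
proof (rule ccontr)
  assume "\<not> uniform_limit K f g sequentially"
  then obtain \<eta> where \<eta>: "\<eta> > 0" "\<forall>N. \<exists>n\<ge>N. \<exists>x\<in>K. dist (f n x) (g x) \<ge> \<eta>"
    unfolding uniform_limit_sequentially_iff by (auto simp: not_less)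
  define P where "P n \<longleftrightarrow> (\<exists>x\<in>K. dist (f n x) (g x) \<ge> \<eta>)" for n
  have inf: "infinite {n. P n}" unfolding infinite_nat_iff_unbounded_le using \<eta>(2) by (auto simp: P_def)
  define r where "r = enumerate {n. P n}"
  have r: "strict_mono r" "P (r k)" for k
    using strict_mono_enumerate[OF inf] enumerate_in_set[OF inf, of k] by (auto simp: r_def)
  from r(2) obtain x where x: "\<And>k. x k \<in> K" "\<And>k. dist (f (r k) (x k)) (g (x k)) \<ge> \<eta>"
    unfolding P_def by metis
  obtain l q where l: "l \<in> K" "strict_mono q" "(x \<circ> q) \<longlonglongrightarrow> l"
    using K x(1) unfolding compact_eq_seq_compact_metric seq_compact_def by metis
  define R where "R = r \<circ> q"
  have R: "strict_mono R" using r l by (simp add: R_def strict_mono_o)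
  have injR: "inj R" using R by (rule strict_mono_imp_inj_on)
  define s where "s n = (if n \<in> range R then x (q (inv R n)) else l)" for n
  have sR: "s (R k) = x (q k)" for k using injR by (simp add: s_def)
  have sl: "s \<longlonglongrightarrow> l"
  proof (rule metric_LIMSEQ_I)
    fix e :: real assume e: "e > 0"
    then obtain k0 where k0: "\<And>k. k \<ge> k0 \<Longrightarrow> dist (x (q k)) l < e"
      using l(3) unfolding lim_sequentially o_def by blast
    have "dist (s n) l < e" if n: "n \<ge> R k0" for n
    proof (cases "n \<in> range R")
      case True
      then obtain k where k: "n = R k" by auto
      with n R have "k \<ge> k0" by (simp add: strict_mono_less_eq)
      then show ?thesis using k0 by (simp add: k sR)
    qed (use e in \<open>simp add: s_def\<close>)
    then show "\<exists>no. \<forall>n\<ge>no. dist (s n) l < e" by blast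
  qed
  have "(\<lambda>n. f n (s n)) \<longlonglongrightarrow> g l" by (rule conv[OF _ l(1) sl]) (use x l in \<open>simp add: s_def\<close>)
  then have "((\<lambda>n. f n (s n)) \<circ> R) \<longlonglongrightarrow> g l" by (rule LIMSEQ_subseq_LIMSEQ[OF _ R])
  then have 1: "(\<lambda>k. f (R k) (x (q k))) \<longlonglongrightarrow> g l" by (simp add: o_def sR)
  have 2: "(\<lambda>k. g (x (q k))) \<longlonglongrightarrow> g l"
    using g l x(1) unfolding continuous_on_sequentially o_def by auto
  have "(\<lambda>k. dist (f (R k) (x (q k))) (g (x (q k)))) \<longlonglongrightarrow> dist (g l) (g l)"
    by (intro tendsto_dist 1 2)
  then have "\<forall>\<^sub>F k in sequentially. dist (f (R k) (x (q k))) (g (x (q k))) < \<eta>"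
    by (rule order_tendstoD(2)) (use \<eta> in simp)
  then obtain k where "dist (f (R k) (x (q k))) (g (x (q k))) < \<eta>"
    using eventually_happens'[OF sequentially_bot] by blast
  with x(2)[of "q k"] show False by (simp add: R_def)
qed

definition diff_quot :: "real \<Rightarrow> (complex \<Rightarrow> complex) \<Rightarrow> complex \<Rightarrow> complex" where
  "diff_quot e h w = (h (w + of_real e) - h w) / of_real e"

text \<open>Cauchy's inequality on circles of radius \<delta> / 2 turns the sup bound into a
  derivative bound on the inner ball; the mean value inequality makes the result independent of the
  step e.\<close>

lemma holomorphic_diff_quot_bound:
  assumes \<delta>: "\<delta> > 0" and h: "h holomorphic_on ball z (2 * \<delta>)"
    and B: "\<And>w. w \<in> cball z \<delta> \<Longrightarrow> norm (h w) \<le> B"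
    and s: "s \<in> ball z (\<delta> / 2)" "s + of_real e \<in> ball z (\<delta> / 2)" and e: "e > 0"
  shows "norm (diff_quot e h s) \<le> 2 * B / \<delta>"
proof -
  have der: "norm (deriv h w) \<le> 2 * B / \<delta>" if w: "w \<in> ball z (\<delta> / 2)" for w
  proof -
    have sub: "cball w (\<delta> / 2) \<subseteq> cball z \<delta>"
    proof
      fix v assume "v \<in> cball w (\<delta> / 2)"
      then show "v \<in> cball z \<delta>" using w dist_triangle[of z v w] by simp
    qed
    have sub2: "cball w (\<delta> / 2) \<subseteq> ball z (2 * \<delta>)" using sub \<delta> by (auto simp: subset_iff)
    have "norm ((deriv ^^ 1) h w) \<le> fact 1 * B / (\<delta> / 2) ^ 1"
    proof (rule Cauchy_inequality)
      show "h holomorphic_on ball w (\<delta> / 2)"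
        by (rule holomorphic_on_subset[OF h]) (use sub2 in auto)
      show "continuous_on (cball w (\<delta> / 2)) h"
        by (rule holomorphic_on_imp_continuous_on, rule holomorphic_on_subset[OF h sub2])
      show "norm (h x) \<le> B" if "norm (w - x) = \<delta> / 2" for x
        by (rule B) (use sub that in \<open>auto simp: dist_norm subset_iff\<close>)
    qed (use \<delta> in simp)
    then show ?thesis by (simp add: field_simps)
  qed
  have "norm (h (s + of_real e) - h s) \<le> 2 * B / \<delta> * norm (s + of_real e - s)"
  proof (rule field_differentiable_bound[of "ball z (\<delta> / 2)" h "deriv h"])
    fix w assume w: "w \<in> ball z (\<delta> / 2)"
    then have "w \<in> ball z (2 * \<delta>)" using \<delta> by auto
    then show "(h has_field_derivative deriv h w) (at w within ball z (\<delta> / 2))"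
      by (intro has_field_derivative_at_within[OF holomorphic_derivI[OF h open_ball]])
  qed (use s der in auto)
  then show ?thesis using e by (simp add: diff_quot_def norm_divide divide_le_eq)
qed

lemma diff_quot_diff: "diff_quot e (\<lambda>w. f w - g w) s = diff_quot e f s - diff_quot e g s"
  by (simp add: diff_quot_def diff_divide_distrib)

lemma diff_quot_tendsto_deriv:
  fixes s :: "nat \<Rightarrow> complex"
  assumes op: "open \<Omega>" and g: "g holomorphic_on \<Omega>" and z: "z \<in> \<Omega>"
    and s: "s \<longlonglongrightarrow> z" and e: "\<And>n. e n > 0" "e \<longlonglongrightarrow> 0"
  shows "(\<lambda>n. diff_quot (e n) g (s n)) \<longlonglongrightarrow> deriv g z"
proof (rule metric_LIMSEQ_I)
  fix \<eta> :: real assume \<eta>: "\<eta> > 0"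
  have "continuous_on \<Omega> (deriv g)"
    by (intro holomorphic_on_imp_continuous_on holomorphic_deriv g op)
  then have "isCont (deriv g) z" using op z by (simp add: continuous_on_eq_continuous_at)
  then obtain d1 where d1: "d1 > 0" "\<And>w. dist w z < d1 \<Longrightarrow> dist (deriv g w) (deriv g z) < \<eta> / 2"
    using \<eta> unfolding continuous_at_eps_delta by (metis half_gt_zero)
  obtain d2 where d2: "d2 > 0" "ball z d2 \<subseteq> \<Omega>" using op z by (auto simp: open_contains_ball)
  define d where "d = min d1 d2"
  have d: "d > 0" using d1 d2 by (simp add: d_def)
  have "(\<lambda>n. s n + of_real (e n)) \<longlonglongrightarrow> z + of_real 0" by (intro tendsto_intros s e)
  then have se: "(\<lambda>n. s n + of_real (e n)) \<longlonglongrightarrow> z" by simp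
  obtain N where N: "\<And>n. n \<ge> N \<Longrightarrow> dist (s n) z < d \<and> dist (s n + of_real (e n)) z < d"
    using tendstoD[OF s d] tendstoD[OF se d] unfolding eventually_sequentially
    by (metis (no_types, lifting) linorder_linear order_trans)
  have "dist (diff_quot (e n) g (s n)) (deriv g z) < \<eta>" if n: "n \<ge> N" for n
  proof -
    \<comment> \<open>Subtracting the linear part leaves a function whose derivative is at most
      \<eta> / 2 near \<open>z\<close>, whatever the base point and the step.\<close>
    let ?h = "\<lambda>w. g w - deriv g z * w"
    have "norm (?h (s n + of_real (e n)) - ?h (s n)) \<le> \<eta> / 2 * norm (s n + of_real (e n) - s n)"
    proof (rule field_differentiable_bound[of "ball z d" ?h "\<lambda>w. deriv g w - deriv g z"])
      fix w assume w: "w \<in> ball z d"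
      then have "w \<in> \<Omega>" using d2 by (auto simp: d_def)
      then have gd: "(g has_field_derivative deriv g w) (at w)" by (rule holomorphic_derivI[OF g op])
      show "(?h has_field_derivative deriv g w - deriv g z) (at w within ball z d)"
        by (rule has_field_derivative_at_within[OF DERIV_cong[OF DERIV_diff[OF gd DERIV_cmult[OF DERIV_ident]]]]) simp
      show "norm (deriv g w - deriv g z) \<le> \<eta> / 2"
        using d1(2)[of w] w by (auto simp: d_def dist_norm norm_minus_commute less_imp_le)
    qed (use N[OF n] in \<open>auto simp: dist_commute\<close>)
    moreover have "?h (s n + of_real (e n)) - ?h (s n) = of_real (e n) * (diff_quot (e n) g (s n) - deriv g z)"
      using e(1)[of n] by (simp add: diff_quot_def field_simps)
    ultimately have "e n * norm (diff_quot (e n) g (s n) - deriv g z) \<le> e n * (\<eta> / 2)"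
      using e(1)[of n] by (simp add: norm_mult mult.commute)
    then have "norm (diff_quot (e n) g (s n) - deriv g z) \<le> \<eta> / 2"
      using e(1)[of n] by (simp only: mult_le_cancel_left_pos)
    then show ?thesis using \<eta> by (simp add: dist_norm)
  qed
  then show "\<exists>no. \<forall>n\<ge>no. dist (diff_quot (e n) g (s n)) (deriv g z) < \<eta>" by blast
qed

text \<open>The conclusions have the shape of the hypotheses, so the step can be iterated.
  Holomorphy of \<open>f n\<close> is required only locally and eventually, because its half-plane
  will move with n.\<close>

lemma diff_quot_step:
  fixes f :: "nat \<Rightarrow> complex \<Rightarrow> complex"
  assumes op: "open \<Omega>" and g: "g holomorphic_on \<Omega>"
    and hol: "\<And>z. z \<in> \<Omega> \<Longrightarrow> \<exists>\<delta>>0. \<forall>\<^sub>F n in sequentially. f n holomorphic_on ball z \<delta>"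
    and conv: "\<And>s z. z \<in> \<Omega> \<Longrightarrow> s \<longlonglongrightarrow> z \<Longrightarrow> (\<lambda>n. f n (s n)) \<longlonglongrightarrow> g z"
    and e: "\<And>n. e n > 0" "e \<longlonglongrightarrow> 0"
  shows "deriv g holomorphic_on \<Omega>"
    and "\<And>z. z \<in> \<Omega> \<Longrightarrow> \<exists>\<delta>>0. \<forall>\<^sub>F n in sequentially. diff_quot (e n) (f n) holomorphic_on ball z \<delta>"
    and "\<And>s z. z \<in> \<Omega> \<Longrightarrow> s \<longlonglongrightarrow> z \<Longrightarrow> (\<lambda>n. diff_quot (e n) (f n) (s n)) \<longlonglongrightarrow> deriv g z"
proof -
  show "deriv g holomorphic_on \<Omega>" by (rule holomorphic_deriv[OF g op])
next
  fix z assume "z \<in> \<Omega>"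
  then obtain \<delta> where \<delta>: "\<delta> > 0" "\<forall>\<^sub>F n in sequentially. f n holomorphic_on ball z \<delta>" using hol by blast
  have "\<forall>\<^sub>F n in sequentially. e n < \<delta> / 2" by (rule order_tendstoD(2)[OF e(2)]) (use \<delta> in simp)
  with \<delta>(2) have "\<forall>\<^sub>F n in sequentially. diff_quot (e n) (f n) holomorphic_on ball z (\<delta> / 2)"
  proof eventually_elim
    case (elim n)
    have sub: "(\<lambda>w. w + of_real (e n)) ` ball z (\<delta> / 2) \<subseteq> ball z \<delta>"
    proof (rule image_subsetI)
      fix w assume "w \<in> ball z (\<delta> / 2)"
      moreover have "dist w (w + of_real (e n)) < \<delta> / 2" using elim e(1)[of n] by (simp add: dist_norm)
      ultimately show "w + of_real (e n) \<in> ball z \<delta>"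
        using dist_triangle[of z "w + of_real (e n)" w] by simp
    qed
    have "(f n \<circ> (\<lambda>w. w + of_real (e n))) holomorphic_on ball z (\<delta> / 2)"
      by (rule holomorphic_on_compose_gen[OF _ elim(1) sub]) (intro holomorphic_intros)
    moreover have "f n holomorphic_on ball z (\<delta> / 2)"
      by (rule holomorphic_on_subset[OF elim(1)]) (use \<delta> in auto)
    ultimately show ?case
      unfolding diff_quot_def[abs_def] o_def using e(1)[of n] by (intro holomorphic_intros) auto
  qed
  then show "\<exists>\<delta>>0. \<forall>\<^sub>F n in sequentially. diff_quot (e n) (f n) holomorphic_on ball z \<delta>"
    using \<delta> by (intro exI[of _ "\<delta> / 2"]) simp
next
  fix s z assume z: "z \<in> \<Omega>" and s: "s \<longlonglongrightarrow> z"
  obtain \<delta>1 where \<delta>1: "\<delta>1 > 0" "\<forall>\<^sub>F n in sequentially. f n holomorphic_on ball z \<delta>1" using hol[OF z] by blast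
  obtain \<delta>2 where \<delta>2: "\<delta>2 > 0" "ball z \<delta>2 \<subseteq> \<Omega>" using op z by (auto simp: open_contains_ball)
  define \<delta> where "\<delta> = min \<delta>1 \<delta>2 / 2"
  have \<delta>: "\<delta> > 0" "2 * \<delta> \<le> \<delta>1" "2 * \<delta> \<le> \<delta>2" using \<delta>1 \<delta>2 by (auto simp: \<delta>_def)
  have cb: "cball z \<delta> \<subseteq> \<Omega>" using \<delta> \<delta>2(2) by (auto simp: subset_iff)
  have b2: "ball z (2 * \<delta>) \<subseteq> \<Omega>" using \<delta> \<delta>2(2) by (auto simp: subset_iff)
  \<comment> \<open>Uniform smallness of f n - g on the disc is what the Cauchy bound needs; the
    quotient of \<open>g\<close> alone converges by \<open>diff_quot_tendsto_deriv\<close>.\<close>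
  have ul: "uniform_limit (cball z \<delta>) f g sequentially"
    by (rule continuous_convergence_imp_uniform_limit)
       (use cb conv g in \<open>auto intro: continuous_on_subset[OF holomorphic_on_imp_continuous_on]\<close>)
  have lim: "(\<lambda>n. diff_quot (e n) (\<lambda>w. f n w - g w) (s n)) \<longlonglongrightarrow> 0"
  proof (rule tendstoI)
    fix \<eta> :: real assume \<eta>: "\<eta> > 0"
    define B where "B = \<eta> * \<delta> / 4"
    have B: "B > 0" using \<eta> \<delta> by (simp add: B_def)
    have "\<forall>\<^sub>F n in sequentially. \<forall>w\<in>cball z \<delta>. dist (f n w) (g w) < B"
      using ul B unfolding uniform_limit_iff by blast
    moreover have "\<forall>\<^sub>F n in sequentially. dist (s n) z < \<delta> / 2" by (rule tendstoD[OF s]) (use \<delta> in simp)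
    moreover have "\<forall>\<^sub>F n in sequentially. dist (s n + of_real (e n)) z < \<delta> / 2"
    proof (rule tendstoD)
      have "(\<lambda>n. s n + of_real (e n)) \<longlonglongrightarrow> z + of_real 0" by (intro tendsto_intros s e)
      then show "(\<lambda>n. s n + of_real (e n)) \<longlonglongrightarrow> z" by simp
    qed (use \<delta> in simp)
    ultimately show "\<forall>\<^sub>F n in sequentially. dist (diff_quot (e n) (\<lambda>w. f n w - g w) (s n)) 0 < \<eta>"
      using \<delta>1(2)
    proof eventually_elim
      case (elim n)
      have "norm (diff_quot (e n) (\<lambda>w. f n w - g w) (s n)) \<le> 2 * B / \<delta>"
      proof (rule holomorphic_diff_quot_bound[OF \<delta>(1)])
        show "(\<lambda>w. f n w - g w) holomorphic_on ball z (2 * \<delta>)"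
          using \<delta> b2 by (intro holomorphic_on_diff holomorphic_on_subset[OF elim(4)] holomorphic_on_subset[OF g]) auto
        show "norm (f n w - g w) \<le> B" if "w \<in> cball z \<delta>" for w
          using elim(1) that by (auto simp: dist_norm less_imp_le)
      qed (use elim e(1) in \<open>auto simp: dist_commute\<close>)
      also have "2 * B / \<delta> < \<eta>" using \<delta> \<eta> by (simp add: B_def)
      finally show ?case by simp
    qed
  qed
  have "(\<lambda>n. diff_quot (e n) (\<lambda>w. f n w - g w) (s n) + diff_quot (e n) g (s n)) \<longlonglongrightarrow> 0 + deriv g z"
    by (intro tendsto_add lim diff_quot_tendsto_deriv[OF op g z s e])
  then show "(\<lambda>n. diff_quot (e n) (f n) (s n)) \<longlonglongrightarrow> deriv g z" by (simp add: diff_quot_diff)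
qed

lemma iterated_diff_quot_tendsto:
  fixes f :: "nat \<Rightarrow> complex \<Rightarrow> complex"
  assumes op: "open \<Omega>" and g: "g holomorphic_on \<Omega>"
    and hol: "\<And>z. z \<in> \<Omega> \<Longrightarrow> \<exists>\<delta>>0. \<forall>\<^sub>F n in sequentially. f n holomorphic_on ball z \<delta>"
    and conv: "\<And>s z. z \<in> \<Omega> \<Longrightarrow> s \<longlonglongrightarrow> z \<Longrightarrow> (\<lambda>n. f n (s n)) \<longlonglongrightarrow> g z"
    and e: "\<And>n. e n > 0" "e \<longlonglongrightarrow> 0" and z: "z \<in> \<Omega>" and s: "s \<longlonglongrightarrow> z"
  shows "(\<lambda>n. (diff_quot (e n) ^^ k) (f n) (s n)) \<longlonglongrightarrow> (deriv ^^ k) g z"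
  using g hol conv
proof (induction k arbitrary: f g)
  case 0
  then show ?case using z s by simp
next
  case (Suc k)
  note st = diff_quot_step[OF op Suc.prems(1,2,3) e]
  have "(\<lambda>n. (diff_quot (e n) ^^ k) (diff_quot (e n) (f n)) (s n)) \<longlonglongrightarrow> (deriv ^^ k) (deriv g) z"
    by (rule Suc.IH[OF st])
  then show ?case by (simp only: funpow_Suc_right o_apply)
qed

text \<open>A k-fold difference reads h only at the nodes w, w + e, ..., w + k e.\<close>

lemma iterated_diff_quot_eq_0:
  assumes "\<And>j. j \<le> k \<Longrightarrow> h (w + of_real (real j * e)) = 0"
  shows "(diff_quot e ^^ k) h w = 0"
  using assms
proof (induction k arbitrary: w)
  case (Suc k)
  have "(diff_quot e ^^ k) h (w + of_real e) = 0"
  proof (rule Suc.IH)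
    fix j assume "j \<le> k"
    then show "h (w + of_real e + of_real (real j * e)) = 0"
      using Suc.prems[of "Suc j"] by (simp add: algebra_simps)
  qed
  moreover have "(diff_quot e ^^ k) h w = 0" by (rule Suc.IH) (use Suc.prems in auto)
  ultimately show ?case by (simp add: diff_quot_def[of e "(diff_quot e ^^ k) h"])
qed simp

text \<open>One difference multiplies the integrand by (exp (e y) - 1) / e, which is the variable t
  of the theorem in the chart. Moments in t are therefore exact differences, without
  remainder.\<close>

lemma iterated_diff_quot_laplace:
  assumes "e > 0"
    and "\<And>j. j \<le> k \<Longrightarrow> bilateral_laplace_exists G (w + of_real (real j * e))"
  shows "bilateral_laplace_exists (\<lambda>y. ((exp (e * y) - 1) / e) ^ k * G y) w \<and>
    (diff_quot e ^^ k) (bilateral_laplace G) w = bilateral_laplace (\<lambda>y. ((exp (e * y) - 1) / e) ^ k * G y) w"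
  using assms(2)
proof (induction k arbitrary: w)
  case (Suc k)
  let ?F = "\<lambda>k y. ((exp (e * y) - 1) / e) ^ k * G y"
  have p: "\<And>j. j \<le> k \<Longrightarrow> bilateral_laplace_exists G (w + of_real e + of_real (real j * e))"
  proof -
    fix j assume "j \<le> k"
    then show "bilateral_laplace_exists G (w + of_real e + of_real (real j * e))"
      using Suc.prems[of "Suc j"] by (simp add: algebra_simps)
  qed
  have p0: "\<And>j. j \<le> k \<Longrightarrow> bilateral_laplace_exists G (w + of_real (real j * e))" using Suc.prems by auto
  have eq: "exp (w * of_real y) * complex_of_real (?F (Suc k) y) =
      (exp ((w + of_real e) * of_real y) * complex_of_real (?F k y) - exp (w * of_real y) * complex_of_real (?F k y)) / of_real e" for y
    using \<open>e > 0\<close> by (simp add: ring_distribs exp_add field_simps flip: exp_of_real)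
  have i: "integrable lborel (\<lambda>y. exp ((w + of_real e) * of_real y) * complex_of_real (?F k y))"
    "integrable lborel (\<lambda>y. exp (w * of_real y) * complex_of_real (?F k y))"
    using Suc.IH[OF p] Suc.IH[OF p0] by (auto simp: bilateral_laplace_exists_def)
  have A: "bilateral_laplace_exists (?F (Suc k)) w"
    unfolding bilateral_laplace_exists_def eq using i by auto
  have B: "(diff_quot e ^^ Suc k) (bilateral_laplace G) w = bilateral_laplace (?F (Suc k)) w"
  proof -
    have "bilateral_laplace (?F (Suc k)) w = (bilateral_laplace (?F k) (w + of_real e) - bilateral_laplace (?F k) w) / of_real e"
      unfolding bilateral_laplace_def eq using i by simp
    then show ?thesis using Suc.IH[OF p] Suc.IH[OF p0] by (simp add: diff_quot_def[of e "(diff_quot e ^^ k) (bilateral_laplace G)"])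
  qed
  from A B show ?case ..
qed auto

lemma decaying_laplace_higher_deriv:
  assumes S: "open S" and f: "decaying S f" and z: "Re z \<in> S"
  shows "(deriv ^^ k) (bilateral_laplace f) z = bilateral_laplace (\<lambda>t. t ^ k * f t) z"
  using z
proof (induction k arbitrary: z)
  case (Suc k)
  have [measurable]: "f \<in> borel_measurable borel" using decaying_measurable[OF f, of 0] by simp
  have int: "integrable lborel (\<lambda>t. exp (\<sigma> * t) * (t ^ k * f t))" if "\<sigma> \<in> S" for \<sigma>
    using decaying_moment_integrable[OF S f that, of k] by (simp add: mult_ac)
  have op: "open {z. Re z \<in> S}"
    using open_vimage[OF S continuous_on_Re[OF continuous_on_id]] by (simp add: vimage_def)
  have "(bilateral_laplace (\<lambda>t. t ^ k * f t) has_field_derivative bilateral_laplace (\<lambda>t. t * (t ^ k * f t)) z) (at z)"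
    by (rule bilateral_laplace_has_field_derivative[OF _ S int Suc.prems]) measurable
  then have "((deriv ^^ k) (bilateral_laplace f) has_field_derivative bilateral_laplace (\<lambda>t. t * (t ^ k * f t)) z) (at z)"
    by (rule has_field_derivative_transform_within_open[OF _ op]) (use Suc in auto)
  then show ?case by (simp add: DERIV_imp_deriv mult_ac)
qed simp

section \<open>Limits along a sequence of parameters\<close>

text \<open>The map t = (exp (e y) - 1) / e solves 1 + e t = exp (e y), and dt = exp (e y) dy
  supplies the factor built into \<open>log_pullback\<close>.\<close>

lemma affine_log_substitution:
  assumes B: "(\<lambda>x. indicator {0<..} x * B x) \<in> borel_measurable borel"
    and \<phi>[measurable]: "\<phi> \<in> borel_measurable borel" and \<tau>: "\<tau> > 0" and e: "e > 0"
  shows "set_integrable lborel {- inverse e<..} (\<lambda>t. \<phi> t * B (\<tau> * (1 + e * t))) \<longleftrightarrow>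
      integrable lborel (\<lambda>y. \<phi> ((exp (e * y) - 1) / e) * log_pullback \<tau> e B y)"
    and "set_integrable lborel {- inverse e<..} (\<lambda>t. \<phi> t * B (\<tau> * (1 + e * t))) \<Longrightarrow>
      (LINT t:{- inverse e<..}|lborel. \<phi> t * B (\<tau> * (1 + e * t))) =
      (LINT y|lborel. \<phi> ((exp (e * y) - 1) / e) * log_pullback \<tau> e B y)"
proof -
  note [measurable] = B
  let ?f = "\<lambda>t. \<phi> t * B (\<tau> * (1 + e * t))"
  let ?g = "\<lambda>y. (exp (e * y) - 1) / e"
  have pos: "\<tau> * (1 + e * t) > 0 \<longleftrightarrow> t > - inverse e" for t
  proof -
    have "\<tau> * (1 + e * t) > 0 \<longleftrightarrow> 1 + e * t > 0" using \<tau> by (simp only: zero_less_mult_iff) auto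
    also have "\<dots> \<longleftrightarrow> t > - inverse e" using e by (auto simp: field_simps)
    finally show ?thesis .
  qed
  have "(\<lambda>t. \<phi> t * (indicator {0<..} (\<tau> * (1 + e * t)) * B (\<tau> * (1 + e * t)))) \<in> borel_measurable borel"
    by measurable
  also have "(\<lambda>t. \<phi> t * (indicator {0<..} (\<tau> * (1 + e * t)) * B (\<tau> * (1 + e * t)))) =
      (\<lambda>t. indicator {- inverse e<..} t *\<^sub>R ?f t)"
    using pos by (auto simp: fun_eq_iff indicator_def)
  finally have m: "set_borel_measurable lborel {- inverse e<..} ?f"
    by (simp add: set_borel_measurable_def)
  have im: "{- inverse e<..} = ?g ` UNIV"
  proof (intro equalityI subsetI)
    fix t assume "t \<in> {- inverse e<..}"
    then have "1 + e * t > 0" using e by (simp add: field_simps)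
    then show "t \<in> ?g ` UNIV" using e by (intro image_eqI[of _ _ "ln (1 + e * t) / e"]) auto
  next
    fix t assume "t \<in> ?g ` UNIV"
    then show "t \<in> {- inverse e<..}" using e by (auto simp: field_simps)
  qed
  have eq: "\<bar>exp (e * y)\<bar> *\<^sub>R ?f (?g y) = \<phi> (?g y) * log_pullback \<tau> e B y" for y
    using e by (simp add: log_pullback_def mult_ac)
  have der: "(?g has_real_derivative exp (e * y)) (at y)" for y
    using e by (auto intro!: derivative_eq_intros)
  have inj: "inj ?g" using e by (auto intro!: inj_onI)
  note sub = lborel_substitution[of UNIV "{- inverse e<..}" ?g "\<lambda>y. exp (e * y)" ?f, OF _ im der inj m, unfolded eq]
  show "set_integrable lborel {- inverse e<..} ?f \<longleftrightarrow> integrable lborel (\<lambda>y. \<phi> (?g y) * log_pullback \<tau> e B y)"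
    using sub(1) by (simp add: set_integrable_def)
  show "(LINT t:{- inverse e<..}|lborel. ?f t) = (LINT y|lborel. \<phi> (?g y) * log_pullback \<tau> e B y)"
    if "set_integrable lborel {- inverse e<..} ?f"
    using sub(2)[OF _ _ _ that] by (simp add: set_lebesgue_integral_def)
qed

text \<open>The hypotheses of the theorem along one sequence \<open>T\<close>. What holds eventually
  is required here for all j, which is arranged by dropping an initial segment. The centring limit
  is 2 \<open>ahat\<close> because eps \<tau> * sqrt (2 \<tau>) = 2.\<close>

locale laguerre_limit =
  fixes r p \<eta> :: nat and n m :: "nat \<Rightarrow> nat" and a b \<beta> :: "nat \<Rightarrow> real \<Rightarrow> real" and ahat :: real
    and \<rho> d \<xi> :: "nat \<Rightarrow> real" and BL :: "real \<Rightarrow> real \<Rightarrow> real" and T :: "nat \<Rightarrow> real"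
  assumes T: "filterlim T at_top sequentially" and T_pos: "\<And>j. T j > 0"
    and a_gt: "\<And>j \<nu>. \<nu> \<in> {1..r+1} \<Longrightarrow> a \<nu> (T j) > -1"
    and b_gt: "\<And>j h. h \<in> {1..r} \<Longrightarrow> b h (T j) > a h (T j)"
    and a_last: "(\<lambda>j. eps (T j) * (a (r + 1) (T j) + 1 - T j)) \<longlonglongrightarrow> 2 * ahat"
    and \<rho>_pos: "\<And>h. h \<in> {1..r} \<Longrightarrow> \<rho> h > 0"
    and a_lim: "\<And>h. h \<in> {1..r} \<Longrightarrow> (\<lambda>j. eps (T j) * (a h (T j) + 1)) \<longlonglongrightarrow> \<rho> h"
    and d_nonneg: "\<And>h. h \<in> {1..r} \<Longrightarrow> d h \<ge> 0"
    and d_lim: "\<And>h. h \<in> {1..r} \<Longrightarrow> (\<lambda>j. b h (T j) - a h (T j)) \<longlonglongrightarrow> d h"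
    and \<xi>_lim: "\<And>i. i \<in> {1..p} \<Longrightarrow> (\<lambda>j. eps (T j) * \<beta> i (T j)) \<longlonglongrightarrow> \<xi> i"
    and \<xi>_\<rho>: "\<And>i h. i \<in> {1..p} \<Longrightarrow> h \<in> {1..r} \<Longrightarrow> \<xi> i + \<rho> h > 0"
    and degree: "(\<Sum>i=1..p. m i) + 1 = (\<Sum>h=1..r. n h) + \<eta>"
    and rep: "\<And>j. laguerre_rep r p (\<lambda>\<nu>. a \<nu> (T j)) (\<lambda>h. b h (T j)) (\<lambda>i. \<beta> i (T j)) n m (BL (T j))"
begin

definition e :: "nat \<Rightarrow> real" where "e j = eps (T j)"

definition G :: "nat \<Rightarrow> real \<Rightarrow> real" where
  "G j y = T j * e j ^ \<eta> / Z_norm r a b (T j) * log_pullback (T j) (e j) (BL (T j)) y"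

text \<open>Real parts of s for which 1 + s / e lies to the right of all poles of the Gamma
  factors.\<close>

definition dom :: "nat \<Rightarrow> real set" where
  "dom j = {\<sigma>. \<forall>\<nu>\<in>{1..r+1}. - (e j * (a \<nu> (T j) + 1)) < \<sigma>}"

definition Gauss_factor :: "nat \<Rightarrow> complex \<Rightarrow> complex" where
  "Gauss_factor j s = of_real (T j) powr (- s / of_real (e j)) *
     Gamma (of_real (a (r + 1) (T j) + 1) + s / of_real (e j)) / of_real (Gamma (a (r + 1) (T j) + 1))"

text \<open>Normalised to have a finite limit: the quotient at s is of order e^(b - a + n), the one
  at 0 of order e^(b - a), so exactly e^n is divided out.\<close>

definition ratio_factor :: "nat \<Rightarrow> nat \<Rightarrow> complex \<Rightarrow> complex" where
  "ratio_factor h j s = of_real (1 / e j ^ n h) *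
     (Gamma (of_real (a h (T j) + 1) + s / of_real (e j)) *
      rGamma (of_real (a h (T j) + 1) + s / of_real (e j) + of_real (b h (T j) - a h (T j) + n h))) /
     of_real (Gamma (a h (T j) + 1) * rGamma (b h (T j) + 1))"

text \<open>This is e^(m i) times the Pochhammer symbol at z = 1 + s / e; its zeros are the nodes e
  \<beta> + k e with k < m i.\<close>

definition poch_factor :: "nat \<Rightarrow> nat \<Rightarrow> complex \<Rightarrow> complex" where
  "poch_factor i j s = (\<Prod>k<m i. of_real (e j * \<beta> i (T j)) - s + of_real (real k * e j))"

definition H :: "complex \<Rightarrow> complex" where
  "H s = exp (of_real ahat * s + s\<^sup>2 / 4) * (\<Prod>h=1..r. (of_real (\<rho> h) / (of_real (\<rho> h) + s)) powr of_real (d h)) *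
     ((\<Prod>i=1..p. (of_real (\<xi> i) - s) ^ m i) / (\<Prod>h=1..r. (of_real (\<rho> h) + s) ^ n h))"

definition \<Omega> :: "complex set" where "\<Omega> = {s. Re s \<in> strip r \<rho>}"

lemma e_pos: "e j > 0"
  using eps_pos[OF T_pos] by (simp add: e_def)

lemma e_lim: "e \<longlonglongrightarrow> 0"
  unfolding e_def[abs_def] by (rule filterlim_compose[OF eps_tendsto_0 T])

lemma Gamma_a_pos: "h \<in> {1..r+1} \<Longrightarrow> Gamma (a h (T j) + 1) > 0"
  using a_gt[of h j] by (intro Gamma_real_pos) simp

lemma Gamma_b_pos: "h \<in> {1..r} \<Longrightarrow> Gamma (b h (T j) + 1) > 0"
  using a_gt[of h j] b_gt[of h j] by (intro Gamma_real_pos) simp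

lemma Z_pos: "Z_norm r a b (T j) > 0"
  unfolding Z_norm_def using Gamma_a_pos Gamma_b_pos by (intro divide_pos_pos prod_pos) auto

lemma open_dom: "open (dom j)"
proof -
  have "dom j = (\<Inter>\<nu>\<in>{1..r+1}. {- (e j * (a \<nu> (T j) + 1))<..})" by (auto simp: dom_def)
  then show ?thesis by (auto intro!: open_INT)
qed

lemma dom_add: "\<sigma> \<in> dom j \<Longrightarrow> x \<ge> 0 \<Longrightarrow> \<sigma> + x \<in> dom j"
  by (force simp: dom_def)

lemma zero_dom: "0 \<in> dom j"
proof -
  have "e j * (a \<nu> (T j) + 1) > 0" if "\<nu> \<in> {1..r+1}" for \<nu>
    using a_gt[OF that, of j] e_pos[of j] by (intro mult_pos_pos) auto
  then show ?thesis by (simp add: dom_def)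
qed

lemma open_\<Omega>: "open \<Omega>"
  unfolding \<Omega>_def using open_vimage[OF open_strip continuous_on_Re[OF continuous_on_id]] by (simp add: vimage_def)

text \<open>The leading order is eps \<tau> * \<tau> = sqrt (2 \<tau>): the poles of the last Gamma
  factor leave every fixed half-plane, so only \<rho> restricts the limiting strip.\<close>

lemma e_a_last: "filterlim (\<lambda>j. e j * (a (r + 1) (T j) + 1)) at_top sequentially"
proof -
  have "filterlim (\<lambda>t. eps t * t) at_top at_top" unfolding eps_def[abs_def] by real_asymp
  then have "filterlim (\<lambda>j. eps (T j) * T j) at_top sequentially" by (rule filterlim_compose[OF _ T])
  from filterlim_tendsto_add_at_top[OF a_last this] show ?thesis by (simp add: e_def algebra_simps)
qed

lemma eventually_dom:
  assumes \<sigma>: "\<sigma> \<in> strip r \<rho>"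
  obtains \<delta> where "\<delta> > 0" "\<forall>\<^sub>F j in sequentially. \<forall>x. \<bar>x - \<sigma>\<bar> < \<delta> \<longrightarrow> x \<in> dom j"
proof -
  obtain \<delta> where \<delta>: "\<delta> > 0" "\<And>x. \<bar>x - \<sigma>\<bar> < \<delta> \<Longrightarrow> x \<in> strip r \<rho>"
    using open_strip[of r \<rho>] \<sigma> unfolding open_real by metis
  \<comment> \<open>As \<open>dom j\<close> is upward closed, one point to the left of the interval
    decides about the whole interval.\<close>
  define \<kappa> where "\<kappa> = \<sigma> - \<delta> / 2"
  have \<kappa>: "\<kappa> \<in> strip r \<rho>" using \<delta> by (auto simp: \<kappa>_def)
  have "\<forall>\<^sub>F j in sequentially. e j * (a \<nu> (T j) + 1) > - \<kappa>" if \<nu>: "\<nu> \<in> {1..r+1}" for \<nu>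
  proof (cases "\<nu> = r + 1")
    case True
    then show ?thesis using e_a_last by (simp add: filterlim_at_top_dense)
  next
    case False
    then have h: "\<nu> \<in> {1..r}" using \<nu> by auto
    show ?thesis unfolding e_def
      by (rule order_tendstoD(1)[OF a_lim[OF h]]) (use \<kappa> h in \<open>auto simp: strip_def minus_less_iff[of \<kappa>]\<close>)
  qed
  then have "\<forall>\<^sub>F j in sequentially. \<forall>\<nu>\<in>{1..r+1}. e j * (a \<nu> (T j) + 1) > - \<kappa>"
    by (intro eventually_ball_finite) auto
  then have "\<forall>\<^sub>F j in sequentially. \<forall>x. \<bar>x - \<sigma>\<bar> < \<delta> / 2 \<longrightarrow> x \<in> dom j"
  proof eventually_elim
    case (elim j)
    show ?case
    proof (intro allI impI)
      fix x assume "\<bar>x - \<sigma>\<bar> < \<delta> / 2"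
      then have "\<kappa> < x" unfolding \<kappa>_def by linarith
      then show "x \<in> dom j" using elim unfolding dom_def by fastforce
    qed
  qed
  with \<delta> that[of "\<delta> / 2"] show ?thesis by simp
qed

text \<open>Exact at each finite parameter: the Mellin transform at 1 + s / e is regrouped into
  factors that have limits of their own.\<close>

lemma laplace_G:
  assumes s: "Re s \<in> dom j"
  shows "bilateral_laplace_exists (G j) s"
    and "bilateral_laplace (G j) s =
      Gauss_factor j s * (\<Prod>h=1..r. ratio_factor h j s) * (\<Prod>i=1..p. poch_factor i j s)"
proof -
  let ?e = "complex_of_real (e j)"
  let ?z = "1 + s / ?e"
  let ?M = "(\<Prod>\<nu>=1..r+1. Gamma (?z + of_real (a \<nu> (T j)))) / (\<Prod>h=1..r. Gamma (?z + of_real (b h (T j)) + of_nat (n h))) *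
      (\<Prod>i=1..p. pochhammer (of_real (\<beta> i (T j)) + 1 - ?z) (m i))"
  define c where "c = T j * e j ^ \<eta> / Z_norm r a b (T j)"
  have en: "e j > 0" "?e \<noteq> 0" using e_pos[of j] by auto
  have "Re ?z > - a \<nu> (T j)" if "\<nu> \<in> {1..r+1}" for \<nu>
  proof -
    have "e j * (a \<nu> (T j) + 1) + Re s > 0" using s that unfolding dom_def by fastforce
    then have "(e j * (a \<nu> (T j) + 1) + Re s) / e j > 0" using en by simp
    then show ?thesis using en by (simp add: add_divide_distrib)
  qed
  then have M: "has_mellin (BL (T j)) ?z ?M" using rep[of j] unfolding laguerre_rep_def by blast
  note L = laplace_log_pullback[OF M T_pos en(1)]
  have Gc: "G j = (\<lambda>y. c * log_pullback (T j) (e j) (BL (T j)) y)" by (simp add: G_def c_def fun_eq_iff)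
  show "bilateral_laplace_exists (G j) s"
  proof -
    have "(\<lambda>y. exp (s * of_real y) * complex_of_real (G j y)) =
        (\<lambda>y. of_real c * (exp (s * of_real y) * complex_of_real (log_pullback (T j) (e j) (BL (T j)) y)))"
      by (simp add: Gc fun_eq_iff)
    then show ?thesis using L(1) unfolding bilateral_laplace_exists_def by simp
  qed
  have "bilateral_laplace (G j) s = of_real c * (of_real (T j) powr (- s / ?e) * ?M / of_real (T j * e j))"
    unfolding Gc bilateral_laplace_cmult L(2) ..
  also have "?M = (\<Prod>h=1..r. Gamma (?z + of_real (a h (T j)))) * Gamma (?z + of_real (a (r + 1) (T j))) *
      (\<Prod>h=1..r. rGamma (?z + of_real (b h (T j)) + of_nat (n h))) * (\<Prod>i=1..p. pochhammer (of_real (\<beta> i (T j)) + 1 - ?z) (m i))"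
    by (simp add: rGamma_inverse_Gamma divide_inverse prod_inversef[symmetric])
  also have "(\<Prod>i=1..p. pochhammer (of_real (\<beta> i (T j)) + 1 - ?z) (m i)) = (\<Prod>i=1..p. poch_factor i j s) / ?e ^ (\<Sum>i=1..p. m i)"
  proof -
    have "?e ^ m i * pochhammer (of_real (\<beta> i (T j)) + 1 - ?z) (m i) = poch_factor i j s" for i
    proof -
      have "?e ^ m i * pochhammer (of_real (\<beta> i (T j)) + 1 - ?z) (m i) =
          (\<Prod>k<m i. ?e * (of_real (\<beta> i (T j)) + 1 - ?z + of_nat k))"
        by (simp add: pochhammer_prod prod.distrib atLeast0LessThan)
      also have "\<dots> = poch_factor i j s"
        unfolding poch_factor_def using en by (intro prod.cong refl) (simp add: algebra_simps)
      finally show ?thesis .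
    qed
    then have "(\<Prod>i=1..p. poch_factor i j s) = (\<Prod>i=1..p. ?e ^ m i) * (\<Prod>i=1..p. pochhammer (of_real (\<beta> i (T j)) + 1 - ?z) (m i))"
      by (simp flip: prod.distrib)
    then show ?thesis using en by (simp add: power_sum)
  qed
  also have "(\<Prod>h=1..r. Gamma (?z + of_real (a h (T j)))) * Gamma (?z + of_real (a (r + 1) (T j))) *
      (\<Prod>h=1..r. rGamma (?z + of_real (b h (T j)) + of_nat (n h))) * X =
      (\<Prod>h=1..r. Gamma (?z + of_real (a h (T j))) * rGamma (?z + of_real (b h (T j)) + of_nat (n h))) *
      Gamma (?z + of_real (a (r + 1) (T j))) * X" for X
    by (simp add: prod.distrib)
  also have "(\<Prod>h=1..r. Gamma (?z + of_real (a h (T j))) * rGamma (?z + of_real (b h (T j)) + of_nat (n h))) =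
      (\<Prod>h=1..r. ratio_factor h j s) * ?e ^ (\<Sum>h=1..r. n h) *
      of_real ((\<Prod>h=1..r. Gamma (a h (T j) + 1)) / (\<Prod>h=1..r. Gamma (b h (T j) + 1)))"
  proof -
    have "Gamma (?z + of_real (a h (T j))) * rGamma (?z + of_real (b h (T j)) + of_nat (n h)) =
        ratio_factor h j s * ?e ^ n h * of_real (Gamma (a h (T j) + 1) / Gamma (b h (T j) + 1))"
      if h: "h \<in> {1..r}" for h
    proof -
      have "of_real (a h (T j) + 1) + s / ?e = ?z + of_real (a h (T j))"
        "of_real (a h (T j) + 1) + s / ?e + of_real (b h (T j) - a h (T j) + n h) = ?z + of_real (b h (T j)) + of_nat (n h)"
        by (simp_all add: algebra_simps)
      then show ?thesis unfolding ratio_factor_def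
        using Gamma_a_pos[of h j] Gamma_b_pos[OF h, of j] h en by (simp add: rGamma_inverse_Gamma field_simps)
    qed
    then have "(\<Prod>h=1..r. Gamma (?z + of_real (a h (T j))) * rGamma (?z + of_real (b h (T j)) + of_nat (n h))) =
        (\<Prod>h=1..r. ratio_factor h j s * ?e ^ n h * of_real (Gamma (a h (T j) + 1) / Gamma (b h (T j) + 1)))"
      by (intro prod.cong) auto
    then show ?thesis by (simp add: prod.distrib prod_dividef power_sum)
  qed
  also have "Gamma (?z + of_real (a (r + 1) (T j))) =
      Gauss_factor j s * of_real (Gamma (a (r + 1) (T j) + 1)) / of_real (T j) powr (- s / ?e)"
  proof -
    have "of_real (a (r + 1) (T j) + 1) + s / ?e = ?z + of_real (a (r + 1) (T j))" by simp
    then show ?thesis unfolding Gauss_factor_def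
      using Gamma_a_pos[of "r + 1" j] T_pos[of j] by (simp add: field_simps)
  qed
  finally have eq: "bilateral_laplace (G j) s = of_real c * (of_real (T j) powr (- s / ?e) *
      ((\<Prod>h=1..r. ratio_factor h j s) * ?e ^ (\<Sum>h=1..r. n h) *
      of_real ((\<Prod>h=1..r. Gamma (a h (T j) + 1)) / (\<Prod>h=1..r. Gamma (b h (T j) + 1))) *
      (Gauss_factor j s * of_real (Gamma (a (r + 1) (T j) + 1)) / of_real (T j) powr (- s / ?e)) *
      ((\<Prod>i=1..p. poch_factor i j s) / ?e ^ (\<Sum>i=1..p. m i))) / of_real (T j * e j))" .
  have Zeq: "Z_norm r a b (T j) = (\<Prod>h=1..r. Gamma (a h (T j) + 1)) / (\<Prod>h=1..r. Gamma (b h (T j) + 1)) * Gamma (a (r + 1) (T j) + 1)"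
    by (simp add: Z_norm_def)
  have Z: "complex_of_real ((\<Prod>h=1..r. Gamma (a h (T j) + 1)) / (\<Prod>h=1..r. Gamma (b h (T j) + 1))) *
      of_real (Gamma (a (r + 1) (T j) + 1)) = of_real (Z_norm r a b (T j))"
    unfolding Zeq of_real_mult ..
  \<comment> \<open>The degree condition enters here: \<eta> from the normalisation and n h from the
    ratios balance m i from the Pochhammer symbols and one from the Jacobian, so no power of e
    survives.\<close>
  have pw: "?e ^ \<eta> * ?e ^ (\<Sum>h=1..r. n h) = ?e * ?e ^ (\<Sum>i=1..p. m i)"
    using degree by (simp flip: power_add power_Suc add: add.commute)
  have "bilateral_laplace (G j) s = Gauss_factor j s * (\<Prod>h=1..r. ratio_factor h j s) * (\<Prod>i=1..p. poch_factor i j s) *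
      ((?e ^ \<eta> * ?e ^ (\<Sum>h=1..r. n h)) / (?e * ?e ^ (\<Sum>i=1..p. m i))) *
      ((complex_of_real ((\<Prod>h=1..r. Gamma (a h (T j) + 1)) / (\<Prod>h=1..r. Gamma (b h (T j) + 1))) *
      of_real (Gamma (a (r + 1) (T j) + 1))) / of_real (Z_norm r a b (T j)))"
    unfolding eq c_def using en T_pos[of j] Z_pos[of j] by (simp add: divide_simps)
  then show "bilateral_laplace (G j) s =
      Gauss_factor j s * (\<Prod>h=1..r. ratio_factor h j s) * (\<Prod>i=1..p. poch_factor i j s)"
    unfolding pw Z using en Z_pos[of j] by simp
qed

end

section \<open>Limits and uniform bounds of the factors\<close>

context laguerre_limit
begin

lemma Gauss_factor_lim:
  assumes "s \<longlonglongrightarrow> z"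
  shows "(\<lambda>j. Gauss_factor j (s j)) \<longlonglongrightarrow> exp (of_real ahat * z + z\<^sup>2 / 4)"
  unfolding Gauss_factor_def e_def by (rule Gamma_central_limit[OF T a_last assms])

lemma ratio_factor_lim:
  assumes h: "h \<in> {1..r}" and s: "s \<longlonglongrightarrow> z" and z: "Re z > - \<rho> h"
  shows "(\<lambda>j. ratio_factor h j (s j)) \<longlonglongrightarrow> (of_real (\<rho> h) / (of_real (\<rho> h) + z)) powr of_real (d h) / (of_real (\<rho> h) + z) ^ n h"
proof -
  define D where "D j = b h (T j) - a h (T j)" for j
  define w where "w = of_real (\<rho> h) + z"
  have w: "Re w > 0" "w \<noteq> 0" using z by (auto simp: w_def complex_eq_iff)
  have D: "D j > 0" for j using b_gt[OF h, of j] by (simp add: D_def)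
  have D_lim: "D \<longlonglongrightarrow> d h" unfolding D_def[abs_def] by (rule d_lim[OF h])
  have al: "(\<lambda>j. e j * (a h (T j) + 1)) \<longlonglongrightarrow> \<rho> h" using a_lim[OF h] by (simp add: e_def)
  define \<omega> where "\<omega> j = of_real (e j * (a h (T j) + 1)) + s j" for j
  define \<omega>0 where "\<omega>0 j = complex_of_real (e j * (a h (T j) + 1))" for j
  have \<omega>: "\<omega> \<longlonglongrightarrow> w" unfolding \<omega>_def[abs_def] w_def by (intro tendsto_intros al s)
  have \<omega>0: "\<omega>0 \<longlonglongrightarrow> of_real (\<rho> h)" unfolding \<omega>0_def[abs_def] by (rule tendsto_of_real[OF al])
  have \<rho>: "\<rho> h > 0" by (rule \<rho>_pos[OF h])
  \<comment> \<open>Both Gamma quotients are compared with powers of e; the moving exponent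
    \<open>D j\<close> cancels in X / Y and leaves e^(- n h).\<close>
  define X where "X j = of_real (e j powr (- (D j + n h))) * (Gamma (\<omega> j / of_real (e j)) * rGamma (\<omega> j / of_real (e j) + of_real (D j + n h)))" for j
  define Y where "Y j = of_real (e j powr (- D j)) * (Gamma (\<omega>0 j / of_real (e j)) * rGamma (\<omega>0 j / of_real (e j) + of_real (D j)))" for j
  have X: "X \<longlonglongrightarrow> w powr (- of_real (d h + n h))"
    unfolding X_def[abs_def]
  proof (rule Gamma_ratio_asymp[OF e_pos e_lim \<omega> w(1)])
    show "D j + real (n h) \<ge> 0" for j using D[of j] by simp
    show "(\<lambda>j. D j + real (n h)) \<longlonglongrightarrow> d h + real (n h)" by (intro tendsto_intros D_lim)
  qed
  have Y: "Y \<longlonglongrightarrow> of_real (\<rho> h) powr (- of_real (d h))"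
    unfolding Y_def[abs_def]
    by (rule Gamma_ratio_asymp[OF e_pos e_lim \<omega>0]) (use D \<rho> in \<open>auto intro!: D_lim less_imp_le\<close>)
  have "(\<lambda>j. X j / Y j) \<longlonglongrightarrow> w powr (- of_real (d h + n h)) / of_real (\<rho> h) powr (- of_real (d h))"
    using \<rho> by (intro tendsto_divide X Y) auto
  also have "w powr (- of_real (d h + n h)) / of_real (\<rho> h) powr (- of_real (d h)) =
      (of_real (\<rho> h) / w) powr of_real (d h) / w ^ n h"
  proof -
    have p1: "w powr (- of_real (d h + n h)) = w powr (- of_real (d h)) / w ^ n h"
      using w by (simp add: powr_add powr_minus powr_nat' powr_diff)
    have p2: "of_real (\<rho> h) powr (- complex_of_real (d h)) = inverse (of_real (\<rho> h powr d h))"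
      using \<rho> powr_of_real[of "\<rho> h" "d h"] by (simp add: powr_minus)
    show ?thesis unfolding p1 p2 powr_divide_right_half_plane[OF \<rho> w(1)] by (simp add: divide_inverse)
  qed
  also have "(\<lambda>j. X j / Y j) = (\<lambda>j. ratio_factor h j (s j))"
  proof
    fix j
    have en: "e j > 0" by (rule e_pos)
    have G: "Gamma (a h (T j) + 1) > 0" "Gamma (b h (T j) + 1) > 0"
      using Gamma_a_pos[of h j] Gamma_b_pos[OF h] h by auto
    have 1: "\<omega> j / of_real (e j) = of_real (a h (T j) + 1) + s j / of_real (e j)"
      using en by (simp add: \<omega>_def field_simps)
    have 2: "\<omega>0 j / of_real (e j) = of_real (a h (T j) + 1)"
      using en by (simp add: \<omega>0_def)
    have 3: "complex_of_real (a h (T j) + 1) + of_real (D j) = of_real (b h (T j) + 1)"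
      by (simp add: D_def)
    have 4: "e j powr (- (D j + n h)) = e j powr (- D j) * (1 / e j ^ n h)"
      using en by (simp add: powr_diff powr_realpow)
    show "X j / Y j = ratio_factor h j (s j)"
      unfolding X_def Y_def ratio_factor_def 1 2 3 4 Gamma_complex_of_real rGamma_complex_of_real of_real_mult
      using en by (simp add: D_def)
  qed
  finally show ?thesis by (simp add: w_def)
qed

lemma poch_factor_lim:
  assumes i: "i \<in> {1..p}" and s: "s \<longlonglongrightarrow> z"
  shows "(\<lambda>j. poch_factor i j (s j)) \<longlonglongrightarrow> (of_real (\<xi> i) - z) ^ m i"
proof -
  have "(\<lambda>j. e j * \<beta> i (T j)) \<longlonglongrightarrow> \<xi> i" using \<xi>_lim[OF i] by (simp add: e_def)
  then have "(\<lambda>j. poch_factor i j (s j)) \<longlonglongrightarrow> (\<Prod>k<m i. of_real (\<xi> i) - z + of_real (real k * 0))"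
    unfolding poch_factor_def by (intro tendsto_intros s e_lim)
  then show ?thesis by simp
qed

lemma eventually_Re_dom:
  assumes z: "z \<in> \<Omega>" and s: "s \<longlonglongrightarrow> z"
  shows "\<forall>\<^sub>F j in sequentially. Re (s j) \<in> dom j"
proof -
  have "Re z \<in> strip r \<rho>" using z by (simp add: \<Omega>_def)
  then obtain \<delta> where \<delta>: "\<delta> > 0" "\<forall>\<^sub>F j in sequentially. \<forall>x. \<bar>x - Re z\<bar> < \<delta> \<longrightarrow> x \<in> dom j"
    using eventually_dom by blast
  have "(\<lambda>j. Re (s j)) \<longlonglongrightarrow> Re z" by (intro tendsto_intros s)
  then have "\<forall>\<^sub>F j in sequentially. dist (Re (s j)) (Re z) < \<delta>" by (rule tendstoD) (rule \<delta>)
  with \<delta>(2) show ?thesis by eventually_elim (auto simp: dist_real_def)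
qed

lemma laplace_G_lim:
  assumes z: "z \<in> \<Omega>" and s: "s \<longlonglongrightarrow> z"
  shows "(\<lambda>j. bilateral_laplace (G j) (s j)) \<longlonglongrightarrow> H z"
proof -
  have "(\<lambda>j. Gauss_factor j (s j) * (\<Prod>h=1..r. ratio_factor h j (s j)) * (\<Prod>i=1..p. poch_factor i j (s j))) \<longlonglongrightarrow>
      exp (of_real ahat * z + z\<^sup>2 / 4) *
      (\<Prod>h=1..r. (of_real (\<rho> h) / (of_real (\<rho> h) + z)) powr of_real (d h) / (of_real (\<rho> h) + z) ^ n h) *
      (\<Prod>i=1..p. (of_real (\<xi> i) - z) ^ m i)"
    using z by (intro tendsto_mult tendsto_prod Gauss_factor_lim ratio_factor_lim poch_factor_lim s)
      (auto simp: \<Omega>_def strip_def)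
  also have "exp (of_real ahat * z + z\<^sup>2 / 4) *
      (\<Prod>h=1..r. (of_real (\<rho> h) / (of_real (\<rho> h) + z)) powr of_real (d h) / (of_real (\<rho> h) + z) ^ n h) *
      (\<Prod>i=1..p. (of_real (\<xi> i) - z) ^ m i) = H z"
    by (simp add: H_def prod_dividef)
  finally have "(\<lambda>j. Gauss_factor j (s j) * (\<Prod>h=1..r. ratio_factor h j (s j)) * (\<Prod>i=1..p. poch_factor i j (s j))) \<longlonglongrightarrow> H z" .
  moreover have "\<forall>\<^sub>F j in sequentially. Gauss_factor j (s j) * (\<Prod>h=1..r. ratio_factor h j (s j)) * (\<Prod>i=1..p. poch_factor i j (s j)) =
      bilateral_laplace (G j) (s j)"
    using eventually_Re_dom[OF z s] by eventually_elim (simp add: laplace_G(2))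
  ultimately show ?thesis by (rule Lim_transform_eventually)
qed

lemma Gauss_factor_bound:
  assumes "l \<ge> 1"
  shows "\<forall>\<^sub>F j in sequentially. \<forall>u. norm (Gauss_factor j (\<i> * of_real u)) \<le> (128 * real l / (1 + u\<^sup>2)) ^ l"
proof -
  have "\<forall>\<^sub>F j in sequentially. T j \<ge> 2 * real l" using T by (simp add: filterlim_at_top)
  moreover have "\<forall>\<^sub>F j in sequentially. eps (T j) * (a (r + 1) (T j) + 1 - T j) < 2 * ahat + 1"
    by (rule order_tendstoD(2)[OF a_last]) simp
  \<comment> \<open>With the preceding bound on e (A - \<tau>) this gives A \<le> 2 \<tau>, as the
    vertical decay estimate demands.\<close>
  moreover have "\<forall>\<^sub>F j in sequentially. eps (T j) * T j > 2 * ahat + 1"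
  proof -
    have "filterlim (\<lambda>t. eps t * t) at_top at_top" unfolding eps_def[abs_def] by real_asymp
    then have "filterlim (\<lambda>j. eps (T j) * T j) at_top sequentially" by (rule filterlim_compose[OF _ T])
    then show ?thesis by (simp add: filterlim_at_top_dense)
  qed
  ultimately show ?thesis
  proof eventually_elim
    case (elim j)
    let ?A = "a (r + 1) (T j) + 1"
    have en: "eps (T j) > 0" by (rule eps_pos[OF T_pos])
    have "eps (T j) * (?A - T j) < eps (T j) * T j" using elim by linarith
    then have A2: "?A \<le> 2 * T j" using en by simp
    have A: "?A > 0" using a_gt[of "r + 1" j] by simp
    have G: "Gamma ?A > 0" by (rule Gamma_real_pos[OF A])
    show ?case
    proof
      fix u
      have "norm (of_real (T j) powr (- (\<i> * of_real u) / of_real (e j))) = 1"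
        using T_pos[of j] by (subst norm_powr_real_powr) auto
      then have "norm (Gauss_factor j (\<i> * of_real u)) =
          norm (Gamma (of_real ?A + \<i> * of_real u / of_real (eps (T j)))) / Gamma ?A"
        using G unfolding Gauss_factor_def e_def by (simp add: norm_mult norm_divide)
      also have "\<dots> \<le> Gamma ?A * (128 * real l / (1 + u\<^sup>2)) ^ l / Gamma ?A"
        using G by (intro divide_right_mono Gamma_vertical_decay assms elim A A2) auto
      finally show "norm (Gauss_factor j (\<i> * of_real u)) \<le> (128 * real l / (1 + u\<^sup>2)) ^ l" using G by simp
    qed
  qed
qed

text \<open>On the imaginary axis the modulus is largest at 0, and the values at 0 converge in
  j.\<close>

lemma ratio_factor_bound:
  assumes h: "h \<in> {1..r}"
  obtains C where "C > 0" "\<And>j u. norm (ratio_factor h j (\<i> * of_real u)) \<le> C"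
proof -
  have "(\<lambda>j. ratio_factor h j 0) \<longlonglongrightarrow> (of_real (\<rho> h) / (of_real (\<rho> h) + 0)) powr of_real (d h) / (of_real (\<rho> h) + 0) ^ n h"
    using \<rho>_pos[OF h] by (intro ratio_factor_lim[OF h]) auto
  then obtain C where C: "C > 0" "\<And>j. norm (ratio_factor h j 0) \<le> C"
    using convergent_imp_Bseq[of "\<lambda>j. ratio_factor h j 0"] unfolding convergent_def Bseq_def by blast
  have "norm (ratio_factor h j (\<i> * of_real u)) \<le> norm (ratio_factor h j 0)" for j u
  proof -
    let ?A = "a h (T j) + 1" and ?D = "b h (T j) - a h (T j) + n h"
    have A: "?A > 0" using a_gt[of h j] h by simp
    have D: "?D > 0" using b_gt[OF h, of j] by simp
    have en: "e j > 0" by (rule e_pos)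
    let ?z = "of_real ?A + \<i> * of_real u / of_real (e j)"
    have pos: "Gamma ?A * rGamma (?A + ?D) \<ge> 0"
      using A D Gamma_real_pos[OF A] Gamma_real_pos[of "?A + ?D"] by (simp add: rGamma_inverse_Gamma)
    have Re: "Re ?z = ?A" using en by (simp add: Re_divide_of_real)
    have "norm (Gamma ?z * rGamma (?z + of_real ?D)) \<le> Gamma ?A * rGamma (?A + ?D)"
      using norm_Gamma_ratio_le[OF D, of ?z] unfolding Re using A by blast
    also have "\<dots> = norm (complex_of_real (Gamma ?A * rGamma (?A + ?D)))" using pos by (simp only: norm_of_real abs_of_nonneg)
    also have "complex_of_real (Gamma ?A * rGamma (?A + ?D)) = Gamma (of_real ?A + 0 / of_real (e j)) * rGamma (of_real ?A + 0 / of_real (e j) + of_real ?D)"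
      using rGamma_complex_of_real[of "?A + ?D"] Gamma_complex_of_real[of ?A] by simp
    finally show ?thesis unfolding ratio_factor_def norm_divide norm_mult[of "of_real (1 / e j ^ n h)"]
      by (intro divide_right_mono mult_left_mono) auto
  qed
  with C that show ?thesis by (meson order_trans)
qed

lemma poch_factor_bound:
  assumes i: "i \<in> {1..p}"
  obtains C where "C > 0" "\<And>j u. norm (poch_factor i j (\<i> * of_real u)) \<le> (C * (1 + u\<^sup>2)) ^ m i"
proof -
  have "(\<lambda>j. e j * \<beta> i (T j)) \<longlonglongrightarrow> \<xi> i" using \<xi>_lim[OF i] by (simp add: e_def)
  then obtain B where B: "B > 0" "\<And>j. \<bar>e j * \<beta> i (T j)\<bar> \<le> B"
    using convergent_imp_Bseq[of "\<lambda>j. e j * \<beta> i (T j)"] unfolding convergent_def Bseq_def by auto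
  obtain E where E: "E > 0" "\<And>j. \<bar>e j\<bar> \<le> E"
    using convergent_imp_Bseq[of e] e_lim unfolding convergent_def Bseq_def by auto
  define C where "C = B + real (m i) * E + 1"
  have "norm (poch_factor i j (\<i> * of_real u)) \<le> (C * (1 + u\<^sup>2)) ^ m i" for j u
  proof -
    have f: "norm (of_real (e j * \<beta> i (T j)) - \<i> * of_real u + of_real (real k * e j)) \<le> C * (1 + u\<^sup>2)" if "k < m i" for k
    proof -
      have "norm (of_real (e j * \<beta> i (T j)) - \<i> * of_real u + of_real (real k * e j)) \<le>
          norm (complex_of_real (e j * \<beta> i (T j))) + norm (\<i> * complex_of_real u) + norm (complex_of_real (real k * e j))"
        by (meson norm_triangle_ineq norm_triangle_ineq4 add_right_mono order_trans)
      also have "\<dots> = \<bar>e j * \<beta> i (T j)\<bar> + \<bar>u\<bar> + real k * \<bar>e j\<bar>" by (simp add: norm_mult abs_mult)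
      also have "\<dots> \<le> B + (1 + u\<^sup>2) + real (m i) * E"
      proof (intro add_mono B mult_mono E)
        have "0 \<le> (\<bar>u\<bar> - 1)\<^sup>2" by simp
        then have "2 * \<bar>u\<bar> \<le> 1 + u\<^sup>2" by (simp add: power2_eq_square algebra_simps abs_mult_self_eq)
        then show "\<bar>u\<bar> \<le> 1 + u\<^sup>2" by (meson abs_ge_zero dual_order.trans mult_le_cancel_right1 one_le_numeral le_numeral_extra linorder_not_less)
      qed (use that in auto)
      also have "\<dots> \<le> C * (1 + u\<^sup>2)"
      proof -
        have "B + real (m i) * E \<ge> 0" using B E by simp
        then have "(B + real (m i) * E) * 1 \<le> (B + real (m i) * E) * (1 + u\<^sup>2)" by (intro mult_left_mono) auto
        then show ?thesis by (simp add: C_def algebra_simps)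
      qed
      finally show ?thesis .
    qed
    have "norm (poch_factor i j (\<i> * of_real u)) \<le> (\<Prod>k<m i. C * (1 + u\<^sup>2))"
      unfolding poch_factor_def prod_norm[symmetric] by (intro prod_mono conjI f) auto
    then show ?thesis by simp
  qed
  moreover have "C > 0" using B E by (simp add: C_def add_pos_nonneg)
  ultimately show ?thesis using that by blast
qed

lemma laplace_G_bound:
  obtains C where "C > 0" "\<forall>\<^sub>F j in sequentially. \<forall>u. norm (bilateral_laplace (G j) (\<i> * of_real u)) \<le> C / (1 + u\<^sup>2)"
proof -
  define M where "M = (\<Sum>i=1..p. m i)"
  \<comment> \<open>One power more than the Pochhammer factors consume, which leaves the integrable
    1 / (1 + u^2).\<close>
  define l where "l = Suc M"
  have l: "l \<ge> 1" by (simp add: l_def)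
  have "\<forall>h\<in>{1..r}. \<exists>C>0. \<forall>j u. norm (ratio_factor h j (\<i> * of_real u)) \<le> C"
    using ratio_factor_bound by metis
  then obtain R where R: "\<And>h. h \<in> {1..r} \<Longrightarrow> R h > 0" "\<And>h j u. h \<in> {1..r} \<Longrightarrow> norm (ratio_factor h j (\<i> * of_real u)) \<le> R h"
    by metis
  have "\<forall>i\<in>{1..p}. \<exists>C>0. \<forall>j u. norm (poch_factor i j (\<i> * of_real u)) \<le> (C * (1 + u\<^sup>2)) ^ m i"
    using poch_factor_bound by metis
  then obtain Q where Q: "\<And>i. i \<in> {1..p} \<Longrightarrow> Q i > 0"
      "\<And>i j u. i \<in> {1..p} \<Longrightarrow> norm (poch_factor i j (\<i> * of_real u)) \<le> (Q i * (1 + u\<^sup>2)) ^ m i"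
    by metis
  define C where "C = (128 * real l) ^ l * (\<Prod>h=1..r. R h) * (\<Prod>i=1..p. Q i ^ m i)"
  have C: "C > 0" unfolding C_def using R Q by (intro mult_pos_pos prod_pos) (auto simp: l_def)
  have "\<forall>\<^sub>F j in sequentially. \<forall>u. norm (bilateral_laplace (G j) (\<i> * of_real u)) \<le> C / (1 + u\<^sup>2)"
    using Gauss_factor_bound[OF l]
  proof eventually_elim
    case (elim j)
    show ?case
    proof
      fix u :: real
      have u: "1 + u\<^sup>2 > 0" by (simp add: add_pos_nonneg)
      have dom: "Re (\<i> * of_real u) \<in> dom j" using zero_dom by simp
      have "norm (bilateral_laplace (G j) (\<i> * of_real u)) =
          norm (Gauss_factor j (\<i> * of_real u)) * (\<Prod>h=1..r. norm (ratio_factor h j (\<i> * of_real u))) * (\<Prod>i=1..p. norm (poch_factor i j (\<i> * of_real u)))"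
        unfolding laplace_G(2)[OF dom] by (simp add: norm_mult prod_norm)
      also have "\<dots> \<le> (128 * real l / (1 + u\<^sup>2)) ^ l * (\<Prod>h=1..r. R h) * (\<Prod>i=1..p. (Q i * (1 + u\<^sup>2)) ^ m i)"
        using elim R Q u by (intro mult_mono prod_mono conjI mult_nonneg_nonneg prod_nonneg) (auto simp: less_imp_le)
      also have "(\<Prod>i=1..p. (Q i * (1 + u\<^sup>2)) ^ m i) = (\<Prod>i=1..p. Q i ^ m i) * (1 + u\<^sup>2) ^ M"
        by (simp add: power_mult_distrib prod.distrib power_sum M_def)
      also have "(128 * real l / (1 + u\<^sup>2)) ^ l * (\<Prod>h=1..r. R h) * ((\<Prod>i=1..p. Q i ^ m i) * (1 + u\<^sup>2) ^ M) = C / (1 + u\<^sup>2)"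
      proof -
        have *: "(x / v) ^ l * P * (P' * v ^ M) = x ^ l * P * P' / v" if "v > 0" for x v P P' :: real
          using that by (simp add: power_divide l_def field_simps)
        show ?thesis unfolding C_def by (rule *[OF u])
      qed
      finally show "norm (bilateral_laplace (G j) (\<i> * of_real u)) \<le> C / (1 + u\<^sup>2)" .
    qed
  qed
  with C that show ?thesis by blast
qed

end

section \<open>Test functions in the chart\<close>

lemma test_funD:
  assumes "test_fun \<phi>"
  obtains R M where "R > 0" "\<And>t. isCont \<phi> t" "\<And>t. \<bar>\<phi> t\<bar> \<le> M" "\<And>t. \<phi> t \<noteq> 0 \<Longrightarrow> \<bar>t\<bar> \<le> R"
proof -
  let ?S = "closure {t. \<phi> t \<noteq> 0}"
  have c: "compact ?S" and s: "smooth \<phi>" using assms by (auto simp: test_fun_def)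
  have "\<phi> differentiable_on UNIV" using s[unfolded smooth_def, rule_format, of 0] by simp
  then have co: "continuous_on UNIV \<phi>" by (rule differentiable_imp_continuous_on)
  have "bounded (\<phi> ` ?S)"
    by (intro compact_imp_bounded compact_continuous_image continuous_on_subset[OF co] c) auto
  then obtain M where M: "M > 0" "\<And>t. t \<in> ?S \<Longrightarrow> \<bar>\<phi> t\<bar> \<le> M" unfolding bounded_pos by auto
  obtain R where R: "R > 0" "\<And>t. t \<in> ?S \<Longrightarrow> \<bar>t\<bar> \<le> R"
    using compact_imp_bounded[OF c] unfolding bounded_pos by auto
  have sub: "t \<in> ?S" if "\<phi> t \<noteq> 0" for t using that closure_subset[of "{t. \<phi> t \<noteq> 0}"] by auto
  show ?thesis
  proof (rule that[OF R(1)])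
    show "isCont \<phi> t" for t using co by (simp add: continuous_on_eq_continuous_at)
    show "\<bar>\<phi> t\<bar> \<le> M" for t using M sub by (cases "\<phi> t = 0") auto
    show "\<bar>t\<bar> \<le> R" if "\<phi> t \<noteq> 0" for t using R sub that by blast
  qed
qed

text \<open>The chart changes with the parameter, yet the pulled-back test functions need a common
  compact support for dominated convergence.\<close>

lemma exp_chart_support:
  fixes e R y :: real
  assumes e: "e > 0" and R: "R > 0" "e * R \<le> 1 / 2" and t: "\<bar>(exp (e * y) - 1) / e\<bar> \<le> R"
  shows "\<bar>y\<bar> \<le> 2 * R"
proof -
  have "e * y \<le> exp (e * y) - 1" using exp_ge_add_one_self[of "e * y"] by linarith
  then have "y \<le> (exp (e * y) - 1) / e" using e by (simp add: le_divide_eq mult.commute)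
  then have up: "y \<le> R" using t by linarith
  have low: "- (2 * R) \<le> y"
  proof (rule ccontr)
    assume "\<not> - (2 * R) \<le> y"
    then have "e * y < e * - (2 * R)" using e by (intro mult_strict_left_mono) auto
    then have "exp (e * y) < exp (- (2 * (e * R)))" by simp
    also have "\<dots> = inverse (exp (2 * (e * R)))" by (simp add: exp_minus)
    also have "\<dots> \<le> inverse (1 + 2 * (e * R))"
      using e R exp_ge_add_one_self[of "2 * (e * R)"] by (intro le_imp_inverse_le) (auto intro!: add_pos_nonneg)
    \<comment> \<open>With x = e R, (1 - x) (1 + 2 x) = 1 + x (1 - 2 x) is at least 1 as long as x
      \<le> 1 / 2; this is why e R is restricted.\<close>
    also have "\<dots> \<le> 1 - e * R"
    proof -
      have x: "0 < e * R" using e R by simp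
      have "(1 - e * R) * (1 + 2 * (e * R)) = 1 + e * R * (1 - 2 * (e * R))" by (simp add: algebra_simps)
      also have "\<dots> \<ge> 1" using x R(2) by (simp add: mult_nonneg_nonneg)
      finally show ?thesis using x by (simp add: inverse_eq_divide divide_le_eq)
    qed
    finally have "exp (e * y) - 1 < - R * e" by (simp add: mult.commute)
    then have "(exp (e * y) - 1) / e < - R" using e by (simp add: divide_less_eq)
    with t show False by linarith
  qed
  from up low R show ?thesis by linarith
qed

text \<open>Counterexamples of unbounded size would form a sequence tending to infinity, so one good
  index on each sequence is enough.\<close>

lemma eventually_at_topI_sequentially:
  fixes P :: "real \<Rightarrow> bool"
  assumes "\<And>X. filterlim X at_top sequentially \<Longrightarrow> \<exists>j. P (X j)"
  shows "eventually P at_top"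
proof (rule ccontr)
  assume "\<not> eventually P at_top"
  then have "\<forall>j::nat. \<exists>x\<ge>real j. \<not> P x" unfolding eventually_at_top_linorder by blast
  then obtain X where X: "\<And>j. X j \<ge> real j" "\<And>j. \<not> P (X j)" by metis
  have "filterlim X at_top sequentially"
    by (rule filterlim_at_top_mono[OF filterlim_real_sequentially]) (simp add: X)
  from assms[OF this] X show False by blast
qed

section \<open>The limit function, its moments and distributional convergence\<close>

context laguerre_limit
begin

definition BH :: "real \<Rightarrow> real" where
  "BH = D_part p \<xi> m (K_part r \<rho> n (F_fun r \<rho> d ahat))"

lemma BH_decaying: "decaying (strip r \<rho>) BH"
  unfolding BH_def
  by (intro D_part_strip(1) open_strip K_part_strip(1) F_fun_strip(1)) (auto simp: \<rho>_pos d_nonneg)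

lemma laplace_BH:
  assumes z: "Re z \<in> strip r \<rho>"
  shows "bilateral_laplace BH z = H z"
proof -
  have F: "decaying (strip r \<rho>) (F_fun r \<rho> d ahat)"
    by (rule F_fun_strip(1)) (auto simp: \<rho>_pos d_nonneg)
  have K: "decaying (strip r \<rho>) (K_part r \<rho> n (F_fun r \<rho> d ahat))"
    by (rule K_part_strip(1)) (auto simp: \<rho>_pos F)
  have "bilateral_laplace (F_fun r \<rho> d ahat) z =
      exp (of_real ahat * z + z\<^sup>2 / 4) * (\<Prod>h=1..r. (of_real (\<rho> h) / (of_real (\<rho> h) + z)) powr of_real (d h))"
    by (rule F_fun_strip(2)) (auto simp: \<rho>_pos d_nonneg z)
  moreover have "bilateral_laplace (K_part r \<rho> n (F_fun r \<rho> d ahat)) z =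
      bilateral_laplace (F_fun r \<rho> d ahat) z / (\<Prod>h=1..r. (of_real (\<rho> h) + z) ^ n h)"
    by (rule K_part_strip(2)) (auto simp: \<rho>_pos F z)
  ultimately show ?thesis
    unfolding BH_def D_part_strip(2)[OF open_strip K z] H_def by (simp only:) (simp add: mult_ac)
qed

lemma BH_measurable [measurable]: "BH \<in> borel_measurable borel"
  using decaying_measurable[OF BH_decaying, of 0] by simp

lemma zero_strip: "0 \<in> strip r \<rho>"
  using \<rho>_pos by (auto simp: strip_def)

lemma BH_integrable: "integrable lborel BH"
  using decaying_integrable[OF open_strip BH_decaying zero_strip] by simp

lemma pullback_measurable:
  "(\<lambda>x. indicator {0<..} x * BL (T j) x) \<in> borel_measurable borel"
proof -
  have "has_mellin (BL (T j)) 1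
          ((\<Prod>\<nu>=1..r+1. Gamma (1 + of_real (a \<nu> (T j))))
             / (\<Prod>h=1..r. Gamma (1 + of_real (b h (T j)) + of_nat (n h)))
           * (\<Prod>i=1..p. pochhammer (of_real (\<beta> i (T j)) + 1 - 1) (m i)))"
  proof (rule rep[of j, unfolded laguerre_rep_def, rule_format])
    fix \<nu> assume "\<nu> \<in> {1..r+1}"
    then show "- a \<nu> (T j) < Re 1" using a_gt[of \<nu> j] by simp
  qed
  then show ?thesis by (rule has_mellin_measurable)
qed

lemma G_measurable [measurable]: "G j \<in> borel_measurable borel"
  using log_pullback_measurable[OF pullback_measurable T_pos] unfolding G_def[abs_def] by measurable

lemma G_integrable: "integrable lborel (G j)"
proof -
  have "bilateral_laplace_exists (G j) 0" by (rule laplace_G(1)) (simp add: zero_dom)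
  then show ?thesis by (simp add: bilateral_laplace_exists_iff[OF G_measurable])
qed

lemma rescaled_substitution:
  assumes [measurable]: "\<phi> \<in> borel_measurable borel"
  shows "set_integrable lborel {- inverse (eps (T j))<..} (\<lambda>t. \<phi> t * rescaled r a b \<eta> BL (T j) t) \<longleftrightarrow>
      integrable lborel (\<lambda>y. \<phi> ((exp (e j * y) - 1) / e j) * G j y)"
    and "set_integrable lborel {- inverse (eps (T j))<..} (\<lambda>t. \<phi> t * rescaled r a b \<eta> BL (T j) t) \<Longrightarrow>
      (LINT t:{- inverse (eps (T j))<..}|lborel. \<phi> t * rescaled r a b \<eta> BL (T j) t) =
      (LINT y|lborel. \<phi> ((exp (e j * y) - 1) / e j) * G j y)"
proof -
  define c where "c = T j * e j ^ \<eta> / Z_norm r a b (T j)"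
  have 1: "\<phi> t * rescaled r a b \<eta> BL (T j) t = (\<phi> t * c) * BL (T j) (T j * (1 + e j * t))" for t
    by (simp add: rescaled_def c_def ctr_def x_map_def e_def)
  have 2: "\<phi> ((exp (e j * y) - 1) / e j) * G j y = (\<phi> ((exp (e j * y) - 1) / e j) * c) * log_pullback (T j) (e j) (BL (T j)) y" for y
    by (simp add: G_def c_def)
  have fm: "(\<lambda>t. \<phi> t * c) \<in> borel_measurable borel" by measurable
  note A = affine_log_substitution[OF pullback_measurable[of j], of "\<lambda>t. \<phi> t * c" "T j" "e j", OF fm T_pos e_pos]
  show "set_integrable lborel {- inverse (eps (T j))<..} (\<lambda>t. \<phi> t * rescaled r a b \<eta> BL (T j) t) \<longleftrightarrow>
      integrable lborel (\<lambda>y. \<phi> ((exp (e j * y) - 1) / e j) * G j y)"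
    unfolding 1 2 e_def[symmetric] by (rule A(1))
  show "(LINT t:{- inverse (eps (T j))<..}|lborel. \<phi> t * rescaled r a b \<eta> BL (T j) t) =
      (LINT y|lborel. \<phi> ((exp (e j * y) - 1) / e j) * G j y)"
    if "set_integrable lborel {- inverse (eps (T j))<..} (\<lambda>t. \<phi> t * rescaled r a b \<eta> BL (T j) t)"
    using that unfolding 1 2 e_def[symmetric] by (rule A(2))
qed

lemma rescaled_integrable: "set_integrable lborel {- inverse (eps (T j))<..} (rescaled r a b \<eta> BL (T j))"
  using rescaled_substitution(1)[of "\<lambda>_. 1" j] G_integrable by simp

text \<open>In the chart 1 + e t = exp (e y), so the weight (1 + e t)^\<beta> is exp (e \<beta> y),
  and the moment is a difference of the transform based at e \<beta>, a point tending to
  \<open>\<xi> i\<close>.\<close>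

lemma moment_eventually:
  assumes i: "i \<in> {1..p}"
  shows "\<forall>\<^sub>F j in sequentially.
      set_integrable lborel {- inverse (eps (T j))<..} (\<lambda>t. t ^ k * (1 + eps (T j) * t) powr \<beta> i (T j) * rescaled r a b \<eta> BL (T j) t) \<and>
      of_real (LINT t:{- inverse (eps (T j))<..}|lborel. t ^ k * (1 + eps (T j) * t) powr \<beta> i (T j) * rescaled r a b \<eta> BL (T j) t) =
        (diff_quot (e j) ^^ k) (bilateral_laplace (G j)) (of_real (e j * \<beta> i (T j)))"
proof -
  have lim: "(\<lambda>j. complex_of_real (e j * \<beta> i (T j))) \<longlonglongrightarrow> of_real (\<xi> i)"
    using \<xi>_lim[OF i] unfolding e_def[symmetric] by (rule tendsto_of_real)
  have xi: "complex_of_real (\<xi> i) \<in> \<Omega>" using \<xi>_\<rho>[OF i] by (fastforce simp: \<Omega>_def strip_def)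
  show ?thesis
    using eventually_Re_dom[OF xi lim]
  proof eventually_elim
    case (elim j)
    let ?s = "e j * \<beta> i (T j)"
    have s: "?s \<in> dom j" using elim by simp
    have en: "e j > 0" by (rule e_pos)
    let ?Q = "\<lambda>y. ((exp (e j * y) - 1) / e j) ^ k * G j y"
    have D: "bilateral_laplace_exists ?Q (of_real ?s) \<and>
        (diff_quot (e j) ^^ k) (bilateral_laplace (G j)) (of_real ?s) = bilateral_laplace ?Q (of_real ?s)"
      by (rule iterated_diff_quot_laplace[OF en]) (use s en dom_add in \<open>auto intro!: laplace_G(1)\<close>)
    let ?\<phi> = "\<lambda>t. t ^ k * (1 + eps (T j) * t) powr \<beta> i (T j)"
    have \<phi>m: "?\<phi> \<in> borel_measurable borel" by measurable
    have eq: "?\<phi> ((exp (e j * y) - 1) / e j) * G j y = exp (?s * y) * ?Q y" for y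
    proof -
      have "1 + eps (T j) * ((exp (e j * y) - 1) / e j) = exp (e j * y)"
        using en by (simp add: e_def)
      then show ?thesis by (simp add: powr_def mult_ac)
    qed
    have c: "complex_of_real (exp (?s * y) * ?Q y) = exp (of_real ?s * of_real y) * complex_of_real (?Q y)" for y
      by (simp flip: exp_of_real)
    have I: "integrable lborel (\<lambda>y. exp (?s * y) * ?Q y)"
    proof -
      have "integrable lborel (\<lambda>y. complex_of_real (exp (?s * y) * ?Q y))"
        unfolding c using D by (simp add: bilateral_laplace_exists_def)
      then show ?thesis by (simp only: complex_of_real_integrable_eq)
    qed
    have SI: "set_integrable lborel {- inverse (eps (T j))<..} (\<lambda>t. ?\<phi> t * rescaled r a b \<eta> BL (T j) t)"
      unfolding rescaled_substitution(1)[OF \<phi>m] eq by (rule I)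
    have "of_real (LINT t:{- inverse (eps (T j))<..}|lborel. ?\<phi> t * rescaled r a b \<eta> BL (T j) t) =
        complex_of_real (LINT y|lborel. exp (?s * y) * ?Q y)"
      unfolding rescaled_substitution(2)[OF \<phi>m SI] eq ..
    also have "\<dots> = bilateral_laplace ?Q (of_real ?s)"
      unfolding integral_complex_of_real[symmetric] c bilateral_laplace_def ..
    finally show ?case using SI D by simp
  qed
qed

lemma laplace_BH_holomorphic: "bilateral_laplace BH holomorphic_on \<Omega>"
  unfolding \<Omega>_def by (intro bilateral_laplace_holomorphic BH_measurable open_strip decaying_integrable[OF open_strip BH_decaying])

lemma moment_tendsto:
  assumes i: "i \<in> {1..p}"
  shows "(\<lambda>j. LINT t:{- inverse (eps (T j))<..}|lborel. t ^ k * (1 + eps (T j) * t) powr \<beta> i (T j) * rescaled r a b \<eta> BL (T j) t)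
    \<longlonglongrightarrow> (LINT t|lborel. t ^ k * exp (\<xi> i * t) * BH t)"
proof -
  have lim: "(\<lambda>j. complex_of_real (e j * \<beta> i (T j))) \<longlonglongrightarrow> of_real (\<xi> i)"
    using \<xi>_lim[OF i] unfolding e_def[symmetric] by (rule tendsto_of_real)
  have xi: "complex_of_real (\<xi> i) \<in> \<Omega>" using \<xi>_\<rho>[OF i] by (fastforce simp: \<Omega>_def strip_def)
  \<comment> \<open>The transform is known to be holomorphic over \<open>dom j\<close> only, which
    eventually contains a fixed neighbourhood of Re z.\<close>
  have hol: "\<exists>\<delta>>0. \<forall>\<^sub>F j in sequentially. bilateral_laplace (G j) holomorphic_on ball z \<delta>" if z: "z \<in> \<Omega>" for z
  proof -
    have "Re z \<in> strip r \<rho>" using z by (simp add: \<Omega>_def)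
    then obtain \<delta> where \<delta>: "\<delta> > 0" "\<forall>\<^sub>F j in sequentially. \<forall>x. \<bar>x - Re z\<bar> < \<delta> \<longrightarrow> x \<in> dom j"
      using eventually_dom by blast
    from \<delta>(2) have "\<forall>\<^sub>F j in sequentially. bilateral_laplace (G j) holomorphic_on ball z \<delta>"
    proof eventually_elim
      case (elim j)
      have "bilateral_laplace (G j) holomorphic_on {s. Re s \<in> dom j}"
      proof (rule bilateral_laplace_holomorphic[OF G_measurable open_dom])
        fix \<sigma> assume "\<sigma> \<in> dom j"
        then have "bilateral_laplace_exists (G j) (of_real \<sigma>)" by (intro laplace_G(1)) simp
        then show "integrable lborel (\<lambda>t. exp (\<sigma> * t) * G j t)"
          by (simp add: bilateral_laplace_exists_iff[OF G_measurable])
      qed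
      then show ?case
      proof (rule holomorphic_on_subset)
        show "ball z \<delta> \<subseteq> {s. Re s \<in> dom j}"
        proof
          fix s assume "s \<in> ball z \<delta>"
          then have "\<bar>Re s - Re z\<bar> < \<delta>"
            using abs_Re_le_cmod[of "s - z"] by (simp add: dist_norm norm_minus_commute)
          then show "s \<in> {s. Re s \<in> dom j}" using elim by simp
        qed
      qed
    qed
    with \<delta> show ?thesis by blast
  qed
  have "(\<lambda>j. (diff_quot (e j) ^^ k) (bilateral_laplace (G j)) (of_real (e j * \<beta> i (T j)))) \<longlonglongrightarrow>
      (deriv ^^ k) (bilateral_laplace BH) (of_real (\<xi> i))"
  proof (rule iterated_diff_quot_tendsto[OF open_\<Omega> laplace_BH_holomorphic hol _ e_pos e_lim xi lim])
    fix s :: "nat \<Rightarrow> complex" and z assume "z \<in> \<Omega>" "s \<longlonglongrightarrow> z"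
    then show "(\<lambda>j. bilateral_laplace (G j) (s j)) \<longlonglongrightarrow> bilateral_laplace BH z"
      using laplace_G_lim laplace_BH by (simp add: \<Omega>_def)
  qed
  also have "(deriv ^^ k) (bilateral_laplace BH) (of_real (\<xi> i)) = bilateral_laplace (\<lambda>t. t ^ k * BH t) (of_real (\<xi> i))"
    using xi by (intro decaying_laplace_higher_deriv[OF open_strip BH_decaying]) (simp add: \<Omega>_def)
  also have "\<dots> = of_real (LINT t|lborel. t ^ k * exp (\<xi> i * t) * BH t)"
  proof -
    have "exp (of_real (\<xi> i) * of_real t) * complex_of_real (t ^ k * BH t) = of_real (t ^ k * exp (\<xi> i * t) * BH t)" for t
      by (simp add: mult_ac flip: exp_of_real)
    then show ?thesis unfolding bilateral_laplace_def by (simp only: integral_complex_of_real)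
  qed
  finally have "(\<lambda>j. (diff_quot (e j) ^^ k) (bilateral_laplace (G j)) (of_real (e j * \<beta> i (T j)))) \<longlonglongrightarrow>
      of_real (LINT t|lborel. t ^ k * exp (\<xi> i * t) * BH t)" .
  then have "(\<lambda>j. complex_of_real (LINT t:{- inverse (eps (T j))<..}|lborel. t ^ k * (1 + eps (T j) * t) powr \<beta> i (T j) * rescaled r a b \<eta> BL (T j) t))
    \<longlonglongrightarrow> of_real (LINT t|lborel. t ^ k * exp (\<xi> i * t) * BH t)"
    by (rule Lim_transform_eventually) (use moment_eventually[OF i, of k] in \<open>auto elim!: eventually_mono\<close>)
  then show ?thesis by (simp only: tendsto_of_real_iff)
qed

lemma BH_orthogonal:
  assumes i: "i \<in> {1..p}" and k: "k < m i"
  shows "(LINT t|lborel. t ^ k * exp (\<xi> i * t) * BH t) = 0"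
proof -
  have lim: "(\<lambda>j. complex_of_real (e j * \<beta> i (T j))) \<longlonglongrightarrow> of_real (\<xi> i)"
    using \<xi>_lim[OF i] unfolding e_def[symmetric] by (rule tendsto_of_real)
  have xi: "complex_of_real (\<xi> i) \<in> \<Omega>" using \<xi>_\<rho>[OF i] by (fastforce simp: \<Omega>_def strip_def)
  have "\<forall>\<^sub>F j in sequentially. (LINT t:{- inverse (eps (T j))<..}|lborel. t ^ k * (1 + eps (T j) * t) powr \<beta> i (T j) * rescaled r a b \<eta> BL (T j) t) = 0"
    using eventually_Re_dom[OF xi lim] moment_eventually[OF i, of k]
  proof eventually_elim
    case (elim j)
    have "(diff_quot (e j) ^^ k) (bilateral_laplace (G j)) (of_real (e j * \<beta> i (T j))) = 0"
    proof (rule iterated_diff_quot_eq_0)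
      fix l assume l: "l \<le> k"
      let ?s = "complex_of_real (e j * \<beta> i (T j)) + of_real (real l * e j)"
      have "Re ?s \<in> dom j" using elim(1) e_pos[of j] by (simp add: dom_add)
      \<comment> \<open>The node with index l kills the factor with index l, which is present
        because l \<le> k < m i.\<close>
      moreover have "poch_factor i j ?s = 0"
        unfolding poch_factor_def using l k by (intro prod_zero bexI[of _ l]) auto
      ultimately show "bilateral_laplace (G j) ?s = 0"
        using i by (subst laplace_G(2)) (auto intro!: prod_zero)
    qed
    with elim(2) show ?case by simp
  qed
  then have "(\<lambda>j. 0) \<longlonglongrightarrow> (LINT t|lborel. t ^ k * exp (\<xi> i * t) * BH t)"
    by (rule Lim_transform_eventually[OF moment_tendsto[OF i, of k]])
  then show ?thesis by (simp add: LIMSEQ_const_iff)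
qed

text \<open>Parseval is applied at both ends: to \<open>G j\<close> with the pulled-back test
  function, and to the limit with \<phi>. In between both transforms vary with j, one dominated by C
  / (1 + u^2), the other by a constant.\<close>

lemma distribution_tendsto:
  assumes "test_fun \<phi>"
  shows "(\<lambda>j. LINT t|lborel. (if t > - inverse (eps (T j)) then rescaled r a b \<eta> BL (T j) t else 0) * \<phi> t)
    \<longlonglongrightarrow> (LINT t|lborel. BH t * \<phi> t)"
proof -
  obtain R M where R: "R > 0" and cont: "\<And>t. isCont \<phi> t" and M: "\<And>t. \<bar>\<phi> t\<bar> \<le> M"
      and supp: "\<And>t. \<phi> t \<noteq> 0 \<Longrightarrow> \<bar>t\<bar> \<le> R"
    using test_funD[OF assms] by metis
  have M0: "M \<ge> 0" using M[of 0] by linarith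
  have [measurable]: "\<phi> \<in> borel_measurable borel"
    by (intro borel_measurable_continuous_onI continuous_at_imp_continuous_on ballI cont)
  define \<psi> where "\<psi> j y = \<phi> ((exp (e j * y) - 1) / e j)" for j y
  have \<psi>_cont: "isCont (\<psi> j) y" for j y
    unfolding \<psi>_def[abs_def]
    by (rule isCont_o2[OF _ cont]) (use e_pos[of j] in \<open>auto intro!: continuous_intros\<close>)
  have [measurable]: "\<psi> j \<in> borel_measurable borel" for j
    by (intro borel_measurable_continuous_onI continuous_at_imp_continuous_on ballI \<psi>_cont)
  have \<psi>M: "\<bar>\<psi> j y\<bar> \<le> M" for j y unfolding \<psi>_def by (rule M)
  let ?w = "\<lambda>y. M * indicat_real {- (2 * R)..2 * R} y"
  have wi: "integrable lborel ?w" by (intro integrable_mult_right integrable_real_indicator) (auto simp: emeasure_lborel_Icc_eq)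
  have wv: "(LINT y|lborel. ?w y) = M * (4 * R)" using R by simp
  have \<phi>w: "\<bar>\<phi> y\<bar> \<le> ?w y" for y
    using M[of y] supp[of y] R M0 by (cases "\<phi> y = 0") (auto simp: indicator_def abs_le_iff)
  have \<phi>i: "integrable lborel \<phi>"
  proof (rule Bochner_Integration.integrable_bound[OF wi])
    show "AE y in lborel. norm (\<phi> y) \<le> norm (?w y)"
      unfolding real_norm_def by (intro AE_I2 order_trans[OF \<phi>w abs_ge_self])
  qed measurable
  obtain C where C: "C > 0" "\<forall>\<^sub>F j in sequentially. \<forall>u. norm (bilateral_laplace (G j) (\<i> * of_real u)) \<le> C / (1 + u\<^sup>2)"
    by (rule laplace_G_bound)
  have "(\<lambda>j. e j * R) \<longlonglongrightarrow> 0 * R" by (intro tendsto_intros e_lim)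
  then have "\<forall>\<^sub>F j in sequentially. e j * R < 1 / 2" by (rule order_tendstoD(2)) simp
  with C(2) have "\<forall>\<^sub>F j in sequentially. e j * R < 1 / 2 \<and> (\<forall>u. norm (bilateral_laplace (G j) (\<i> * of_real u)) \<le> C / (1 + u\<^sup>2))"
    by eventually_elim simp
  then obtain N where N: "\<And>j. j \<ge> N \<Longrightarrow> e j * R < 1 / 2"
      "\<And>j u. j \<ge> N \<Longrightarrow> norm (bilateral_laplace (G j) (\<i> * of_real u)) \<le> C / (1 + u\<^sup>2)"
    unfolding eventually_sequentially by blast
  have \<psi>w: "\<bar>\<psi> j y\<bar> \<le> ?w y" if "j \<ge> N" for j y
  proof (cases "\<psi> j y = 0")
    case False
    then have "\<bar>(exp (e j * y) - 1) / e j\<bar> \<le> R" unfolding \<psi>_def by (rule supp)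
    then have "\<bar>y\<bar> \<le> 2 * R"
      using N(1)[OF that] R by (intro exp_chart_support[OF e_pos[of j]]) auto
    then show ?thesis using \<psi>M[of j y] by (auto simp: indicator_def abs_le_iff)
  qed (use M0 in simp)
  have \<psi>i: "integrable lborel (\<psi> j)" if "j \<ge> N" for j
  proof (rule Bochner_Integration.integrable_bound[OF wi])
    show "AE y in lborel. norm (\<psi> j y) \<le> norm (?w y)"
      unfolding real_norm_def by (intro AE_I2 order_trans[OF \<psi>w[OF that] abs_ge_self])
  qed measurable
  let ?L = "\<lambda>j u. bilateral_laplace (G j) (\<i> * of_real u)"
  let ?P = "\<lambda>j u. bilateral_laplace (\<psi> j) (- \<i> * of_real u)"
  let ?L' = "\<lambda>u. bilateral_laplace BH (\<i> * of_real u)"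
  let ?P' = "\<lambda>u. bilateral_laplace \<phi> (- \<i> * of_real u)"
  have [measurable]: "?L j \<in> borel_measurable borel" "?P j \<in> borel_measurable borel"
    "?L' \<in> borel_measurable borel" "?P' \<in> borel_measurable borel" for j
    unfolding bilateral_laplace_def by measurable
  have Ci: "integrable lborel (\<lambda>u. C / (1 + u\<^sup>2))"
  proof -
    have "integrable lborel (\<lambda>u::real. inverse (1 + u\<^sup>2))"
      using integrable_inverse_1_plus_square by (simp add: set_integrable_def)
    then have "integrable lborel (\<lambda>u::real. C * inverse (1 + u\<^sup>2))" by (rule integrable_mult_right)
    then show ?thesis by (simp add: divide_inverse)
  qed
  have Llim: "(\<lambda>j. ?L j u) \<longlonglongrightarrow> ?L' u" for u
  proof -
    have z: "\<i> * of_real u \<in> \<Omega>" using zero_strip by (simp add: \<Omega>_def)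
    then have "bilateral_laplace BH (\<i> * of_real u) = H (\<i> * of_real u)" by (intro laplace_BH) (simp add: \<Omega>_def)
    with laplace_G_lim[OF z tendsto_const] show ?thesis by simp
  qed
  \<comment> \<open>The uniform bound survives the pointwise limit and makes the limit transform
    integrable.\<close>
  have L'b: "norm (?L' u) \<le> C / (1 + u\<^sup>2)" for u
    by (rule LIMSEQ_le_const2[OF tendsto_norm[OF Llim]]) (use N(2) in blast)
  have pos: "C / (1 + u\<^sup>2) \<ge> 0" for u using C by (simp add: add_nonneg_nonneg)
  have Li: "integrable lborel (?L j)" if "j \<ge> N" for j
  proof (rule Bochner_Integration.integrable_bound[OF Ci])
    show "AE u in lborel. norm (?L j u) \<le> norm (C / (1 + u\<^sup>2))"
      unfolding real_norm_def by (intro AE_I2 order_trans[OF N(2)[OF that] abs_ge_self])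
  qed measurable
  have L'i: "integrable lborel ?L'"
  proof (rule Bochner_Integration.integrable_bound[OF Ci])
    show "AE u in lborel. norm (?L' u) \<le> norm (C / (1 + u\<^sup>2))"
      unfolding real_norm_def by (intro AE_I2 order_trans[OF L'b abs_ge_self])
  qed measurable
  have Pb: "norm (?P j u) \<le> M * (4 * R)" if "j \<ge> N" for j u
  proof -
    have "norm (?P j u) \<le> (LINT y|lborel. norm (exp (- \<i> * of_real u * of_real y) * complex_of_real (\<psi> j y)))"
      unfolding bilateral_laplace_def by (rule integral_norm_bound)
    also have "\<dots> = (LINT y|lborel. \<bar>\<psi> j y\<bar>)" by (simp add: norm_mult)
    also have "\<dots> \<le> (LINT y|lborel. ?w y)" by (intro integral_mono integrable_abs \<psi>i that wi \<psi>w)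
    finally show ?thesis unfolding wv .
  qed
  have Plim: "(\<lambda>j. ?P (j + N) u) \<longlonglongrightarrow> ?P' u" for u
    unfolding bilateral_laplace_def
  proof (rule integral_dominated_convergence[where w = ?w])
    have "(\<lambda>j. \<psi> j y) \<longlonglongrightarrow> \<phi> y" for y
    proof -
      have "((\<lambda>x. (exp (x * y) - 1) / x) \<longlongrightarrow> y) (at_right 0)" by real_asymp
      moreover have "filterlim e (at_right 0) sequentially"
        using e_lim less_imp_neq[OF e_pos, symmetric] e_pos by (simp add: filterlim_at)
      ultimately have "(\<lambda>j. (exp (e j * y) - 1) / e j) \<longlonglongrightarrow> y" by (rule filterlim_compose)
      then show ?thesis unfolding \<psi>_def by (rule isCont_tendsto_compose[OF cont])
    qed
    then show "AE y in lborel. (\<lambda>j. exp (- \<i> * of_real u * of_real y) * complex_of_real (\<psi> (j + N) y)) \<longlonglongrightarrow>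
        exp (- \<i> * of_real u * of_real y) * complex_of_real (\<phi> y)"
      by (intro AE_I2 tendsto_mult tendsto_const tendsto_of_real LIMSEQ_ignore_initial_segment)
    show "AE y in lborel. norm (exp (- \<i> * of_real u * of_real y) * complex_of_real (\<psi> (j + N) y)) \<le> ?w y" for j
      using \<psi>w[of "j + N"] by (simp add: norm_mult)
  qed (use wi in measurable)
  have "(\<lambda>j. LINT u|lborel. ?L (j + N) u * ?P (j + N) u) \<longlonglongrightarrow> (LINT u|lborel. ?L' u * ?P' u)"
  proof (rule integral_dominated_convergence[where w = "\<lambda>u. C / (1 + u\<^sup>2) * (M * (4 * R))"])
    show "integrable lborel (\<lambda>u. C / (1 + u\<^sup>2) * (M * (4 * R)))" by (intro integrable_mult_left Ci)
    show "AE u in lborel. (\<lambda>j. ?L (j + N) u * ?P (j + N) u) \<longlonglongrightarrow> ?L' u * ?P' u"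
      by (intro AE_I2 tendsto_mult Plim LIMSEQ_ignore_initial_segment[OF Llim])
    show "AE u in lborel. norm (?L (j + N) u * ?P (j + N) u) \<le> C / (1 + u\<^sup>2) * (M * (4 * R))" for j
      unfolding norm_mult using M0 R pos by (intro AE_I2 mult_mono N(2) Pb) auto
  qed measurable
  then have lim: "(\<lambda>j. (LINT u|lborel. ?L (j + N) u * ?P (j + N) u) / of_real (2 * pi)) \<longlonglongrightarrow>
      (LINT u|lborel. ?L' u * ?P' u) / of_real (2 * pi)"
    by (intro tendsto_divide tendsto_const) auto
  have "(LINT u|lborel. ?L' u * ?P' u) / of_real (2 * pi) = of_real (LINT t|lborel. BH t * \<phi> t)"
    by (rule bilateral_laplace_parseval[OF BH_integrable L'i \<phi>i cont M, symmetric])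
  moreover have "(LINT u|lborel. ?L (j + N) u * ?P (j + N) u) / of_real (2 * pi) =
      of_real (LINT t|lborel. (if t > - inverse (eps (T (j + N))) then rescaled r a b \<eta> BL (T (j + N)) t else 0) * \<phi> t)" for j
  proof -
    let ?j = "j + N"
    have "integrable lborel (\<lambda>y. \<phi> ((exp (e ?j * y) - 1) / e ?j) * G ?j y)"
    proof (rule Bochner_Integration.integrable_bound)
      show "integrable lborel (\<lambda>y. M * G ?j y)" by (intro integrable_mult_right G_integrable)
      show "AE y in lborel. norm (\<phi> ((exp (e ?j * y) - 1) / e ?j) * G ?j y) \<le> norm (M * G ?j y)"
        using M M0 by (intro AE_I2) (auto simp: abs_mult intro!: mult_right_mono)
    qed measurable
    then have SI: "set_integrable lborel {- inverse (eps (T ?j))<..} (\<lambda>t. \<phi> t * rescaled r a b \<eta> BL (T ?j) t)"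
      by (subst rescaled_substitution(1)) auto
    have "(LINT t|lborel. (if t > - inverse (eps (T ?j)) then rescaled r a b \<eta> BL (T ?j) t else 0) * \<phi> t) =
        (LINT t:{- inverse (eps (T ?j))<..}|lborel. \<phi> t * rescaled r a b \<eta> BL (T ?j) t)"
      unfolding set_lebesgue_integral_def by (intro Bochner_Integration.integral_cong) (auto simp: indicator_def)
    also have "\<dots> = (LINT y|lborel. G ?j y * \<psi> ?j y)"
      by (subst rescaled_substitution(2)[OF _ SI]) (auto simp: \<psi>_def mult.commute)
    finally show ?thesis
      using bilateral_laplace_parseval[OF G_integrable Li \<psi>i \<psi>_cont \<psi>M, of ?j ?j] by simp
  qed
  ultimately have "(\<lambda>j. complex_of_real (LINT t|lborel. (if t > - inverse (eps (T (j + N))) then rescaled r a b \<eta> BL (T (j + N)) t else 0) * \<phi> t)) \<longlonglongrightarrow>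
      of_real (LINT t|lborel. BH t * \<phi> t)"
    using lim by simp
  then have "(\<lambda>j. LINT t|lborel. (if t > - inverse (eps (T (j + N))) then rescaled r a b \<eta> BL (T (j + N)) t else 0) * \<phi> t) \<longlonglongrightarrow>
      (LINT t|lborel. BH t * \<phi> t)" by (simp only: tendsto_of_real_iff)
  then show ?thesis by (rule LIMSEQ_offset)
qed

end

section \<open>Passage from sequences to the filter at infinity\<close>

lemma integrable_imp_locally_integrable: "integrable lborel f \<Longrightarrow> locally_integrable f"
  unfolding locally_integrable_def set_integrable_def
  using integrable_mult_indicator[of _ lborel f] by (simp add: borel_compact)

text \<open>The shift \<open>N\<close> lets each test sequence be trimmed to a tail on which the
  locale assumptions hold.\<close>

lemma tendsto_at_top_sequentiallyI:
  fixes f :: "real \<Rightarrow> 'a::topological_space"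
  assumes "\<And>X. filterlim X at_top sequentially \<Longrightarrow> \<exists>N. (\<lambda>j. f (X (j + N))) \<longlonglongrightarrow> L"
  shows "(f \<longlongrightarrow> L) at_top"
proof (rule topological_tendstoI)
  fix S assume S: "open S" "L \<in> S"
  show "\<forall>\<^sub>F x in at_top. f x \<in> S"
  proof (rule eventually_at_topI_sequentially)
    fix X :: "nat \<Rightarrow> real" assume "filterlim X at_top sequentially"
    then obtain N where "(\<lambda>j. f (X (j + N))) \<longlonglongrightarrow> L" using assms by blast
    from topological_tendstoD[OF this S] show "\<exists>j. f (X j) \<in> S"
      using eventually_happens'[OF sequentially_bot] by blast
  qed
qed

text \<open>Here eps \<tau> * sqrt (2 \<tau>) = 2 produces the factor 2, and eps \<tau> tending to 0
  removes the bounded remainder.\<close>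

lemma eps_centering_limit:
  assumes "(\<lambda>\<tau>. f \<tau> - (\<tau> + sqrt (2 * \<tau>) * ahat)) \<in> O[at_top](\<lambda>_. 1)"
  shows "((\<lambda>\<tau>. eps \<tau> * (f \<tau> - \<tau>)) \<longlongrightarrow> 2 * ahat) at_top"
proof -
  let ?R = "\<lambda>\<tau>. f \<tau> - (\<tau> + sqrt (2 * \<tau>) * ahat)"
  obtain c where c: "\<forall>\<^sub>F \<tau> in at_top. norm (?R \<tau>) \<le> c * norm (1::real)"
    using landau_o.bigE[OF assms] by blast
  have "((\<lambda>\<tau>. eps \<tau> * ?R \<tau>) \<longlongrightarrow> 0) at_top"
  proof (rule Lim_null_comparison)
    show "((\<lambda>\<tau>. eps \<tau> * c) \<longlongrightarrow> 0) at_top" using tendsto_mult_right[OF eps_tendsto_0, of c] by simp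
    show "\<forall>\<^sub>F \<tau> in at_top. norm (eps \<tau> * ?R \<tau>) \<le> eps \<tau> * c"
      using c eventually_gt_at_top[of 0]
    proof eventually_elim
      case (elim \<tau>)
      then show ?case using eps_pos[OF elim(2)] by (simp add: abs_mult)
    qed
  qed
  then have "((\<lambda>\<tau>. eps \<tau> * ?R \<tau> + 2 * ahat) \<longlongrightarrow> 0 + 2 * ahat) at_top" by (intro tendsto_intros)
  moreover have "\<forall>\<^sub>F \<tau> in at_top. eps \<tau> * ?R \<tau> + 2 * ahat = eps \<tau> * (f \<tau> - \<tau>)"
    using eventually_gt_at_top[of 0]
  proof eventually_elim
    case (elim \<tau>)
    have "eps \<tau> * sqrt (2 * \<tau>) = sqrt (2 / \<tau> * (2 * \<tau>))" unfolding eps_def real_sqrt_mult ..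
    also have "\<dots> = 2" using elim by simp
    finally have s: "eps \<tau> * sqrt (2 * \<tau>) = 2" .
    have "eps \<tau> * ?R \<tau> = eps \<tau> * (f \<tau> - \<tau>) - (eps \<tau> * sqrt (2 * \<tau>)) * ahat" by (simp add: algebra_simps)
    then show ?case unfolding s by simp
  qed
  ultimately show ?thesis by (simp add: Lim_transform_eventually)
qed

theorem theorem5p8:
  fixes r p \<eta> :: nat
    and n m :: "nat \<Rightarrow> nat"
    and a b \<beta> :: "nat \<Rightarrow> real \<Rightarrow> real"
    and ahat :: real
    and \<rho> d \<xi> :: "nat \<Rightarrow> real"
    and BL :: "real \<Rightarrow> real \<Rightarrow> real"
  assumes "p \<ge> 1"
    and "\<forall>\<^sub>F \<tau> in at_top. (\<forall>\<nu>\<in>{1..r+1}. a \<nu> \<tau> > -1) \<and> (\<forall>h\<in>{1..r}. b h \<tau> > a h \<tau>)"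
    and "(\<lambda>\<tau>. a (r+1) \<tau> + 1 - (\<tau> + sqrt (2 * \<tau>) * ahat)) \<in> O[at_top](\<lambda>_. 1)"
    and "\<And>h. h \<in> {1..r} \<Longrightarrow> \<rho> h > 0"
    and "\<And>h. h \<in> {1..r} \<Longrightarrow> ((\<lambda>\<tau>. eps \<tau> * (a h \<tau> + 1)) \<longlongrightarrow> \<rho> h) at_top"
    and "\<And>h. h \<in> {1..r} \<Longrightarrow> d h \<ge> 0"
    and "\<And>h. h \<in> {1..r} \<Longrightarrow> ((\<lambda>\<tau>. b h \<tau> - a h \<tau>) \<longlongrightarrow> d h) at_top"
    and "\<And>i. i \<in> {1..p} \<Longrightarrow> ((\<lambda>\<tau>. eps \<tau> * \<beta> i \<tau>) \<longlongrightarrow> \<xi> i) at_top"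
    and "\<And>i h. i \<in> {1..p} \<Longrightarrow> h \<in> {1..r} \<Longrightarrow> \<xi> i + \<rho> h > 0"
    and "inj_on \<xi> {1..p}"
    and "near_diagonal r n \<eta>"
    and "(\<Sum>i=1..p. m i) + 1 = (\<Sum>h=1..r. n h) + \<eta>"
    and "\<forall>\<^sub>F \<tau> in at_top.
           laguerre_rep r p (\<lambda>\<nu>. a \<nu> \<tau>) (\<lambda>h. b h \<tau>) (\<lambda>i. \<beta> i \<tau>) n m (BL \<tau>)"
  shows "\<exists>BH :: real \<Rightarrow> real.
     \<comment> \<open>Rodrigues representation; smoothness makes the derivatives in it meaningful\<close>
     smooth (K_part r \<rho> n (F_fun r \<rho> d ahat)) \<and>
     BH = D_part p \<xi> m (K_part r \<rho> n (F_fun r \<rho> d ahat)) \<and>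
     \<comment> \<open>distributional convergence\<close>
     tendsto_distr
       (\<lambda>\<tau> t. if t > - inverse (eps \<tau>) then rescaled r a b \<eta> BL \<tau> t else 0) BH at_top \<and>
     \<comment> \<open>convergence of weighted moments\<close>
     (\<forall>k. \<forall>i\<in>{1..p}.
        (\<forall>\<^sub>F \<tau> in at_top. set_integrable lborel {- inverse (eps \<tau>)<..}
           (\<lambda>t. t ^ k * (1 + eps \<tau> * t) powr \<beta> i \<tau> * rescaled r a b \<eta> BL \<tau> t)) \<and>
        integrable lborel (\<lambda>t. t ^ k * exp (\<xi> i * t) * BH t) \<and>
        ((\<lambda>\<tau>. LINT t:{- inverse (eps \<tau>)<..}|lborel.
             t ^ k * (1 + eps \<tau> * t) powr \<beta> i \<tau> * rescaled r a b \<eta> BL \<tau> t)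
          \<longlongrightarrow> (LINT t|lborel. t ^ k * exp (\<xi> i * t) * BH t)) at_top) \<and>
     \<comment> \<open>Laplace transforms of \<open>F\<close> and of the limit\<close>
     (\<forall>z::complex. (r > 0 \<longrightarrow> Re z > - Min (\<rho> ` {1..r})) \<longrightarrow>
        bilateral_laplace_exists (F_fun r \<rho> d ahat) z \<and>
        bilateral_laplace (F_fun r \<rho> d ahat) z =
          exp (of_real ahat * z + z\<^sup>2 / 4)
            * (\<Prod>h=1..r. (of_real (\<rho> h) / (of_real (\<rho> h) + z)) powr of_real (d h)) \<and>
        bilateral_laplace_exists BH z \<and>
        bilateral_laplace BH z =
          bilateral_laplace (F_fun r \<rho> d ahat) z
            * ((\<Prod>i=1..p. (of_real (\<xi> i) - z) ^ m i)
               / (\<Prod>h=1..r. (of_real (\<rho> h) + z) ^ n h))) \<and>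
     \<comment> \<open>orthogonality\<close>
     (\<forall>i\<in>{1..p}. \<forall>k<m i. (LINT t|lborel. t ^ k * exp (\<xi> i * t) * BH t) = 0)"
proof -
  let ?F = "F_fun r \<rho> d ahat"
  let ?K = "K_part r \<rho> n ?F"
  let ?BH = "D_part p \<xi> m ?K"
  let ?R = "\<lambda>\<tau> t. if t > - inverse (eps \<tau>) then rescaled r a b \<eta> BL \<tau> t else 0"
  let ?f = "\<lambda>k i \<tau> t. t ^ k * (1 + eps \<tau> * t) powr \<beta> i \<tau> * rescaled r a b \<eta> BL \<tau> t"
  note \<rho>_pos = assms(4) and d_nonneg = assms(6)
  have dF: "decaying (strip r \<rho>) ?F" by (rule F_fun_strip(1)) (auto simp: \<rho>_pos d_nonneg)
  have dK: "decaying (strip r \<rho>) ?K" by (rule K_part_strip(1)) (auto simp: \<rho>_pos dF)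
  have dB: "decaying (strip r \<rho>) ?BH" by (rule D_part_strip(1)[OF open_strip dK])
  have zero: "0 \<in> strip r \<rho>" using \<rho>_pos by (auto simp: strip_def)
  \<comment> \<open>Any sequence tending to infinity has a tail on which the eventual hypotheses
    hold at every index; that tail instantiates the locale.\<close>
  have seq: "\<exists>N. laguerre_limit r p \<eta> n m a b \<beta> ahat \<rho> d \<xi> BL (\<lambda>j. X (j + N))"
    if X: "filterlim X at_top sequentially" for X
  proof -
    let ?good = "\<lambda>\<tau>. \<tau> > 0 \<and> ((\<forall>\<nu>\<in>{1..r+1}. a \<nu> \<tau> > -1) \<and> (\<forall>h\<in>{1..r}. b h \<tau> > a h \<tau>)) \<and>
      laguerre_rep r p (\<lambda>\<nu>. a \<nu> \<tau>) (\<lambda>h. b h \<tau>) (\<lambda>i. \<beta> i \<tau>) n m (BL \<tau>)"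
    have "\<forall>\<^sub>F \<tau> in at_top. ?good \<tau>"
      using eventually_gt_at_top[of 0] assms(2) assms(13) by eventually_elim blast
    then have "\<forall>\<^sub>F j in sequentially. ?good (X j)" using X by (rule eventually_compose_filterlim)
    then obtain N where N: "\<And>j. j \<ge> N \<Longrightarrow> ?good (X j)" unfolding eventually_sequentially by blast
    let ?T = "\<lambda>j. X (j + N)"
    have T: "filterlim ?T at_top sequentially" by (rule filterlim_compose[OF X filterlim_add_const_nat_at_top])
    have "laguerre_limit r p \<eta> n m a b \<beta> ahat \<rho> d \<xi> BL ?T"
    proof
      show "(\<lambda>j. eps (?T j) * (a (r + 1) (?T j) + 1 - ?T j)) \<longlonglongrightarrow> 2 * ahat"
        by (rule filterlim_compose[OF eps_centering_limit[OF assms(3)] T])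
    next
      fix h assume h: "h \<in> {1..r}"
      show "(\<lambda>j. eps (?T j) * (a h (?T j) + 1)) \<longlonglongrightarrow> \<rho> h" by (rule filterlim_compose[OF assms(5)[OF h] T])
      show "(\<lambda>j. b h (?T j) - a h (?T j)) \<longlonglongrightarrow> d h" by (rule filterlim_compose[OF assms(7)[OF h] T])
    next
      fix i assume i: "i \<in> {1..p}"
      show "(\<lambda>j. eps (?T j) * \<beta> i (?T j)) \<longlonglongrightarrow> \<xi> i" by (rule filterlim_compose[OF assms(8)[OF i] T])
    qed (use T N assms(4,6,9,12) in auto)
    then show ?thesis by blast
  qed
  have distr: "tendsto_distr ?R ?BH at_top"
    unfolding tendsto_distr_def
  proof (intro conjI allI impI)
    show "\<forall>\<^sub>F \<tau> in at_top. locally_integrable (?R \<tau>)"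
    proof (rule eventually_at_topI_sequentially)
      fix X :: "nat \<Rightarrow> real" assume "filterlim X at_top sequentially"
      then obtain N where "laguerre_limit r p \<eta> n m a b \<beta> ahat \<rho> d \<xi> BL (\<lambda>j. X (j + N))" using seq by blast
      then interpret laguerre_limit r p \<eta> n m a b \<beta> ahat \<rho> d \<xi> BL "\<lambda>j. X (j + N)" .
      \<comment> \<open>One index of the trimmed sequence suffices, so index 0 is taken.\<close>
      have "integrable lborel (\<lambda>t. indicator {- inverse (eps (X (0 + N)))<..} t *\<^sub>R rescaled r a b \<eta> BL (X (0 + N)) t)"
        using rescaled_integrable[of 0] unfolding set_integrable_def .
      also have "(\<lambda>t. indicator {- inverse (eps (X (0 + N)))<..} t *\<^sub>R rescaled r a b \<eta> BL (X (0 + N)) t) = ?R (X (0 + N))"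
        by (auto simp: indicator_def fun_eq_iff)
      finally show "\<exists>j. locally_integrable (?R (X j))" using integrable_imp_locally_integrable by blast
    qed
    show "locally_integrable ?BH"
      using decaying_integrable[OF open_strip dB zero] by (intro integrable_imp_locally_integrable) simp
    fix \<phi> assume \<phi>: "test_fun \<phi>"
    show "((\<lambda>\<tau>. LINT t|lborel. ?R \<tau> t * \<phi> t) \<longlongrightarrow> (LINT t|lborel. ?BH t * \<phi> t)) at_top"
    proof (rule tendsto_at_top_sequentiallyI)
      fix X :: "nat \<Rightarrow> real" assume "filterlim X at_top sequentially"
      then obtain N where L: "laguerre_limit r p \<eta> n m a b \<beta> ahat \<rho> d \<xi> BL (\<lambda>j. X (j + N))" using seq by blast
      from laguerre_limit.distribution_tendsto[OF L \<phi>]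
      show "\<exists>N. (\<lambda>j. LINT t|lborel. ?R (X (j + N)) t * \<phi> t) \<longlonglongrightarrow> (LINT t|lborel. ?BH t * \<phi> t)"
        unfolding laguerre_limit.BH_def[OF L] by blast
    qed
  qed
  have moments: "(\<forall>\<^sub>F \<tau> in at_top. set_integrable lborel {- inverse (eps \<tau>)<..} (?f k i \<tau>)) \<and>
        integrable lborel (\<lambda>t. t ^ k * exp (\<xi> i * t) * ?BH t) \<and>
        ((\<lambda>\<tau>. LINT t:{- inverse (eps \<tau>)<..}|lborel. ?f k i \<tau> t)
          \<longlongrightarrow> (LINT t|lborel. t ^ k * exp (\<xi> i * t) * ?BH t)) at_top"
    if i: "i \<in> {1..p}" for k i
  proof (intro conjI)
    show "\<forall>\<^sub>F \<tau> in at_top. set_integrable lborel {- inverse (eps \<tau>)<..} (?f k i \<tau>)"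
    proof (rule eventually_at_topI_sequentially)
      fix X :: "nat \<Rightarrow> real" assume "filterlim X at_top sequentially"
      then obtain N where L: "laguerre_limit r p \<eta> n m a b \<beta> ahat \<rho> d \<xi> BL (\<lambda>j. X (j + N))" using seq by blast
      from eventually_happens'[OF sequentially_bot laguerre_limit.moment_eventually[OF L i, of k]]
      show "\<exists>j. set_integrable lborel {- inverse (eps (X j))<..} (?f k i (X j))" by blast
    qed
    show "integrable lborel (\<lambda>t. t ^ k * exp (\<xi> i * t) * ?BH t)"
      by (rule decaying_moment_integrable[OF open_strip dB]) (use assms(9)[OF i] in \<open>fastforce simp: strip_def\<close>)
    show "((\<lambda>\<tau>. LINT t:{- inverse (eps \<tau>)<..}|lborel. ?f k i \<tau> t)
          \<longlongrightarrow> (LINT t|lborel. t ^ k * exp (\<xi> i * t) * ?BH t)) at_top"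
    proof (rule tendsto_at_top_sequentiallyI)
      fix X :: "nat \<Rightarrow> real" assume "filterlim X at_top sequentially"
      then obtain N where L: "laguerre_limit r p \<eta> n m a b \<beta> ahat \<rho> d \<xi> BL (\<lambda>j. X (j + N))" using seq by blast
      from laguerre_limit.moment_tendsto[OF L i, of k]
      show "\<exists>N. (\<lambda>j. LINT t:{- inverse (eps (X (j + N)))<..}|lborel. ?f k i (X (j + N)) t)
          \<longlonglongrightarrow> (LINT t|lborel. t ^ k * exp (\<xi> i * t) * ?BH t)"
        unfolding laguerre_limit.BH_def[OF L] by blast
    qed
  qed
  have orth: "(LINT t|lborel. t ^ k * exp (\<xi> i * t) * ?BH t) = 0" if "i \<in> {1..p}" "k < m i" for i k
  proof -
    \<comment> \<open>Orthogonality no longer mentions \<tau>, so a single sequence, here that of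
      the natural numbers, is enough.\<close>
    obtain N where L: "laguerre_limit r p \<eta> n m a b \<beta> ahat \<rho> d \<xi> BL (\<lambda>j. real (j + N))"
      using seq[OF filterlim_real_sequentially] by blast
    from laguerre_limit.BH_orthogonal[OF L that] show ?thesis unfolding laguerre_limit.BH_def[OF L] .
  qed
  have laplace: "bilateral_laplace_exists ?F z \<and>
        bilateral_laplace ?F z = exp (of_real ahat * z + z\<^sup>2 / 4)
            * (\<Prod>h=1..r. (of_real (\<rho> h) / (of_real (\<rho> h) + z)) powr of_real (d h)) \<and>
        bilateral_laplace_exists ?BH z \<and>
        bilateral_laplace ?BH z = bilateral_laplace ?F z
            * ((\<Prod>i=1..p. (of_real (\<xi> i) - z) ^ m i) / (\<Prod>h=1..r. (of_real (\<rho> h) + z) ^ n h))"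
    if "r > 0 \<longrightarrow> Re z > - Min (\<rho> ` {1..r})" for z
  proof -
    have z: "Re z \<in> strip r \<rho>"
      unfolding strip_def
    proof (intro CollectI ballI)
      fix h assume h: "h \<in> {1..r}"
      then have "Min (\<rho> ` {1..r}) \<le> \<rho> h" by (intro Min_le) auto
      with that h show "- \<rho> h < Re z" by auto
    qed
    have LF: "bilateral_laplace ?F z = exp (of_real ahat * z + z\<^sup>2 / 4)
            * (\<Prod>h=1..r. (of_real (\<rho> h) / (of_real (\<rho> h) + z)) powr of_real (d h))"
      by (rule F_fun_strip(2)) (auto simp: \<rho>_pos d_nonneg z)
    have LK: "bilateral_laplace ?K z = bilateral_laplace ?F z / (\<Prod>h=1..r. (of_real (\<rho> h) + z) ^ n h)"
      by (rule K_part_strip(2)) (auto simp: \<rho>_pos dF z)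
    have LB: "bilateral_laplace ?BH z = bilateral_laplace ?F z
            * ((\<Prod>i=1..p. (of_real (\<xi> i) - z) ^ m i) / (\<Prod>h=1..r. (of_real (\<rho> h) + z) ^ n h))"
      unfolding D_part_strip(2)[OF open_strip dK z] LK by simp
    from decaying_laplace_exists[OF open_strip dF z] decaying_laplace_exists[OF open_strip dB z] LF LB
    show ?thesis by blast
  qed
  show ?thesis
    by (rule exI[of _ ?BH], intro conjI)
       (use decaying_smooth[OF dK] distr moments laplace orth in blast)+
qed

end
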